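(* Let $f \colon \mathcal{M} \to \mathbb{R}$ be $C^2$ and assume that either of the following holds: 1. $\mathcal{M} = \mathbb{R}^n$ (with the Euclidean metric) and $\mathrm{R}_x(v) = x+v$; or (more generally) 2. $\mathcal{M}$ is a real-analytic manifold with a Riemannian metric and a retraction $\mathrm{R} \colon \mathrm{T}\mathcal{M} \to \mathcal{M}$ and, for all $x \in \mathcal{M}$, the map $v \mapsto \mathrm{R}_x(v)$ from $\mathrm{T}_x\mathcal{M}$ to $\mathcal{M}$ is real analytic. Then, for all $\tau, r \in (0,1)$, all $\varepsilon>0$ and (Lebesgue-)almost all $\bar\alpha > 0$, the stabilized backtracking gradient descent algorithm described in the context avoids the strict saddles of $f$; that is, the set of initial points $x_0 \in \mathcal{M}$ for which the generated sequence $(x_t)_{t\ge0}$ converges to a strict saddle of $f$ has measure zero in $\mathcal{M}$.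
   Context: Manifolds are finite-dimensional, Hausdorff and second countable. A subset $A$ of a smooth $n$-dimensional manifold $\mathcal{M}$ has measure zero if for every smooth chart $(U,\varphi)$ the set $\varphi(A\cap U) \subseteq \mathbb{R}^n$ has Lebesgue measure zero. $\mathrm{grad} f$ and $\mathrm{Hess} f$ denote the Riemannian gradient and Hessian; a strict saddle of $f$ is a point $x^*$ with $\mathrm{grad} f(x^* ) = 0$ at which $\mathrm{Hess} f(x^* )$ has at least one negative eigenvalue. A retraction is a smooth map $\mathrm{R} \colon \mathrm{T}\mathcal{M} \to \mathcal{M}$, $(x,v) \mapsto \mathrm{R}_x(v)$, defined on the whole tangent bundle, such that each curve $c(t) = \mathrm{R}_x(tv)$ satisfies $c(0)=x$ and $c'(0)=v$. A map between real-analytic manifolds is real analytic if it is given by locally convergent power series in real-analytic charts. Stabilized backtracking (Riemannian) gradient descent. Inputs: $\tau, r \in (0,1)$, $\bar\alpha > 0$, $\varepsilon > 0$, $x_0 \in \mathcal{M}$. Set $\alpha_0 \leftarrow \bar\alpha$. For $t = 0, 1, 2, \dots$: (i) while $f(x_t) - f(\mathrm{R}_{x_t}(-\alpha_t\, \mathrm{grad} f(x_t))) < r\, \alpha_t \|\mathrm{grad} f(x_t)\|^2$, replace $\alpha_t \leftarrow \tau \alpha_t$; (ii) with the resulting value of $\alpha_t$, set $x_{t+1} \leftarrow \mathrm{R}_{x_t}(-\alpha_t\, \mathrm{grad} f(x_t))$; (iii) if $\|\mathrm{grad} f(x_{t+1})\| \ge \varepsilon$, set $\alpha_{t+1} \leftarrow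 \bar\alpha$; otherwise set $\alpha_{t+1} \leftarrow \alpha_t$ (the value used in (ii)). *)

theory Defs
  imports "HOL-Analysis.Analysis" "HOL-Library.While_Combinator"
begin

section \<open>Regularity classes on open subsets of Euclidean space\<close>

text \<open>
  The predicates of this section are only used for open sets.  For open subsets of a
  finite-dimensional space, the recursion below (all iterated directional derivatives exist as
  Frechet derivatives and are continuous) is the usual class of $k$ times continuously
  differentiable functions.
\<close>

primrec Ck_on :: "nat \<Rightarrow> 'a::real_normed_vector set \<Rightarrow> ('a \<Rightarrow> 'b::real_normed_vector) \<Rightarrow> bool" where
  "Ck_on 0 S f \<longleftrightarrow> continuous_on S f"
| "Ck_on (Suc k) S f \<longleftrightarrow>
     (\<forall>x\<in>S. f differentiable (at x)) \<and> (\<forall>v. Ck_on k S (\<lambda>x. frechet_derivative f (at x) v))"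

definition smooth_on :: "'a::real_normed_vector set \<Rightarrow> ('a \<Rightarrow> 'b::real_normed_vector) \<Rightarrow> bool" where
  "smooth_on S f \<longleftrightarrow> (\<forall>k. Ck_on k S f)"

text \<open>
  Local expansion into a multivariate power series.  The multi-indices are the functions
  \<open>\<kappa> \<in> Basis \<rightarrow>\<^sub>E UNIV\<close>, assigning an exponent to every coordinate direction.
\<close>

definition real_analytic_on ::
    "'a::euclidean_space set \<Rightarrow> ('a \<Rightarrow> 'b::euclidean_space) \<Rightarrow> bool" where
  "real_analytic_on S f \<longleftrightarrow>
     (\<forall>a\<in>S. \<exists>\<rho>>0. \<exists>coef :: ('a \<Rightarrow> nat) \<Rightarrow> 'b. \<forall>x\<in>ball a \<rho>.
        ((\<lambda>\<kappa>. (\<Prod>b\<in>Basis. ((x - a) \<bullet> b) ^ \<kappa> b) *\<^sub>R coef \<kappa>) has_sum f x) (Basis \<rightarrow>\<^sub>E UNIV))"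


section \<open>Charts and atlases\<close>

text \<open>
  The manifold is the whole type \<open>'m\<close>, whose topology is Hausdorff and second countable by its
  type classes.  The model space \<open>'e\<close> fixes the dimension \<open>DIM('e)\<close>.  A chart is a pair
  \<open>(U, \<phi>)\<close>; the values of \<open>\<phi>\<close> outside \<open>U\<close> are irrelevant.
\<close>

type_synonym ('m, 'e) chart = "'m set \<times> ('m \<Rightarrow> 'e)"

abbreviation cdom :: "('m, 'e) chart \<Rightarrow> 'm set" where "cdom \<equiv> fst"
abbreviation cmap :: "('m, 'e) chart \<Rightarrow> 'm \<Rightarrow> 'e" where "cmap \<equiv> snd"
abbreviation cimg :: "('m, 'e) chart \<Rightarrow> 'e set" where "cimg c \<equiv> cmap c ` cdom c"
abbreviation cinv :: "('m, 'e) chart \<Rightarrow> 'e \<Rightarrow> 'm" where "cinv c \<equiv> inv_into (cdom c) (cmap c)"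

definition is_chart :: "('m::topological_space, 'e::euclidean_space) chart \<Rightarrow> bool" where
  "is_chart c \<longleftrightarrow> open (cdom c) \<and> open (cimg c) \<and> homeomorphism (cdom c) (cimg c) (cmap c) (cinv c)"

text \<open>
  \<open>P\<close> is the regularity class of the transition maps, either \<open>smooth_on\<close> or
  \<open>real_analytic_on\<close>.
\<close>

definition compatible ::
    "('e set \<Rightarrow> ('e \<Rightarrow> 'e) \<Rightarrow> bool) \<Rightarrow> ('m, 'e) chart \<Rightarrow> ('m, 'e) chart \<Rightarrow> bool" where
  "compatible P c d \<longleftrightarrow>
     P (cmap c ` (cdom c \<inter> cdom d)) (cmap d \<circ> cinv c) \<and>
     P (cmap d ` (cdom c \<inter> cdom d)) (cmap c \<circ> cinv d)"

definition is_atlas ::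
    "('e set \<Rightarrow> ('e \<Rightarrow> 'e) \<Rightarrow> bool) \<Rightarrow> ('m::topological_space, 'e::euclidean_space) chart set \<Rightarrow> bool"
  where
  "is_atlas P A \<longleftrightarrow>
     (\<forall>c\<in>A. is_chart c) \<and> (\<Union>c\<in>A. cdom c) = UNIV \<and> (\<forall>c\<in>A. \<forall>d\<in>A. compatible P c d)"

abbreviation real_analytic_atlas ::
    "('m::topological_space, 'e::euclidean_space) chart set \<Rightarrow> bool" where
  "real_analytic_atlas \<equiv> is_atlas real_analytic_on"

text \<open>All charts of the smooth structure generated by \<open>A\<close> (the maximal smooth atlas).\<close>

definition smooth_charts ::
    "('m::topological_space, 'e::euclidean_space) chart set \<Rightarrow> ('m, 'e) chart set" where
  "smooth_charts A = {c. is_chart c \<and> (\<forall>d\<in>A. compatible smooth_on c d)}"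

definition measure_zero ::
    "('m::topological_space, 'e::euclidean_space) chart set \<Rightarrow> 'm set \<Rightarrow> bool" where
  "measure_zero A N \<longleftrightarrow> (\<forall>c\<in>smooth_charts A. cmap c ` (N \<inter> cdom c) \<in> null_sets lebesgue)"

definition Ck_fun ::
    "nat \<Rightarrow> ('m::topological_space, 'e::euclidean_space) chart set \<Rightarrow> ('m \<Rightarrow> real) \<Rightarrow> bool" where
  "Ck_fun k A f \<longleftrightarrow> (\<forall>c\<in>A. Ck_on k (cimg c) (f \<circ> cinv c))"

text \<open>A map of class \<open>P\<close> from an open subset \<open>S\<close> of a vector space into the manifold.\<close>

definition map_into ::
    "('a set \<Rightarrow> ('a \<Rightarrow> 'e) \<Rightarrow> bool) \<Rightarrow> ('m::topological_space, 'e::euclidean_space) chart set \<Rightarrow>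
     'a::topological_space set \<Rightarrow> ('a \<Rightarrow> 'm) \<Rightarrow> bool" where
  "map_into P A S F \<longleftrightarrow>
     continuous_on S F \<and> (\<forall>d\<in>A. P (S \<inter> F -` cdom d) (cmap d \<circ> F))"


section \<open>Tangent vectors\<close>

text \<open>
  A tangent vector at \<open>x\<close> is the family of its components in all charts around \<open>x\<close>, the
  components transforming by the derivatives of the transition maps.  At indices that are not
  charts around \<open>x\<close> the family is zero, so that equality of tangent vectors is equality of
  functions and the vector space operations are pointwise.
\<close>

type_synonym ('m, 'e) tvec = "('m, 'e) chart \<Rightarrow> 'e"

definition charts_at :: "('m, 'e) chart set \<Rightarrow> 'm \<Rightarrow> ('m, 'e) chart set" where
  "charts_at A x = {c\<in>A. x \<in> cdom c}"

definition transition_deriv ::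
    "('m, 'e::euclidean_space) chart \<Rightarrow> ('m, 'e) chart \<Rightarrow> 'm \<Rightarrow> 'e \<Rightarrow> 'e" where
  "transition_deriv c d x = frechet_derivative (cmap d \<circ> cinv c) (at (cmap c x))"

definition tangent_space ::
    "('m, 'e::euclidean_space) chart set \<Rightarrow> 'm \<Rightarrow> ('m, 'e) tvec set" where
  "tangent_space A x =
     {v. (\<forall>c. c \<notin> charts_at A x \<longrightarrow> v c = 0) \<and>
         (\<forall>c\<in>charts_at A x. \<forall>d\<in>charts_at A x. v d = transition_deriv c d x (v c))}"

definition tscale :: "real \<Rightarrow> ('m, 'e::euclidean_space) tvec \<Rightarrow> ('m, 'e) tvec" where
  "tscale s v = (\<lambda>c. s *\<^sub>R v c)"

definition tadd :: "('m, 'e::euclidean_space) tvec \<Rightarrow> ('m, 'e) tvec \<Rightarrow> ('m, 'e) tvec" where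
  "tadd u v = (\<lambda>c. u c + v c)"

definition tzero :: "('m, 'e::euclidean_space) tvec" where
  "tzero = (\<lambda>c. 0)"

text \<open>The tangent vector at \<open>x\<close> whose component in the chart \<open>c\<close> is \<open>a\<close>.\<close>

definition coord_vec ::
    "('m, 'e::euclidean_space) chart set \<Rightarrow> ('m, 'e) chart \<Rightarrow> 'm \<Rightarrow> 'e \<Rightarrow> ('m, 'e) tvec" where
  "coord_vec A c x a = (\<lambda>d. if d \<in> charts_at A x then transition_deriv c d x a else 0)"

definition has_velocity ::
    "('m::topological_space, 'e::euclidean_space) chart set \<Rightarrow> (real \<Rightarrow> 'm) \<Rightarrow> ('m, 'e) tvec \<Rightarrow>
     real \<Rightarrow> bool" where
  "has_velocity A \<gamma> v t \<longleftrightarrow>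
     isCont \<gamma> t \<and> v \<in> tangent_space A (\<gamma> t) \<and>
     (\<forall>c\<in>charts_at A (\<gamma> t). ((cmap c \<circ> \<gamma>) has_vector_derivative v c) (at t))"


section \<open>Riemannian metrics, gradient and Hessian\<close>

type_synonym ('m, 'e) metric = "'m \<Rightarrow> ('m, 'e) tvec \<Rightarrow> ('m, 'e) tvec \<Rightarrow> real"

text \<open>The coefficients of the metric at the point with coordinates \<open>y\<close> in the chart \<open>c\<close>,
  as a bilinear form on the model space.\<close>

definition metric_coeff ::
    "('m, 'e::euclidean_space) chart set \<Rightarrow> ('m, 'e) metric \<Rightarrow> ('m, 'e) chart \<Rightarrow>
     'e \<Rightarrow> 'e \<Rightarrow> 'e \<Rightarrow> real" where
  "metric_coeff A g c y a b =
     g (cinv c y) (coord_vec A c (cinv c y) a) (coord_vec A c (cinv c y) b)"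

definition riemannian_metric ::
    "('m, 'e::euclidean_space) chart set \<Rightarrow> ('m, 'e) metric \<Rightarrow> bool" where
  "riemannian_metric A g \<longleftrightarrow>
     (\<forall>x. \<forall>u\<in>tangent_space A x.
        (\<forall>v\<in>tangent_space A x. g x u v = g x v u) \<and>
        (\<forall>v\<in>tangent_space A x. \<forall>w\<in>tangent_space A x. g x (tadd u v) w = g x u w + g x v w) \<and>
        (\<forall>v\<in>tangent_space A x. \<forall>s. g x (tscale s u) v = s * g x u v) \<and>
        (u \<noteq> tzero \<longrightarrow> g x u u > 0)) \<and>
     (\<forall>c\<in>A. \<forall>a b. smooth_on (cimg c) (\<lambda>y. metric_coeff A g c y a b))"

definition tnorm :: "('m, 'e) metric \<Rightarrow> 'm \<Rightarrow> ('m, 'e) tvec \<Rightarrow> real" where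
  "tnorm g x v = sqrt (g x v v)"

text \<open>The Riesz representative of the differential of \<open>f\<close> at \<open>x\<close>.\<close>

definition grad ::
    "('m, 'e::euclidean_space) chart set \<Rightarrow> ('m, 'e) metric \<Rightarrow> ('m \<Rightarrow> real) \<Rightarrow>
     'm \<Rightarrow> ('m, 'e) tvec" where
  "grad A g f x =
     (THE u. u \<in> tangent_space A x \<and>
        (\<forall>c\<in>charts_at A x. \<forall>v\<in>tangent_space A x.
           g x u v = frechet_derivative (f \<circ> cinv c) (at (cmap c x)) (v c)))"

text \<open>
  Christoffel symbols of the Levi-Civita connection in the chart \<open>c\<close>, as a bilinear map on the
  model space.  This is the Koszul formula for constant coordinate fields (whose brackets vanish).
\<close>

definition christoffel ::
    "('m, 'e::euclidean_space) chart set \<Rightarrow> ('m, 'e) metric \<Rightarrow> ('m, 'e) chart \<Rightarrow>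
     'e \<Rightarrow> 'e \<Rightarrow> 'e \<Rightarrow> 'e" where
  "christoffel A g c y a b =
     (THE z. \<forall>w. 2 * metric_coeff A g c y z w =
        frechet_derivative (\<lambda>y. metric_coeff A g c y b w) (at y) a +
        frechet_derivative (\<lambda>y. metric_coeff A g c y a w) (at y) b -
        frechet_derivative (\<lambda>y. metric_coeff A g c y a b) (at y) w)"

text \<open>Levi-Civita covariant derivative of the vector field \<open>X\<close> at \<open>x\<close> in the direction \<open>v\<close>.\<close>

definition cov_deriv ::
    "('m, 'e::euclidean_space) chart set \<Rightarrow> ('m, 'e) metric \<Rightarrow> ('m \<Rightarrow> ('m, 'e) tvec) \<Rightarrow>
     'm \<Rightarrow> ('m, 'e) tvec \<Rightarrow> ('m, 'e) tvec" where
  "cov_deriv A g X x v =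
     (THE u. u \<in> tangent_space A x \<and>
        (\<forall>c\<in>charts_at A x.
           u c = frechet_derivative (\<lambda>y. X (cinv c y) c) (at (cmap c x)) (v c) +
                 christoffel A g c (cmap c x) (v c) (X x c)))"

definition Hess ::
    "('m, 'e::euclidean_space) chart set \<Rightarrow> ('m, 'e) metric \<Rightarrow> ('m \<Rightarrow> real) \<Rightarrow>
     'm \<Rightarrow> ('m, 'e) tvec \<Rightarrow> ('m, 'e) tvec" where
  "Hess A g f x v = cov_deriv A g (grad A g f) x v"

definition strict_saddle ::
    "('m, 'e::euclidean_space) chart set \<Rightarrow> ('m, 'e) metric \<Rightarrow> ('m \<Rightarrow> real) \<Rightarrow> 'm \<Rightarrow> bool" where
  "strict_saddle A g f x \<longleftrightarrow>
     grad A g f x = tzero \<and>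
     (\<exists>\<mu><0. \<exists>v\<in>tangent_space A x. v \<noteq> tzero \<and> Hess A g f x v = tscale \<mu> v)"


section \<open>Retractions\<close>

text \<open>
  Maps on the tangent bundle are given as \<open>R x v\<close> and only matter for \<open>v \<in> tangent_space A x\<close>.
  Smoothness is smoothness in the bundle charts \<open>(x, v) \<mapsto> (cmap c x, v c)\<close>, whose images
  are \<open>cimg c \<times> UNIV\<close>.
\<close>

definition is_retraction ::
    "('m::topological_space, 'e::euclidean_space) chart set \<Rightarrow> ('m \<Rightarrow> ('m, 'e) tvec \<Rightarrow> 'm) \<Rightarrow> bool"
  where
  "is_retraction A R \<longleftrightarrow>
     (\<forall>c\<in>A. map_into smooth_on A (cimg c \<times> UNIV)
        (\<lambda>(y, a). R (cinv c y) (coord_vec A c (cinv c y) a))) \<and>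
     (\<forall>x. \<forall>v\<in>tangent_space A x.
        R x (tscale 0 v) = x \<and> has_velocity A (\<lambda>t. R x (tscale t v)) v 0)"

text \<open>Each map \<open>R x\<close> is real analytic on the vector space \<open>tangent_space A x\<close>, which is
  identified with the model space by the linear coordinates that a chart around \<open>x\<close> provides.\<close>

definition fiberwise_real_analytic ::
    "('m::topological_space, 'e::euclidean_space) chart set \<Rightarrow> ('m \<Rightarrow> ('m, 'e) tvec \<Rightarrow> 'm) \<Rightarrow> bool"
  where
  "fiberwise_real_analytic A R \<longleftrightarrow>
     (\<forall>x. \<forall>c\<in>charts_at A x.
        map_into real_analytic_on A UNIV (\<lambda>a. R x (coord_vec A c x a)))"


section \<open>Euclidean space as a Riemannian manifold\<close>

definition euclidean_chart :: "('e::euclidean_space, 'e) chart" where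
  "euclidean_chart = (UNIV, \<lambda>x. x)"

definition euclidean_atlas :: "('e::euclidean_space, 'e) chart set" where
  "euclidean_atlas = {euclidean_chart}"

definition flat_metric :: "('e::euclidean_space, 'e) metric" where
  "flat_metric x u v = u euclidean_chart \<bullet> v euclidean_chart"

definition translation_retraction :: "'e::euclidean_space \<Rightarrow> ('e, 'e) tvec \<Rightarrow> 'e" where
  "translation_retraction x v = x + v euclidean_chart"


section \<open>Stabilized backtracking gradient descent\<close>

definition gd_step ::
    "('m, 'e::euclidean_space) chart set \<Rightarrow> ('m, 'e) metric \<Rightarrow> ('m \<Rightarrow> ('m, 'e) tvec \<Rightarrow> 'm) \<Rightarrow>
     ('m \<Rightarrow> real) \<Rightarrow> real \<Rightarrow> 'm \<Rightarrow> 'm" where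
  "gd_step A g R f \<alpha> x = R x (tscale (- \<alpha>) (grad A g f x))"

text \<open>The backtracking loop terminates for every \<open>\<alpha> > 0\<close> when \<open>f\<close> is differentiable and
  \<open>\<tau>, r \<in> (0,1)\<close>, so the value of \<open>while\<close> is the one computed by the loop.\<close>

definition backtrack ::
    "('m, 'e::euclidean_space) chart set \<Rightarrow> ('m, 'e) metric \<Rightarrow> ('m \<Rightarrow> ('m, 'e) tvec \<Rightarrow> 'm) \<Rightarrow>
     ('m \<Rightarrow> real) \<Rightarrow> real \<Rightarrow> real \<Rightarrow> 'm \<Rightarrow> real \<Rightarrow> real" where
  "backtrack A g R f \<tau> r x =
     while (\<lambda>\<alpha>. f x - f (gd_step A g R f \<alpha> x) < r * \<alpha> * (tnorm g x (grad A g f x))\<^sup>2)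
           (\<lambda>\<alpha>. \<tau> * \<alpha>)"

text \<open>The state after \<open>t\<close> iterations is \<open>x\<^sub>t\<close> together with the value of \<open>\<alpha>\<^sub>t\<close> before
  backtracking.\<close>

primrec sbgd_state ::
    "('m, 'e::euclidean_space) chart set \<Rightarrow> ('m, 'e) metric \<Rightarrow> ('m \<Rightarrow> ('m, 'e) tvec \<Rightarrow> 'm) \<Rightarrow>
     ('m \<Rightarrow> real) \<Rightarrow> real \<Rightarrow> real \<Rightarrow> real \<Rightarrow> real \<Rightarrow> 'm \<Rightarrow> nat \<Rightarrow> 'm \<times> real" where
  "sbgd_state A g R f \<tau> r \<epsilon> \<alpha>bar x0 0 = (x0, \<alpha>bar)"
| "sbgd_state A g R f \<tau> r \<epsilon> \<alpha>bar x0 (Suc t) =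
     (let (x, \<alpha>) = sbgd_state A g R f \<tau> r \<epsilon> \<alpha>bar x0 t;
          \<alpha>' = backtrack A g R f \<tau> r x \<alpha>;
          x' = gd_step A g R f \<alpha>' x
      in (x', if tnorm g x' (grad A g f x') \<ge> \<epsilon> then \<alpha>bar else \<alpha>'))"

definition sbgd ::
    "('m, 'e::euclidean_space) chart set \<Rightarrow> ('m, 'e) metric \<Rightarrow> ('m \<Rightarrow> ('m, 'e) tvec \<Rightarrow> 'm) \<Rightarrow>
     ('m \<Rightarrow> real) \<Rightarrow> real \<Rightarrow> real \<Rightarrow> real \<Rightarrow> real \<Rightarrow> 'm \<Rightarrow> nat \<Rightarrow> 'm" where
  "sbgd A g R f \<tau> r \<epsilon> \<alpha>bar x0 t = fst (sbgd_state A g R f \<tau> r \<epsilon> \<alpha>bar x0 t)"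

definition sbgd_avoids_strict_saddles ::
    "('m::topological_space, 'e::euclidean_space) chart set \<Rightarrow> ('m, 'e) metric \<Rightarrow>
     ('m \<Rightarrow> ('m, 'e) tvec \<Rightarrow> 'm) \<Rightarrow> ('m \<Rightarrow> real) \<Rightarrow> real \<Rightarrow> real \<Rightarrow> real \<Rightarrow> real \<Rightarrow> bool" where
  "sbgd_avoids_strict_saddles A g R f \<tau> r \<epsilon> \<alpha>bar \<longleftrightarrow>
     measure_zero A
       {x0. \<exists>x. strict_saddle A g f x \<and> (\<lambda>t. sbgd A g R f \<tau> r \<epsilon> \<alpha>bar x0 t) \<longlonglongrightarrow> x}"

end

theory Submission
  imports Defs "HOL-Complex_Analysis.Complex_Analysis" "Jordan_Normal_Form.Determinant"
begin

text \<open>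
  Near a strict saddle the Armijo condition holds for all step sizes below some \<open>\<delta> > 0\<close>, and the
  gradient norm stays below \<open>\<epsilon>\<close>; hence along a sequence converging to a strict saddle the accepted
  step size is eventually a constant \<open>\<alpha> = \<tau>\<^sup>k \<alpha>bar\<close>.  The map \<open>x \<mapsto> R\<^sub>x (- \<alpha> grad f x)\<close> fixes the saddle
  with derivative \<open>I - \<alpha> Hess f\<close>, which is self-adjoint and has an eigenvalue above 1, so the points
  whose orbits stay near the saddle form a Lipschitz graph over a subset of a hyperplane: a null set.

  It remains to pull this null set back through finitely many steps, which works if for each
  \<open>\<alpha> = \<tau>\<^sup>k \<alpha>bar\<close> the derivative of the step map is invertible almost everywhere.  By Fubini it suffices
  that for almost every \<open>x\<close> the derivative is singular for only countably many \<open>\<alpha>\<close>, which holds if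
  its determinant is analytic in \<open>\<alpha>\<close>, as it is nonzero at \<open>\<alpha> = 0\<close>.  The derivative of the retraction
  with respect to the base point need not be analytic along a given fibre, but it is so over almost
  every \<open>x\<close>: let \<open>K\<close> be the set of base points over which the fibre maps are analytic with given
  bounds.  On \<open>K\<close> the error of Lagrange interpolation along the fibre decays at a fast geometric rate.
  At a density point of \<open>K\<close> the same holds, at a slower rate, for its derivative in \<open>x\<close>, which is
  therefore a locally uniform limit of polynomials on a complex disc.
\<close>

section \<open>Strict derivatives\<close>

text \<open>As \<open>f\<close> is only C^2, the step maps are only C^1. Strict derivatives compare
  two arbitrary points near \<open>a\<close> and so give two-point estimates directly: an injective
  derivative yields a local lower Lipschitz bound, which pulls null sets back, and near a saddle
  differences of orbits grow inside a cone. The obstacle is the base-point derivative of the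
  retraction. Interpolation in the fibre parameter commutes with it. On \<open>K\<close> the
  interpolation error with N+1 nodes is about 72^(-2N), but its second-order remainder in the base
  point is only bounded by a multiple of 6^N. Sampling \<open>K\<close> at distance h = 72^(-N)
  bounds the derivative of the error by error / h + 6^N * h, which is of order 12^(-N). Passing from
  real nodes to the complex disc costs another 6^N and leaves 2^(-N). Density is replaced by the
  metric condition \<open>approachable\<close>: it fails only on a countable union of porous sets,
  and these are null by a covering argument for outer measure, with \<open>K\<close> arbitrary. The
  measurability behind Fubini comes from the set of nonsingular pairs (point, step size) being
  open.\<close>

definition has_strict_derivative ::
    "('a::real_normed_vector \<Rightarrow> 'b::real_normed_vector) \<Rightarrow> ('a \<Rightarrow> 'b) \<Rightarrow> 'a \<Rightarrow> bool" where
  "has_strict_derivative f f' a \<longleftrightarrow> bounded_linear f' \<and>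
     (\<forall>e>0. \<exists>d>0. \<forall>x\<in>ball a d. \<forall>y\<in>ball a d. norm (f x - f y - f' (x - y)) \<le> e * norm (x - y))"

lemma has_strict_derivativeD:
  assumes "has_strict_derivative f f' a" "e > 0"
  obtains d where "d > 0" "\<And>x y. x \<in> ball a d \<Longrightarrow> y \<in> ball a d \<Longrightarrow> norm (f x - f y - f' (x - y)) \<le> e * norm (x - y)"
  using assms unfolding has_strict_derivative_def by blast

lemma has_strict_derivative_bounded_linear: "has_strict_derivative f f' a \<Longrightarrow> bounded_linear f'"
  by (simp add: has_strict_derivative_def)

lemma has_strict_derivative_imp_has_derivative:
  assumes "has_strict_derivative f f' a"
  shows "(f has_derivative f') (at a)"
  unfolding has_derivative_at_alt
proof (intro conjI allI impI)
  show "bounded_linear f'" using assms by (simp add: has_strict_derivative_def)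
  fix e :: real assume "e > 0"
  then obtain d where "d > 0" "\<And>x y. x \<in> ball a d \<Longrightarrow> y \<in> ball a d \<Longrightarrow> norm (f x - f y - f' (x - y)) \<le> e * norm (x - y)"
    using assms has_strict_derivativeD by blast
  then show "\<exists>d>0. \<forall>y. norm (y - a) < d \<longrightarrow> norm (f y - f a - f' (y - a)) \<le> e * norm (y - a)"
    by (intro exI[of _ d]) (auto simp: dist_norm norm_minus_commute)
qed

lemma has_strict_derivative_frechet: "has_strict_derivative f f' a \<Longrightarrow> frechet_derivative f (at a) = f'"
  by (rule frechet_derivative_at[symmetric]) (rule has_strict_derivative_imp_has_derivative)

lemma has_strict_derivative_unique:
  "has_strict_derivative f f1 a \<Longrightarrow> has_strict_derivative f f2 a \<Longrightarrow> f1 = f2"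
  by (drule has_strict_derivative_frechet)+ simp

lemma has_strict_derivative_transform:
  assumes "has_strict_derivative f f' a" "open S" "a \<in> S" "\<And>x. x \<in> S \<Longrightarrow> g x = f x"
  shows "has_strict_derivative g f' a"
  unfolding has_strict_derivative_def
proof (intro conjI allI impI)
  show "bounded_linear f'" using assms by (simp add: has_strict_derivative_def)
  fix e :: real assume "e > 0"
  then obtain d where d: "d > 0" "\<And>x y. x \<in> ball a d \<Longrightarrow> y \<in> ball a d \<Longrightarrow> norm (f x - f y - f' (x - y)) \<le> e * norm (x - y)"
    using assms has_strict_derivativeD by blast
  obtain d' where d': "d' > 0" "ball a d' \<subseteq> S" using assms openE by blast
  show "\<exists>d>0. \<forall>x\<in>ball a d. \<forall>y\<in>ball a d. norm (g x - g y - f' (x - y)) \<le> e * norm (x - y)"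
  proof (intro exI[of _ "min d d'"] conjI ballI)
    fix x y assume xy: "x \<in> ball a (min d d')" "y \<in> ball a (min d d')"
    then have "g x = f x" "g y = f y" using d' assms(4) by auto
    then show "norm (g x - g y - f' (x - y)) \<le> e * norm (x - y)" using d(2) xy by auto
  qed (use d d' in auto)
qed

lemma has_strict_derivative_lipschitz:
  assumes "has_strict_derivative f f' a"
  obtains B d where "B > 0" "d > 0" "\<And>x y. x \<in> ball a d \<Longrightarrow> y \<in> ball a d \<Longrightarrow> norm (f x - f y) \<le> B * norm (x - y)"
proof -
  obtain d where d: "d > 0" "\<And>x y. x \<in> ball a d \<Longrightarrow> y \<in> ball a d \<Longrightarrow> norm (f x - f y - f' (x - y)) \<le> 1 * norm (x - y)"
    using has_strict_derivativeD[OF assms, of 1] by auto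
  have bl: "bounded_linear f'" using assms by (simp add: has_strict_derivative_def)
  obtain K where K: "K > 0" "\<And>x. norm (f' x) \<le> norm x * K" using bounded_linear.pos_bounded[OF bl] by blast
  show thesis
  proof (rule that[of "K + 1" d])
    fix x y assume "x \<in> ball a d" "y \<in> ball a d"
    then have "norm (f x - f y - f' (x - y)) \<le> norm (x - y)" using d by auto
    moreover have "norm (f x - f y) \<le> norm (f x - f y - f' (x - y)) + norm (f' (x - y))"
      using norm_triangle_ineq[of "f x - f y - f' (x - y)" "f' (x - y)"] by simp
    ultimately show "norm (f x - f y) \<le> (K + 1) * norm (x - y)" using K(2)[of "x - y"] by (simp add: algebra_simps)
  qed (use K d in auto)
qed

section \<open>Calculus rules for strict derivatives\<close>

lemma has_strict_derivative_compose:
  assumes f: "has_strict_derivative f f' a" and g: "has_strict_derivative g g' (f a)"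
  shows "has_strict_derivative (\<lambda>x. g (f x)) (\<lambda>x. g' (f' x)) a"
  unfolding has_strict_derivative_def
proof (intro conjI allI impI)
  have bf: "bounded_linear f'" and bg: "bounded_linear g'" using f g by (auto simp: has_strict_derivative_def)
  show "bounded_linear (\<lambda>x. g' (f' x))" using bounded_linear_compose[OF bg bf] .
  fix e :: real assume e: "e > 0"
  obtain B d0 where B: "B > 0" "d0 > 0" "\<And>x y. x \<in> ball a d0 \<Longrightarrow> y \<in> ball a d0 \<Longrightarrow> norm (f x - f y) \<le> B * norm (x - y)"
    using has_strict_derivative_lipschitz[OF f] by metis
  obtain K where K: "K > 0" "\<And>x. norm (g' x) \<le> norm x * K" using bounded_linear.pos_bounded[OF bg] by blast
  have "e / (2*B) > 0" "e / (2*K) > 0" using e B K by auto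
  obtain d1 where d1: "d1 > 0" "\<And>x y. x \<in> ball (f a) d1 \<Longrightarrow> y \<in> ball (f a) d1 \<Longrightarrow> norm (g x - g y - g' (x - y)) \<le> e / (2*B) * norm (x - y)"
    using has_strict_derivativeD[OF g \<open>e / (2*B) > 0\<close>] by metis
  obtain d2 where d2: "d2 > 0" "\<And>x y. x \<in> ball a d2 \<Longrightarrow> y \<in> ball a d2 \<Longrightarrow> norm (f x - f y - f' (x - y)) \<le> e / (2*K) * norm (x - y)"
    using has_strict_derivativeD[OF f \<open>e / (2*K) > 0\<close>] by metis
  let ?d = "min (min d0 d2) (d1 / B)"
  have pos: "?d > 0" using B d1 d2 by auto
  show "\<exists>d>0. \<forall>x\<in>ball a d. \<forall>y\<in>ball a d. norm (g (f x) - g (f y) - g' (f' (x - y))) \<le> e * norm (x - y)"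
  proof (intro exI[of _ ?d] conjI pos ballI)
    have into: "f x \<in> ball (f a) d1" if "x \<in> ball a ?d" for x
    proof -
      have "norm (f a - f x) \<le> B * norm (a - x)" using that B by auto
      also have "\<dots> < d1" using that B by (auto simp: dist_norm field_simps)
      finally show ?thesis by (simp add: dist_norm)
    qed
    fix x y assume xy: "x \<in> ball a ?d" "y \<in> ball a ?d"
    have "g (f x) - g (f y) - g' (f' (x - y)) = (g (f x) - g (f y) - g' (f x - f y)) + g' (f x - f y - f' (x - y))"
      using bg by (simp add: linear_diff bounded_linear.linear)
    also have "norm \<dots> \<le> norm (g (f x) - g (f y) - g' (f x - f y)) + norm (g' (f x - f y - f' (x - y)))"
      by (rule norm_triangle_ineq)
    also have "\<dots> \<le> e / (2*B) * norm (f x - f y) + norm (f x - f y - f' (x - y)) * K"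
      using d1(2) into xy K by (intro add_mono) blast+
    also have "\<dots> \<le> e / (2*B) * (B * norm (x - y)) + (e / (2*K) * norm (x - y)) * K"
      using B d2 K xy e by (intro add_mono mult_left_mono mult_right_mono) auto
    also have "\<dots> = e * norm (x - y)" using B K by (simp add: field_simps)
    finally show "norm (g (f x) - g (f y) - g' (f' (x - y))) \<le> e * norm (x - y)" .
  qed
qed

lemma has_strict_derivative_linear: "bounded_linear f \<Longrightarrow> has_strict_derivative f f a"
  unfolding has_strict_derivative_def
  by (auto simp: linear_diff[OF bounded_linear.linear] intro: exI[of _ 1])

lemma has_strict_derivative_const: "has_strict_derivative (\<lambda>x. c) (\<lambda>x. 0) a"
  unfolding has_strict_derivative_def by (auto intro: exI[of _ 1])

lemma has_strict_derivative_ident: "has_strict_derivative (\<lambda>x. x) (\<lambda>x. x) a"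
  by (rule has_strict_derivative_linear) (rule bounded_linear_ident)

lemma has_strict_derivative_Pair:
  assumes f: "has_strict_derivative f f' a" and g: "has_strict_derivative g g' a"
  shows "has_strict_derivative (\<lambda>x. (f x, g x)) (\<lambda>x. (f' x, g' x)) a"
  unfolding has_strict_derivative_def
proof (intro conjI allI impI)
  show "bounded_linear (\<lambda>x. (f' x, g' x))" using f g by (auto simp: has_strict_derivative_def intro: bounded_linear_Pair)
  fix e :: real assume e: "e > 0"
  obtain d1 where d1: "d1 > 0" "\<And>x y. x \<in> ball a d1 \<Longrightarrow> y \<in> ball a d1 \<Longrightarrow> norm (f x - f y - f' (x - y)) \<le> e/2 * norm (x - y)"
    using has_strict_derivativeD[OF f] e by (metis half_gt_zero)
  obtain d2 where d2: "d2 > 0" "\<And>x y. x \<in> ball a d2 \<Longrightarrow> y \<in> ball a d2 \<Longrightarrow> norm (g x - g y - g' (x - y)) \<le> e/2 * norm (x - y)"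
    using has_strict_derivativeD[OF g] e by (metis half_gt_zero)
  show "\<exists>d>0. \<forall>x\<in>ball a d. \<forall>y\<in>ball a d. norm ((f x, g x) - (f y, g y) - (f' (x - y), g' (x - y))) \<le> e * norm (x - y)"
  proof (intro exI[of _ "min d1 d2"] conjI ballI)
    fix x y assume xy: "x \<in> ball a (min d1 d2)" "y \<in> ball a (min d1 d2)"
    have "norm ((f x, g x) - (f y, g y) - (f' (x - y), g' (x - y))) \<le> norm (f x - f y - f' (x - y)) + norm (g x - g y - g' (x - y))"
      using norm_Pair_le by simp
    also have "\<dots> \<le> e/2 * norm (x - y) + e/2 * norm (x - y)" using d1 d2 xy by (intro add_mono) auto
    finally show "norm ((f x, g x) - (f y, g y) - (f' (x - y), g' (x - y))) \<le> e * norm (x - y)" by simp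
  qed (use d1 d2 in auto)
qed

lemma norm_fst_le_norm: "norm (fst z) \<le> norm z" and norm_snd_le_norm: "norm (snd z) \<le> norm z"
  by (metis norm_fst_le prod.collapse) (metis norm_snd_le prod.collapse)

lemma (in bounded_bilinear) has_strict_derivative_prod: "has_strict_derivative (\<lambda>z. prod (fst z) (snd z)) (\<lambda>h. prod (fst a) (snd h) + prod (fst h) (snd a)) a"
  unfolding has_strict_derivative_def
proof (intro conjI allI impI)
  show "bounded_linear (\<lambda>h. prod (fst a) (snd h) + prod (fst h) (snd a))"
    by (intro bounded_linear_add bounded_linear_compose[OF bounded_linear_right bounded_linear_snd] bounded_linear_compose[OF bounded_linear_left bounded_linear_fst])
  fix e :: real assume e: "e > 0"
  obtain K where K: "K > 0" "\<And>a b. norm (prod a b) \<le> norm a * norm b * K" using pos_bounded by blast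
  let ?d = "e / (2*K)"
  show "\<exists>d>0. \<forall>x\<in>ball a d. \<forall>y\<in>ball a d. norm (prod (fst x) (snd x) - prod (fst y) (snd y) - (prod (fst a) (snd (x - y)) + prod (fst (x - y)) (snd a))) \<le> e * norm (x - y)"
  proof (intro exI[of _ ?d] conjI ballI)
    fix x y assume xy: "x \<in> ball a ?d" "y \<in> ball a ?d"
    \<comment> \<open>Each term on the right has one factor measured from \<open>a\<close>, which is
      small on the ball, and one factor that is a component of \<open>x - y\<close>.\<close>
    have *: "prod (fst x) (snd x) - prod (fst y) (snd y) - (prod (fst a) (snd (x - y)) + prod (fst (x - y)) (snd a))
       = prod (fst (x - a)) (snd (x - y)) + prod (fst (x - y)) (snd (y - a))"
      by (simp add: diff_left diff_right)
    have "norm (prod (fst (x - a)) (snd (x - y))) \<le> norm (x - a) * norm (x - y) * K"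
      by (rule order_trans[OF K(2)]) (use K in \<open>intro mult_right_mono mult_mono norm_fst_le_norm norm_snd_le_norm; auto\<close>)
    moreover have "norm (prod (fst (x - y)) (snd (y - a))) \<le> norm (x - y) * norm (y - a) * K"
      by (rule order_trans[OF K(2)]) (use K in \<open>intro mult_right_mono mult_mono norm_fst_le_norm norm_snd_le_norm; auto\<close>)
    moreover have "norm (x - a) * norm (x - y) * K \<le> ?d * norm (x - y) * K"
      using xy K by (intro mult_right_mono) (auto simp: dist_norm norm_minus_commute)
    moreover have "norm (x - y) * norm (y - a) * K \<le> norm (x - y) * ?d * K"
      using xy K by (intro mult_right_mono mult_left_mono) (auto simp: dist_norm norm_minus_commute)
    ultimately have "norm (prod (fst (x - a)) (snd (x - y)) + prod (fst (x - y)) (snd (y - a))) \<le> ?d * norm (x - y) * K + norm (x - y) * ?d * K"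
      using norm_triangle_ineq[of "prod (fst (x - a)) (snd (x - y))" "prod (fst (x - y)) (snd (y - a))"] by linarith
    also have "\<dots> = e * norm (x - y)" using K by (simp add: field_simps)
    finally show "norm (prod (fst x) (snd x) - prod (fst y) (snd y) - (prod (fst a) (snd (x - y)) + prod (fst (x - y)) (snd a))) \<le> e * norm (x - y)"
      unfolding * .
  qed (use e K in auto)
qed

lemma (in bounded_bilinear) has_strict_derivative:
  assumes f: "has_strict_derivative f f' a" and g: "has_strict_derivative g g' a"
  shows "has_strict_derivative (\<lambda>x. prod (f x) (g x)) (\<lambda>h. prod (f a) (g' h) + prod (f' h) (g a)) a"
  using has_strict_derivative_compose[OF has_strict_derivative_Pair[OF f g] has_strict_derivative_prod] by simp

lemma has_strict_derivative_add:
  assumes f: "has_strict_derivative f f' a" and g: "has_strict_derivative g g' a"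
  shows "has_strict_derivative (\<lambda>x. f x + g x) (\<lambda>h. f' h + g' h) a"
proof -
  have "bounded_linear (\<lambda>z::'b\<times>'b. fst z + snd z)" by (intro bounded_linear_add bounded_linear_fst bounded_linear_snd)
  from has_strict_derivative_compose[OF has_strict_derivative_Pair[OF f g] has_strict_derivative_linear[OF this]] show ?thesis by simp
qed

lemma has_strict_derivative_sum:
  assumes "\<And>i. i \<in> I \<Longrightarrow> has_strict_derivative (f i) (f' i) a"
  shows "has_strict_derivative (\<lambda>x. \<Sum>i\<in>I. f i x) (\<lambda>h. \<Sum>i\<in>I. f' i h) a"
  using assms
  by (induction I rule: infinite_finite_induct) (auto intro: has_strict_derivative_const has_strict_derivative_add)

lemma has_strict_derivative_isCont: "has_strict_derivative f f' a \<Longrightarrow> isCont f a"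
  using has_derivative_continuous has_strict_derivative_imp_has_derivative by blast

text \<open>Strictness at one point already makes derivatives continuous there, in operator norm,
  wherever they exist: difference quotients at a nearby \<open>y\<close> obey the same two-point
  estimate. It supplies continuity of the transition derivatives when gradients are compared between
  charts.\<close>

lemma has_strict_derivative_derivative_close:
  assumes f: "has_strict_derivative f f' a" and e: "e > 0"
  obtains d where "d > 0" "\<And>y F u. y \<in> ball a d \<Longrightarrow> (f has_derivative F) (at y) \<Longrightarrow> norm (F u - f' u) \<le> e * norm u"
proof -
  obtain d where d: "d > 0" "\<And>x y. x \<in> ball a d \<Longrightarrow> y \<in> ball a d \<Longrightarrow> norm (f x - f y - f' (x - y)) \<le> e * norm (x - y)"
    using has_strict_derivativeD[OF f e] by metis
  have bl: "bounded_linear f'" using f by (simp add: has_strict_derivative_def)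
  have "norm (F u - f' u) \<le> e * norm u" if y: "y \<in> ball a d" and F: "(f has_derivative F) (at y)" for y F u
  proof (cases "u = 0")
    case True
    then show ?thesis using F bl by (simp add: linear_0 bounded_linear.linear has_derivative_bounded_linear)
  next
    case False
    have lF: "linear F" and lf: "linear f'" using F bl by (auto simp: bounded_linear.linear has_derivative_bounded_linear)
    \<comment> \<open>The slack \<eta> absorbs the error of the derivative \<open>F\<close> at
      \<open>y\<close>. The increment \<open>t *\<^sub>R u\<close> is short enough for both
      estimates, and both scale with \<open>t\<close>, which then cancels.\<close>
    have "norm (F u - f' u) \<le> e * norm u + \<eta>" if \<eta>: "\<eta> > 0" for \<eta>
    proof -
      have "\<eta> / norm u > 0" using \<eta> False by simp
      then obtain d1 where d1: "d1 > 0" "\<And>z. norm (z - y) < d1 \<Longrightarrow> norm (f z - f y - F (z - y)) \<le> \<eta> / norm u * norm (z - y)"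
        using F unfolding has_derivative_at_alt by blast
      obtain d2 where d2: "d2 > 0" "ball y d2 \<subseteq> ball a d" using y openE[OF open_ball] by blast
      define t where "t = min d1 d2 / (2 * norm u)"
      have t: "t > 0" "t * norm u < d1" "t * norm u < d2" using d1(1) d2(1) False by (auto simp: t_def min_def field_simps)
      let ?z = "y + t *\<^sub>R u"
      have "norm (f ?z - f y - F (t *\<^sub>R u)) \<le> \<eta> / norm u * norm (t *\<^sub>R u)" using d1(2)[of ?z] t by simp
      moreover have "?z \<in> ball a d" using t d2(2) by (auto simp: dist_norm subset_iff)
      then have "norm (f ?z - f y - f' (t *\<^sub>R u)) \<le> e * norm (t *\<^sub>R u)" using d(2)[OF _ y, of ?z] by simp
      moreover have "F (t *\<^sub>R u) - f' (t *\<^sub>R u) = (f ?z - f y - f' (t *\<^sub>R u)) - (f ?z - f y - F (t *\<^sub>R u))" by simp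
      ultimately have "norm (F (t *\<^sub>R u) - f' (t *\<^sub>R u)) \<le> e * norm (t *\<^sub>R u) + \<eta> / norm u * norm (t *\<^sub>R u)"
        using norm_triangle_ineq4[of "f ?z - f y - f' (t *\<^sub>R u)" "f ?z - f y - F (t *\<^sub>R u)"] by simp
      moreover have "norm (F (t *\<^sub>R u) - f' (t *\<^sub>R u)) = t * norm (F u - f' u)"
        using lF lf t by (simp add: linear_cmul flip: scaleR_diff_right)
      moreover have "e * norm (t *\<^sub>R u) + \<eta> / norm u * norm (t *\<^sub>R u) = t * (e * norm u + \<eta>)"
        using t False by (simp add: distrib_left)
      ultimately show ?thesis using t(1) by simp
    qed
    then show ?thesis by (rule field_le_epsilon)
  qed
  with d(1) that show thesis by metis
qed

lemma linear_injective_lower_bound: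
  fixes f :: "'a::euclidean_space \<Rightarrow> 'b::euclidean_space"
  assumes "linear f" "inj f"
  obtains c where "c > 0" "\<And>x. norm (f x) \<ge> c * norm x"
  using linear_inj_bounded_below_pos[OF assms] by (metis mult.commute)

text \<open>The linear part stretches by at least \<open>c\<close>, and the strict error is kept
  below half of that. This quantitative form of local injectivity is what the pullback of null sets
  uses.\<close>

lemma has_strict_derivative_lower_bound:
  fixes f :: "'a::euclidean_space \<Rightarrow> 'b::euclidean_space"
  assumes f: "has_strict_derivative f f' a" and inj: "inj f'"
  obtains c d where "c > 0" "d > 0" "\<And>x y. x \<in> ball a d \<Longrightarrow> y \<in> ball a d \<Longrightarrow> norm (f x - f y) \<ge> c * norm (x - y)"
proof -
  have "linear f'" using f by (simp add: has_strict_derivative_def bounded_linear.linear)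
  then obtain c where c: "c > 0" "\<And>x. norm (f' x) \<ge> c * norm x" using linear_injective_lower_bound inj by blast
  obtain d where d: "d > 0" "\<And>x y. x \<in> ball a d \<Longrightarrow> y \<in> ball a d \<Longrightarrow> norm (f x - f y - f' (x - y)) \<le> c/2 * norm (x - y)"
    using has_strict_derivativeD[OF f, of "c/2"] c by auto
  show thesis
  proof (rule that[of "c/2" d])
    fix x y assume "x \<in> ball a d" "y \<in> ball a d"
    then have "norm (f x - f y - f' (x - y)) \<le> c/2 * norm (x - y)" by (rule d)
    moreover have "norm (f' (x - y)) \<le> norm (f x - f y) + norm (f x - f y - f' (x - y))"
      using norm_triangle_ineq4[of "f x - f y" "f x - f y - f' (x - y)"] by simp
    ultimately show "norm (f x - f y) \<ge> c/2 * norm (x - y)" using c(2)[of "x - y"] by linarith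
  qed (use c d in auto)
qed

lemma bounded_linear_small_on_Basis:
  fixes L :: "'a::euclidean_space \<Rightarrow> 'b::real_normed_vector" and e :: real
  assumes "linear L" "\<And>b. b \<in> Basis \<Longrightarrow> norm (L b) \<le> e"
  shows "norm (L u) \<le> DIM('a) * e * norm u"
proof -
  have "L u = (\<Sum>b\<in>Basis. (u \<bullet> b) *\<^sub>R L b)"
    using assms(1) by (subst euclidean_representation[of u, symmetric]) (simp add: linear_sum linear_cmul)
  also have "norm \<dots> \<le> (\<Sum>b\<in>(Basis::'a set). norm u * e)"
    by (rule sum_norm_le) (auto intro!: mult_mono assms simp: Basis_le_norm)
  finally show ?thesis by (simp add: algebra_simps)
qed

section \<open>Strict derivatives and Taylor remainders of C^k functions\<close>

text \<open>The mean value inequality is applied to \<open>f - f' a\<close>, whose derivative is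
  small near \<open>a\<close>. Continuity is asked for each fixed direction, as \<open>Ck_on\<close>
  provides it; finitely many basis directions then give smallness uniformly in the
  direction.\<close>

lemma continuous_derivative_imp_strict:
  fixes f :: "'a::euclidean_space \<Rightarrow> 'b::real_normed_vector"
  assumes S: "open S" "a \<in> S"
    and f': "\<And>x. x \<in> S \<Longrightarrow> (f has_derivative f' x) (at x)"
    and cont: "\<And>v. continuous_on S (\<lambda>x. f' x v)"
  shows "has_strict_derivative f (f' a) a"
  unfolding has_strict_derivative_def
proof (intro conjI allI impI)
  show bl: "bounded_linear (f' a)" using f' S has_derivative_bounded_linear by blast
  fix e :: real assume e: "e > 0"
  define e' where "e' = e / DIM('a)"
  have e': "e' > 0" using e by (simp add: e'_def)
  have "\<exists>d>0. \<forall>x\<in>ball a d. norm (f' x b - f' a b) \<le> e'" if "b \<in> Basis" for b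
  proof -
    have "isCont (\<lambda>x. f' x b) a" using cont S continuous_on_eq_continuous_at by blast
    then obtain d where "d > 0" "\<And>x. dist x a < d \<Longrightarrow> dist (f' x b) (f' a b) < e'"
      unfolding continuous_at_eps_delta using e' by (metis dist_norm)
    then show ?thesis by (intro exI[of _ d]) (auto simp: dist_norm norm_minus_commute less_imp_le)
  qed
  then obtain d where d: "\<And>b. b \<in> Basis \<Longrightarrow> d b > 0" "\<And>b x. b \<in> Basis \<Longrightarrow> x \<in> ball a (d b) \<Longrightarrow> norm (f' x b - f' a b) \<le> e'"
    by metis
  obtain d0 where d0: "d0 > 0" "ball a d0 \<subseteq> S" using S openE by blast
  define D where "D = Min (insert d0 (d ` Basis))"
  have D: "D > 0" "D \<le> d0" "\<And>b. b \<in> Basis \<Longrightarrow> D \<le> d b" using d(1) d0 by (auto simp: D_def simp del: Min_insert intro!: Min_le)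
  have sub: "ball a D \<subseteq> S" using D d0 by (meson ball_subset_ball_iff order_trans subset_ball)
  have small: "norm (f' x u - f' a u) \<le> e * norm u" if x: "x \<in> ball a D" for x u
  proof -
    have "bounded_linear (f' x)" using f' sub x has_derivative_bounded_linear by blast
    then have "linear (\<lambda>u. f' x u - f' a u)" using bl by (intro linear_compose_sub bounded_linear.linear)
    from bounded_linear_small_on_Basis[OF this, of e' u]
    have "norm (f' x u - f' a u) \<le> DIM('a) * e' * norm u" using d(2) D(3) x by fastforce
    then show ?thesis by (simp add: e'_def)
  qed
  show "\<exists>d>0. \<forall>x\<in>ball a d. \<forall>y\<in>ball a d. norm (f x - f y - f' a (x - y)) \<le> e * norm (x - y)"
  proof (intro exI[of _ D] conjI ballI D(1))
    fix x y assume xy: "x \<in> ball a D" "y \<in> ball a D"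
    have "norm ((f x - f' a x) - (f y - f' a y)) \<le> e * norm (x - y)"
    proof (rule differentiable_bound[where S = "ball a D" and f' = "\<lambda>x u. f' x u - f' a u"])
      fix z assume z: "z \<in> ball a D"
      show "((\<lambda>x. f x - f' a x) has_derivative (\<lambda>u. f' z u - f' a u)) (at z within ball a D)"
        by (rule has_derivative_at_withinI[OF has_derivative_diff[OF f' bounded_linear_imp_has_derivative[OF bl]]])
          (use z sub in blast)
      show "onorm (\<lambda>u. f' z u - f' a u) \<le> e" using small[OF z] by (rule onorm_le)
    qed (use xy in auto)
    then show "norm (f x - f y - f' a (x - y)) \<le> e * norm (x - y)"
      using bl by (simp add: linear_diff bounded_linear.linear algebra_simps)
  qed
qed

lemma Ck_on_Suc0_strict:
  fixes f :: "'a::euclidean_space \<Rightarrow> 'b::real_normed_vector"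
  assumes "Ck_on (Suc 0) S f" "open S" "a \<in> S"
  shows "has_strict_derivative f (frechet_derivative f (at a)) a"
  using assms by (intro continuous_derivative_imp_strict[of S]) (auto simp: frechet_derivative_works)

lemma Ck_on_mono: "Ck_on (Suc k) S f \<Longrightarrow> Ck_on k S f"
proof (induction k arbitrary: f)
  case 0
  then show ?case by (auto intro!: continuous_at_imp_continuous_on differentiable_imp_continuous_within)
next
  case (Suc k)
  then show ?case by (metis Ck_on.simps(2))
qed

lemma Ck_on_Suc_strict:
  fixes f :: "'a::euclidean_space \<Rightarrow> 'b::real_normed_vector"
  assumes "Ck_on (Suc k) S f" "open S" "a \<in> S"
  shows "has_strict_derivative f (frechet_derivative f (at a)) a"
proof -
  have "Ck_on (Suc 0) S f" using assms(1) by (induction k) (auto dest: Ck_on_mono simp del: Ck_on.simps)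
  then show ?thesis using assms Ck_on_Suc0_strict by blast
qed

lemma smooth_on_strict:
  fixes h :: "'x::euclidean_space \<Rightarrow> 'y::real_normed_vector"
  assumes "smooth_on S h" "open S" "a \<in> S"
  shows "has_strict_derivative h (frechet_derivative h (at a)) a"
  using assms Ck_on_Suc0_strict unfolding smooth_on_def by blast

text \<open>The first derivative is C^1, hence locally Lipschitz, and integrates to a quadratic
  remainder. One \<open>M\<close> serves for all expansion points \<open>x\<close> near
  \<open>a\<close>; this uniformity is needed later, where the expansion point moves along a
  fibre.\<close>

lemma Ck_on_2_quadratic_remainder:
  fixes f :: "'a::euclidean_space \<Rightarrow> 'b::real_normed_vector"
  assumes "Ck_on 2 S f" "open S" "a \<in> S"
  obtains d M where "d > 0" "M > 0" "ball a d \<subseteq> S"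
    "\<And>x y. x \<in> ball a d \<Longrightarrow> y \<in> ball a d \<Longrightarrow>
       norm (f y - f x - frechet_derivative f (at x) (y - x)) \<le> M * (norm (y - x))\<^sup>2"
proof -
  let ?F = "\<lambda>x. frechet_derivative f (at x)"
  have C2: "Ck_on (Suc (Suc 0)) S f" using assms(1) by (simp add: numeral_2_eq_2)
  have "\<exists>B d. B > 0 \<and> d > 0 \<and> (\<forall>x\<in>ball a d. \<forall>y\<in>ball a d. norm (?F x b - ?F y b) \<le> B * norm (x - y))" for b
  proof -
    have "Ck_on (Suc 0) S (\<lambda>x. ?F x b)" using C2 by simp
    from has_strict_derivative_lipschitz[OF Ck_on_Suc0_strict[OF this assms(2,3)]] show ?thesis by metis
  qed
  then obtain B d where Bd: "\<And>b. B b > 0" "\<And>b. d b > 0" "\<And>b x y. x \<in> ball a (d b) \<Longrightarrow> y \<in> ball a (d b) \<Longrightarrow> norm (?F x b - ?F y b) \<le> B b * norm (x - y)"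
    by metis
  obtain d0 where d0: "d0 > 0" "ball a d0 \<subseteq> S" using assms openE by blast
  define D where "D = Min (insert d0 (d ` Basis))"
  have D: "D > 0" "D \<le> d0" "\<And>b. b \<in> Basis \<Longrightarrow> D \<le> d b" using Bd(2) d0 by (auto simp: D_def simp del: Min_insert intro!: Min_le)
  define M0 where "M0 = Max (B ` Basis)"
  have M0: "M0 > 0" "\<And>b. b \<in> Basis \<Longrightarrow> B b \<le> M0" using Bd(1) by (auto simp: M0_def Max_gr_iff intro: SOME_Basis)
  define M where "M = DIM('a) * M0"
  have Mpos: "M > 0" using M0 by (simp add: M_def)
  have sub: "ball a D \<subseteq> S" using D d0 by (meson order_trans subset_ball)
  have der: "(f has_derivative ?F x) (at x)" if "x \<in> ball a D" for x
    using C2 sub that by (auto simp: frechet_derivative_works)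
  have lip: "norm (?F x u - ?F y u) \<le> M * norm (x - y) * norm u" if "x \<in> ball a D" "y \<in> ball a D" for x y u
  proof -
    have "linear (\<lambda>u. ?F x u - ?F y u)" using der that has_derivative_linear by (intro linear_compose_sub) blast+
    moreover have "norm (?F x b - ?F y b) \<le> M0 * norm (x - y)" if "b \<in> Basis" for b
    proof -
      have "norm (?F x b - ?F y b) \<le> B b * norm (x - y)" using Bd(3) \<open>x \<in> ball a D\<close> \<open>y \<in> ball a D\<close> D(3)[OF that] by auto
      also have "\<dots> \<le> M0 * norm (x - y)" using M0(2)[OF that] by (intro mult_right_mono) auto
      finally show ?thesis .
    qed
    ultimately show ?thesis using bounded_linear_small_on_Basis by (fastforce simp: M_def mult.assoc)
  qed
  have "norm (f y - f x - ?F x (y - x)) \<le> M * (norm (y - x))\<^sup>2" if x: "x \<in> ball a D" and y: "y \<in> ball a D" for x y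
  proof -
    \<comment> \<open>Within distance \<open>norm (y - x)\<close> of \<open>x\<close> the derivative
      differs from the one at \<open>x\<close> by at most \<open>M * norm (y - x)\<close>; the
      intersection is still convex.\<close>
    let ?T = "ball a D \<inter> cball x (norm (y - x))"
    have lx: "linear (?F x)" "bounded_linear (?F x)" using der[OF x] has_derivative_linear has_derivative_bounded_linear by blast+
    have "norm ((f y - ?F x y) - (f x - ?F x x)) \<le> (M * norm (y - x)) * norm (y - x)"
    proof (rule differentiable_bound[where S = ?T and f' = "\<lambda>z u. ?F z u - ?F x u"])
      fix z assume z: "z \<in> ?T"
      show "((\<lambda>z. f z - ?F x z) has_derivative (\<lambda>u. ?F z u - ?F x u)) (at z within ?T)"
        by (rule has_derivative_at_withinI[OF has_derivative_diff[OF der bounded_linear_imp_has_derivative[OF lx(2)]]])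
          (use z in blast)
      show "onorm (\<lambda>u. ?F z u - ?F x u) \<le> M * norm (y - x)"
      proof (rule onorm_le)
        fix u
        have "norm (?F z u - ?F x u) \<le> M * norm (z - x) * norm u" using lip z x by auto
        also have "\<dots> \<le> M * norm (y - x) * norm u" using z Mpos by (intro mult_right_mono mult_left_mono) (auto simp: dist_norm norm_minus_commute)
        finally show "norm (?F z u - ?F x u) \<le> M * norm (y - x) * norm u" .
      qed
    qed (use x y in \<open>auto simp: convex_Int dist_norm norm_minus_commute\<close>)
    then show ?thesis using lx(1) by (simp add: linear_diff algebra_simps power2_eq_square)
  qed
  with that[OF D(1) Mpos sub] show thesis by blast
qed

text \<open>The mean value theorem in direction \<open>u\<close>, applied to the increment of
  \<open>f\<close> along \<open>t *\<^sub>R v\<close>, leaves a difference of first derivatives at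
  two points that are \<open>t *\<^sub>R v\<close> apart; \<open>B\<close> approximates that
  difference.\<close>

lemma mixed_difference_estimate:
  fixes f :: "'a::real_normed_vector \<Rightarrow> real"
  assumes f: "\<And>x. x \<in> ball a d \<Longrightarrow> (f has_derivative F x) (at x)"
    and B: "\<And>x y. x \<in> ball a d \<Longrightarrow> y \<in> ball a d \<Longrightarrow> \<bar>F x u - F y u - B (x - y)\<bar> \<le> e * norm (x - y)"
    and lin: "linear B" and t: "t > 0" "t * (norm u + norm v) < d"
  shows "\<bar>f (a + t *\<^sub>R u + t *\<^sub>R v) - f (a + t *\<^sub>R u) - f (a + t *\<^sub>R v) + f a - t\<^sup>2 * B v\<bar> \<le> e * t\<^sup>2 * norm v"
proof -
  have inb: "a + s *\<^sub>R u + r *\<^sub>R v \<in> ball a d" if "0 \<le> s" "s \<le> t" "0 \<le> r" "r \<le> t" for s r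
  proof -
    have "norm (s *\<^sub>R u + r *\<^sub>R v) \<le> s * norm u + r * norm v" using norm_triangle_ineq[of "s *\<^sub>R u" "r *\<^sub>R v"] that by simp
    also have "\<dots> \<le> t * norm u + t * norm v" using that by (intro add_mono mult_right_mono) auto
    finally have "norm (s *\<^sub>R u + r *\<^sub>R v) < d" using t by (simp add: algebra_simps)
    moreover have "a - (a + s *\<^sub>R u + r *\<^sub>R v) = - (s *\<^sub>R u + r *\<^sub>R v)" by simp
    ultimately show ?thesis by (metis dist_norm mem_ball norm_minus_cancel)
  qed
  define h where "h s = f (a + s *\<^sub>R u + t *\<^sub>R v) - f (a + s *\<^sub>R u)" for s
  have der: "(h has_real_derivative (F (a + s *\<^sub>R u + t *\<^sub>R v) u - F (a + s *\<^sub>R u) u)) (at s)" if "0 \<le> s" "s \<le> t" for s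
  proof -
    have g: "((\<lambda>s. f (a + s *\<^sub>R u + w)) has_derivative (\<lambda>r. r * F (a + s *\<^sub>R u + w) u)) (at s)" if "a + s *\<^sub>R u + w \<in> ball a d" for w
    proof -
      have 1: "((\<lambda>s. a + s *\<^sub>R u + w) has_derivative (\<lambda>r. r *\<^sub>R u)) (at s)" by (auto intro!: derivative_eq_intros)
      have "linear (F (a + s *\<^sub>R u + w))" using f that has_derivative_linear by blast
      then show ?thesis using has_derivative_compose[OF 1 f[OF that]] by (simp add: linear_cmul)
    qed
    have "a + s *\<^sub>R u + t *\<^sub>R v \<in> ball a d" "a + s *\<^sub>R u + 0 \<in> ball a d"
      using inb[of s t] inb[of s 0] that t by auto
    from has_derivative_diff[OF g[OF this(1)] g[OF this(2)]]
    moreover have "(\<lambda>r. r * F (a + s *\<^sub>R u + t *\<^sub>R v) u - r * F (a + s *\<^sub>R u + 0) u) =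
        (*) (F (a + s *\<^sub>R u + t *\<^sub>R v) u - F (a + s *\<^sub>R u) u)"
      by (auto simp: algebra_simps)
    ultimately show ?thesis unfolding has_field_derivative_def h_def by simp
  qed
  obtain s where s: "0 < s" "s < t" "h t - h 0 = (t - 0) * (F (a + s *\<^sub>R u + t *\<^sub>R v) u - F (a + s *\<^sub>R u) u)"
    using MVT2[OF t(1), of h, OF der] by blast
  have "\<bar>F (a + s *\<^sub>R u + t *\<^sub>R v) u - F (a + s *\<^sub>R u) u - B (t *\<^sub>R v)\<bar> \<le> e * norm (t *\<^sub>R v)"
    using B[of "a + s *\<^sub>R u + t *\<^sub>R v" "a + s *\<^sub>R u"] inb[of s t] inb[of s 0] s t by simp
  then have "t * \<bar>F (a + s *\<^sub>R u + t *\<^sub>R v) u - F (a + s *\<^sub>R u) u - t * B v\<bar> \<le> t * (e * t * norm v)"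
    using t lin by (intro mult_left_mono) (auto simp: linear_cmul)
  moreover have "t * \<bar>F (a + s *\<^sub>R u + t *\<^sub>R v) u - F (a + s *\<^sub>R u) u - t * B v\<bar> = \<bar>h t - h 0 - t\<^sup>2 * B v\<bar>"
    using t s(3) by (subst abs_of_pos[of t, symmetric], simp, subst abs_mult[symmetric]) (simp add: algebra_simps power2_eq_square)
  ultimately show ?thesis by (simp add: h_def algebra_simps power2_eq_square)
qed

text \<open>The mixed second difference is unchanged when \<open>u\<close> and \<open>v\<close> are
  exchanged, and divided by \<open>t\<^sup>2\<close> it is close to both sides of the claim.\<close>

lemma symmetric_second_derivative:
  fixes f :: "'a::real_normed_vector \<Rightarrow> real"
  assumes S: "open S" "a \<in> S" and f: "\<And>x. x \<in> S \<Longrightarrow> (f has_derivative F x) (at x)"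
    and B: "\<And>u. has_strict_derivative (\<lambda>x. F x u) (\<lambda>h. B h u) a"
  shows "B u v = B v u"
proof -
  have "\<bar>B u v - B v u\<bar> \<le> 0 + e" if e: "e > 0" for e
  proof -
    define e' where "e' = e / (norm u + norm v + 1)"
    have "norm u + norm v + 1 > 0" by (simp add: add_nonneg_pos)
    then have e': "e' > 0" "e' * (norm u + norm v + 1) = e" using e by (auto simp: e'_def)
    have e'2: "e' * (norm u + norm v) \<le> e" using e' by (simp add: algebra_simps) 
    obtain d0 where d0: "d0 > 0" "ball a d0 \<subseteq> S" using S openE by blast
    obtain d1 where d1: "d1 > 0" "\<And>x y. x \<in> ball a d1 \<Longrightarrow> y \<in> ball a d1 \<Longrightarrow> norm (F x u - F y u - B (x - y) u) \<le> e' * norm (x - y)"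
      using has_strict_derivativeD[OF B e'(1)] by metis
    obtain d2 where d2: "d2 > 0" "\<And>x y. x \<in> ball a d2 \<Longrightarrow> y \<in> ball a d2 \<Longrightarrow> norm (F x v - F y v - B (x - y) v) \<le> e' * norm (x - y)"
      using has_strict_derivativeD[OF B e'(1)] by metis
    define d where "d = min d0 (min d1 d2)"
    have d: "d > 0" using d0 d1 d2 by (simp add: d_def)
    define w where "w = norm u + norm v + 1"
    have w: "w > 0" by (simp add: w_def add_nonneg_pos)
    define t where "t = d / (2 * w)"
    have t: "t > 0" using d w by (simp add: t_def)
    have "t * (norm u + norm v) \<le> t * w" using t by (intro mult_left_mono) (auto simp: w_def)
    also have "\<dots> = d / 2" using w by (simp add: t_def)
    finally have t2: "t * (norm u + norm v) < d" using d by simp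
    have lin: "linear (\<lambda>h. B h w)" for w using has_strict_derivative_bounded_linear[OF B] bounded_linear.linear by blast
    have fd: "(f has_derivative F x) (at x)" if "x \<in> ball a d" for x using f d0 that by (auto simp: d_def)
    let ?D = "f (a + t *\<^sub>R u + t *\<^sub>R v) - f (a + t *\<^sub>R u) - f (a + t *\<^sub>R v) + f a"
    have "\<bar>?D - t\<^sup>2 * B v u\<bar> \<le> e' * t\<^sup>2 * norm v"
      by (rule mixed_difference_estimate[where d = d and F = F]) (use fd d1 lin t t2 in \<open>auto simp: d_def\<close>)
    moreover have "\<bar>f (a + t *\<^sub>R v + t *\<^sub>R u) - f (a + t *\<^sub>R v) - f (a + t *\<^sub>R u) + f a - t\<^sup>2 * B u v\<bar> \<le> e' * t\<^sup>2 * norm u"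
      by (rule mixed_difference_estimate[where d = d and F = F]) (use fd d2 lin t t2 in \<open>auto simp: d_def add.commute\<close>)
    moreover have "f (a + t *\<^sub>R v + t *\<^sub>R u) - f (a + t *\<^sub>R v) - f (a + t *\<^sub>R u) + f a = ?D" by (simp add: add.commute add.left_commute)
    ultimately have "\<bar>t\<^sup>2 * B u v - t\<^sup>2 * B v u\<bar> \<le> e' * t\<^sup>2 * norm v + e' * t\<^sup>2 * norm u" by linarith
    also have "\<dots> = t\<^sup>2 * (e' * (norm u + norm v))" by (simp add: algebra_simps)
    also have "\<dots> \<le> t\<^sup>2 * e" using e'2 by (intro mult_left_mono) auto
    finally have "t\<^sup>2 * \<bar>B u v - B v u\<bar> \<le> t\<^sup>2 * e" by (simp add: abs_mult flip: right_diff_distrib)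
    then show ?thesis using t by simp
  qed
  then have "\<bar>B u v - B v u\<bar> \<le> 0" by (rule field_le_epsilon)
  then show ?thesis by simp
qed

section \<open>Porous sets\<close>

text \<open>A weak form of being a density point of \<open>K\<close>, sufficient to control a derivative by the values on \<open>K\<close>.\<close>

definition approachable :: "'a::euclidean_space set \<Rightarrow> 'a \<Rightarrow> bool" where
  "approachable K x \<longleftrightarrow>
     (\<exists>h0>0. \<forall>h. 0 < h \<and> h < h0 \<longrightarrow> (\<forall>u. norm u \<le> 1 \<longrightarrow> (\<exists>y\<in>K. dist y (x + h *\<^sub>R u) \<le> h / 2)))"

lemma measure_annulus:
  fixes x z :: "'a::euclidean_space"
  assumes h: "h > 0" and sub: "ball z (h/2) \<subseteq> cball x (2*h)"
  shows "measure lebesgue (cball x (2*h) - ball z (h/2)) = (1 - (1/4)^DIM('a)) * measure lebesgue (cball x (2*h))"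
proof -
  have "measure lebesgue (cball x (2*h) - ball z (h/2)) = measure lebesgue (cball x (2*h)) - measure lebesgue (ball z (h/2))"
    by (rule measurable_measure_Diff) (use sub in auto)
  moreover have "measure lebesgue (ball z (h/2)) = (1/4)^DIM('a) * measure lebesgue (cball x (2*h))"
  proof -
    have "(h/2)^DIM('a) = (1/4)^DIM('a) * (2*h)^DIM('a)" by (subst power_mult_distrib[symmetric]) simp
    then show ?thesis using h by (simp add: content_ball content_cball)
  qed
  ultimately show ?thesis by (simp add: algebra_simps)
qed

text \<open>Let \<open>I\<close> be the infimum of the measures of open supersets of
  \<open>S\<close>. Inside any such superset, Vitali's theorem covers almost all of \<open>S\<close>
  by disjoint balls, and each ball contains a hole missing \<open>S\<close> that takes a fixed share
  of its volume. Removing the holes gives \<open>I \<le> \<theta> * I\<close> with \<theta> < 1, so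
  \<open>I = 0\<close>. Boundedness provides an open superset of finite measure to start
  from.\<close>

lemma negligible_porous_bounded:
  fixes S :: "'a::euclidean_space set"
  assumes bd: "bounded S"
    and por: "\<And>x h0. x \<in> S \<Longrightarrow> h0 > 0 \<Longrightarrow> \<exists>h u. 0 < h \<and> h < h0 \<and> norm u \<le> 1 \<and> (\<forall>y\<in>S. dist y (x + h *\<^sub>R u) > h / 2)"
  shows "negligible S"
proof -
  let ?\<mu> = "measure lebesgue :: 'a set \<Rightarrow> real"
  \<comment> \<open>A hole of radius \<open>h/2\<close> occupies the fraction
    \<open>(1/4)^DIM('a)\<close> of a ball of radius \<open>2*h\<close>.\<close>
  define \<theta> :: real where "\<theta> = 1 - (1/4)^DIM('a)"
  have \<theta>: "0 \<le> \<theta>" "\<theta> < 1" by (auto simp: \<theta>_def power_le_one)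
  define \<V> where "\<V> = {V. open V \<and> S \<subseteq> V \<and> V \<in> lmeasurable}"
  define I where "I = Inf (?\<mu> ` \<V>)"
  obtain R where "S \<subseteq> ball 0 R" using bd bounded_subset_ballD by blast
  then have ne: "\<V> \<noteq> {}" by (auto simp: \<V>_def intro: exI[of _ "ball 0 R"])
  have bdd: "bdd_below (?\<mu> ` \<V>)" by (intro bdd_belowI[of _ 0]) auto
  have I0: "I \<ge> 0" unfolding I_def using ne by (intro cINF_greatest) auto
  have key: "I \<le> \<theta> * ?\<mu> V" if V: "V \<in> \<V>" for V
  proof (rule field_le_epsilon)
    fix \<eta> :: real assume \<eta>: "\<eta> > 0"
    \<comment> \<open>An index \<open>(x, h, u)\<close> stands for the hole of radius
      \<open>h/2\<close> around \<open>x + h *\<^sub>R u\<close>. It lies in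
      \<open>cball x (2*h)\<close> since \<open>h + h/2 \<le> 2*h\<close>.\<close>
    define J where "J = {(x, h, u). x \<in> S \<and> 0 < h \<and> norm u \<le> 1 \<and> cball x (2*h) \<subseteq> V \<and> (\<forall>y\<in>S. dist y (x + h *\<^sub>R u) > h / 2)}"
    define c where "c = (\<lambda>i :: 'a \<times> real \<times> 'a. fst i)"
    define r where "r = (\<lambda>i :: 'a \<times> real \<times> 'a. 2 * fst (snd i))"
    define B where "B = (\<lambda>i :: 'a \<times> real \<times> 'a. ball (fst i + fst (snd i) *\<^sub>R snd (snd i)) (fst (snd i) / 2))"
    have Jr: "0 < r i" if "i \<in> J" for i using that by (auto simp: J_def r_def)
    have Jcov: "\<exists>i. i \<in> J \<and> x \<in> cball (c i) (r i) \<and> r i < d" if "x \<in> S" "0 < d" for x and d :: real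
    proof -
      have "open V" "x \<in> V" using V \<open>x \<in> S\<close> by (auto simp: \<V>_def)
      then obtain e where e: "e > 0" "cball x e \<subseteq> V" by (meson open_contains_cball)
      then obtain h u where hu: "0 < h" "h < min (e/2) (d/2)" "norm u \<le> 1" "\<forall>y\<in>S. dist y (x + h *\<^sub>R u) > h / 2"
        using por[OF \<open>x \<in> S\<close>, of "min (e/2) (d/2)"] \<open>0 < d\<close> by auto
      then have "(x, h, u) \<in> J" using e that by (auto simp: J_def subset_iff)
      then show ?thesis using hu by (intro exI[of _ "(x,h,u)"]) (auto simp: c_def r_def)
    qed
    obtain C where C: "countable C" "C \<subseteq> J" "pairwise (\<lambda>i j. disjnt (cball (c i) (r i)) (cball (c j) (r j))) C"
      "negligible (S - (\<Union>i\<in>C. cball (c i) (r i)))"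
      by (rule Vitali_covering_theorem_cballs[of J r S c, OF Jr Jcov]) blast+
    have Bsub: "B i \<subseteq> cball (c i) (r i)" if i: "i \<in> J" for i
    proof -
      obtain x h u where ixhu: "i = (x, h, u)" by (metis prod_cases3)
      have hu: "0 < h" "norm u \<le> 1" using i ixhu by (auto simp: J_def)
      have "dist x (x + h *\<^sub>R u) \<le> h" using hu by (simp add: dist_norm mult_left_le)
      then show ?thesis using hu unfolding ixhu B_def c_def r_def
        by (auto simp: subset_iff) (smt (verit) dist_triangle field_sum_of_halves)
    qed
    define D where "D i = cball (c i) (r i) - B i" for i
    have meas: "?\<mu> (D i) = \<theta> * ?\<mu> (cball (c i) (r i))" if i: "i \<in> C" for i
    proof -
      obtain x h u where ixhu: "i = (x, h, u)" by (metis prod_cases3)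
      have "i \<in> J" using i C by blast
      then have "h > 0" using ixhu by (auto simp: J_def)
      from measure_annulus[OF this] Bsub[OF \<open>i \<in> J\<close>] show ?thesis
        by (simp add: ixhu D_def c_def r_def B_def \<theta>_def)
    qed
    have Dl: "D i \<in> lmeasurable" for i by (auto simp: D_def B_def intro: fmeasurable.Diff)
    \<comment> \<open>Disjointness turns the sum of the ball volumes into the volume of a subset of
      \<open>V\<close>. Finite subfamilies suffice for the countable union.\<close>
    have fin: "?\<mu> (\<Union>i\<in>F. D i) \<le> \<theta> * ?\<mu> V" if F: "F \<subseteq> C" "finite F" for F
    proof -
      have "?\<mu> (\<Union>i\<in>F. D i) \<le> (\<Sum>i\<in>F. ?\<mu> (D i))" using F Dl by (intro measure_UNION_le) auto
      also have "\<dots> = \<theta> * (\<Sum>i\<in>F. ?\<mu> (cball (c i) (r i)))"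
        unfolding sum_distrib_left by (intro sum.cong refl meas) (use F in blast)
      also have "(\<Sum>i\<in>F. ?\<mu> (cball (c i) (r i))) = ?\<mu> (\<Union>i\<in>F. cball (c i) (r i))"
      proof (rule measure_UNION'[symmetric])
        show "pairwise (\<lambda>i j. disjnt (cball (c i) (r i)) (cball (c j) (r j))) F" using C(3) F(1) by (rule pairwise_subset)
      qed (use F in auto)
      also have "\<theta> * ?\<mu> (\<Union>i\<in>F. cball (c i) (r i)) \<le> \<theta> * ?\<mu> V"
      proof (intro mult_left_mono measure_mono_fmeasurable)
        show "(\<Union>i\<in>F. cball (c i) (r i)) \<subseteq> V" using F C by (fastforce simp: J_def c_def r_def)
        show "(\<Union>i\<in>F. cball (c i) (r i)) \<in> sets lebesgue" using F by auto
      qed (use V \<theta> in \<open>auto simp: \<V>_def\<close>)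
      finally show ?thesis .
    qed
    have UD: "(\<Union>i\<in>C. D i) \<in> lmeasurable" and UDm: "?\<mu> (\<Union>i\<in>C. D i) \<le> \<theta> * ?\<mu> V"
      using fmeasurable_UN_bound[OF C(1) Dl fin] measure_UN_bound[OF C(1) Dl fin] by auto
    let ?N = "S - (\<Union>i\<in>C. cball (c i) (r i))"
    have N: "?N \<in> lmeasurable" "?\<mu> ?N = 0" using C(4) negligible_imp_measurable negligible_imp_measure0 by blast+
    let ?S = "(\<Union>i\<in>C. D i) \<union> ?N"
    have S': "?S \<in> lmeasurable" using UD N by (intro fmeasurable.Un) auto
    have S'm: "?\<mu> ?S \<le> \<theta> * ?\<mu> V" using measure_Un_le[of "\<Union>i\<in>C. D i" lebesgue ?N] UD N UDm by auto
    have Ssub: "S \<subseteq> ?S"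
    proof
      fix y assume y: "y \<in> S"
      have "y \<notin> B i" if "i \<in> C" for i using that C(2) y by (force simp: J_def B_def dist_commute)
      then show "y \<in> ?S" using y by (auto simp: D_def)
    qed
    \<comment> \<open>\<open>?S\<close> need not be open; at the cost of \<eta> it is enlarged to an
      open set that competes in the infimum \<open>I\<close>.\<close>
    obtain W where W: "open W" "?S \<subseteq> W" "W \<in> lmeasurable" "?\<mu> W < ?\<mu> ?S + \<eta>"
    proof -
      obtain W where W: "open W" "?S \<subseteq> W" "W - ?S \<in> lmeasurable" "emeasure lebesgue (W - ?S) < ennreal \<eta>"
        by (rule sets_lebesgue_outer_open[OF fmeasurableD[OF S'] \<eta>]) blast
      have eq: "W = ?S \<union> (W - ?S)" using W(2) by blast
      have Wl: "W \<in> lmeasurable" by (subst eq) (intro fmeasurable.Un S' W(3))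
      have "?\<mu> (W - ?S) < \<eta>" using W(3,4) \<eta> by (simp add: emeasure_eq_measure2 ennreal_less_iff)
      moreover have "?\<mu> W \<le> ?\<mu> ?S + ?\<mu> (W - ?S)"
        by (subst eq, rule measure_Un_le) (use S' W(3) in auto)
      ultimately show ?thesis using that W Wl by force
    qed
    have "S \<subseteq> W" using Ssub W(2) by (rule order_trans)
    then have "I \<le> ?\<mu> W" unfolding I_def using W(1,3) bdd by (intro cINF_lower) (simp_all add: \<V>_def)
    then show "I \<le> \<theta> * ?\<mu> V + \<eta>" using W S'm by linarith
  qed
  have "I = 0"
  proof (cases "\<theta> = 0")
    case True
    then show ?thesis using key ne I0 by fastforce
  next
    case False
    \<comment> \<open>By \<open>key\<close>, \<open>I / \<theta>\<close> is a lower bound for all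
      the measures whose infimum is \<open>I\<close>.\<close>
    have "I / \<theta> \<le> I" unfolding I_def[of ] using ne key False \<theta> 
      by (intro cINF_greatest) (auto simp: field_simps I_def)
    then have "I \<le> \<theta> * I" using False \<theta> by (simp add: field_simps)
    then have "(1 - \<theta>) * I \<le> 0" by (simp add: algebra_simps)
    then show ?thesis using I0 \<theta> by (simp add: mult_le_0_iff)
  qed
  show ?thesis unfolding negligible_outer
  proof (intro allI impI)
    fix e :: real assume "e > 0"
    then obtain V where "V \<in> \<V>" "?\<mu> V < e" using \<open>I = 0\<close> cInf_lessD[of "?\<mu> ` \<V>" e] ne by (auto simp: I_def)
    then show "\<exists>T. S \<subseteq> T \<and> T \<in> lmeasurable \<and> ?\<mu> T < e" by (auto simp: \<V>_def)
  qed
qed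

text \<open>Negating \<open>approachable\<close> gives, below every scale, a hole of relative size
  1/2 in \<open>K\<close> near the point. The bad points therefore form a porous set; cutting with
  balls makes it bounded.\<close>

lemma negligible_not_approachable:
  fixes K :: "'a::euclidean_space set"
  shows "negligible {x\<in>K. \<not> approachable K x}"
proof -
  let ?P = "\<lambda>n::nat. {x\<in>K. \<not> approachable K x} \<inter> cball 0 (real n)"
  have "negligible (?P n)" for n
  proof (rule negligible_porous_bounded)
    fix x and h0 :: real assume "x \<in> ?P n" "h0 > 0"
    then show "\<exists>h u. 0 < h \<and> h < h0 \<and> norm u \<le> 1 \<and> (\<forall>y\<in>?P n. dist y (x + h *\<^sub>R u) > h / 2)"
      unfolding approachable_def by (fastforce simp: not_le)
  qed auto
  then have "negligible (\<Union>n. ?P n)" by (intro negligible_countable_Union) auto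
  moreover have "{x\<in>K. \<not> approachable K x} \<subseteq> (\<Union>n. ?P n)"
    using real_arch_simple by fastforce
  ultimately show ?thesis by (rule negligible_subset)
qed

section \<open>Lagrange interpolation\<close>

text \<open>Equispaced nodes on [-1, 1]. For \<open>N = 0\<close> division by zero would put the
  only node at -1, hence the recurring assumption \<open>N \<ge> 1\<close>.\<close>

definition equi_node :: "nat \<Rightarrow> nat \<Rightarrow> real" where
  "equi_node N j = 2 * real j / real N - 1"

text \<open>The nodes are real, but the argument ranges over any normed field: the same weights
  interpolate on the interval and extend the interpolant to the complex disc.\<close>

definition lagrange_basis :: "nat \<Rightarrow> nat \<Rightarrow> 'a::real_normed_field \<Rightarrow> 'a" where
  "lagrange_basis N j z =
     (\<Prod>i\<in>{..N}-{j}. (z - of_real (equi_node N i)) / of_real (equi_node N j - equi_node N i))"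

lemma equi_node_bounds: "N \<ge> 1 \<Longrightarrow> j \<le> N \<Longrightarrow> \<bar>equi_node N j\<bar> \<le> 1"
  by (auto simp: equi_node_def abs_le_iff field_simps)

lemma equi_node_inj: "N \<ge> 1 \<Longrightarrow> equi_node N i = equi_node N j \<longleftrightarrow> i = j"
  by (auto simp: equi_node_def)

lemma lagrange_basis_of_real: "lagrange_basis N j (of_real s) = of_real (lagrange_basis N j s)"
  by (simp add: lagrange_basis_def)

lemma prod_abs_diff_nat:
  assumes "j \<le> N"
  shows "(\<Prod>i\<in>{..N}-{j}. \<bar>real j - real i\<bar>) = fact j * fact (N - j)"
proof -
  have eq: "{..N}-{j} = {..<j} \<union> {Suc j..N}" using assms by auto
  have "(\<Prod>i\<in>{..N}-{j}. \<bar>real j - real i\<bar>) = (\<Prod>i<j. \<bar>real j - real i\<bar>) * (\<Prod>i=Suc j..N. \<bar>real j - real i\<bar>)"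
    unfolding eq by (rule prod.union_disjoint) auto
  also have "(\<Prod>i<j. \<bar>real j - real i\<bar>) = (\<Prod>i=0..<j. real (j - i))"
    by (rule prod.cong) (auto simp: of_nat_diff)
  also have "\<dots> = fact j" by (simp add: fact_prod_rev)
  also have "(\<Prod>i=Suc j..N. \<bar>real j - real i\<bar>) = (\<Prod>i=1..N-j. real i)"
    by (rule prod.reindex_bij_witness[of _ "\<lambda>i. i + j" "\<lambda>i. i - j"]) (auto simp: of_nat_diff)
  also have "\<dots> = fact (N - j)" by (simp add: fact_prod)
  finally show ?thesis .
qed

text \<open>The left side is a single term of the exponential series at \<open>N\<close>, and e is
  at most 3.\<close>

lemma power_div_fact_le: "real N ^ N / fact N \<le> 3 ^ N"
proof -
  have "real N ^ N / fact N \<le> exp (real N)"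
  proof -
    have "(\<Sum>n\<in>{N}. inverse (fact n) *\<^sub>R (real N ^ n)) \<le> (\<Sum>n. inverse (fact n) *\<^sub>R (real N ^ n))"
      by (rule sum_le_suminf) (auto intro: summable_exp)
    then show ?thesis by (simp add: exp_def divide_inverse mult.commute)
  qed
  also have "\<dots> = exp 1 ^ N" by (simp flip: exp_of_nat_mult)
  also have "\<dots> \<le> 3 ^ N" by (intro power_mono exp_le) auto
  finally show ?thesis .
qed

text \<open>Each numerator is at most 2 and each node gap is 2|j - i|/N, so the j-th term is at most
  \<open>N^N / fact N\<close> times a binomial coefficient. The factors 3^N and 2^N give 6^N. The
  bound covers the closed complex unit disc, not only [-1, 1].\<close>

lemma lagrange_basis_sum_bound:
  fixes z :: "'a::real_normed_field"
  assumes N: "N \<ge> 1" and z: "norm z \<le> 1"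
  shows "(\<Sum>j\<le>N. norm (lagrange_basis N j z)) \<le> 6 ^ N"
proof -
  have bound: "norm (lagrange_basis N j z) \<le> (real N ^ N / fact N) * real (N choose j)" if j: "j \<le> N" for j
  proof -
    have "norm (lagrange_basis N j z) = (\<Prod>i\<in>{..N}-{j}. norm (z - of_real (equi_node N i)) / \<bar>equi_node N j - equi_node N i\<bar>)"
      by (simp add: lagrange_basis_def norm_divide norm_of_real del: of_real_diff flip: prod_norm)
    also have "\<dots> \<le> (\<Prod>i\<in>{..N}-{j}. real N / \<bar>real j - real i\<bar>)"
    proof (rule prod_mono, intro conjI)
      fix i assume i: "i \<in> {..N}-{j}"
      have "norm (z - of_real (equi_node N i)) \<le> 2"
        using norm_triangle_ineq4[of z "of_real (equi_node N i)"] z equi_node_bounds[OF N, of i] i by simp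
      moreover have "equi_node N j - equi_node N i = 2 * (real j - real i) / real N"
        by (simp add: equi_node_def diff_divide_distrib right_diff_distrib)
      then have "\<bar>equi_node N j - equi_node N i\<bar> = 2 * \<bar>real j - real i\<bar> / real N"
        by (simp only: abs_mult abs_divide abs_numeral abs_of_nat)
      moreover have "norm (z - of_real (equi_node N i)) / (2 * \<bar>real j - real i\<bar> / real N) =
          (norm (z - of_real (equi_node N i)) / 2) * (real N / \<bar>real j - real i\<bar>)" by simp
      moreover have "(norm (z - of_real (equi_node N i)) / 2) * (real N / \<bar>real j - real i\<bar>) \<le> 1 * (real N / \<bar>real j - real i\<bar>)"
        using calculation(1) by (intro mult_right_mono) auto
      ultimately show "norm (z - of_real (equi_node N i)) / \<bar>equi_node N j - equi_node N i\<bar> \<le> real N / \<bar>real j - real i\<bar>"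
        by simp
    qed auto
    also have "\<dots> = real N ^ N / (\<Prod>i\<in>{..N}-{j}. \<bar>real j - real i\<bar>)"
      using j by (simp add: prod_dividef)
    also have "\<dots> = (real N ^ N / fact N) * real (N choose j)"
      using j by (simp add: prod_abs_diff_nat binomial_fact)
    finally show ?thesis .
  qed
  have "(\<Sum>j\<le>N. norm (lagrange_basis N j z)) \<le> (\<Sum>j\<le>N. (real N ^ N / fact N) * real (N choose j))"
    by (intro sum_mono bound) auto
  also have "\<dots> = (real N ^ N / fact N) * 2 ^ N"
    unfolding sum_distrib_left[symmetric] of_nat_sum[symmetric] choose_row_sum by simp
  also have "\<dots> \<le> 3 ^ N * 2 ^ N" by (intro mult_right_mono power_div_fact_le) auto
  also have "\<dots> = 6 ^ N" by (simp flip: power_mult_distrib)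
  finally show ?thesis .
qed

definition lagrange_basis_poly :: "nat \<Rightarrow> nat \<Rightarrow> 'a::real_normed_field poly" where
  "lagrange_basis_poly N j = (\<Prod>i\<in>{..N}-{j}. [: - of_real (equi_node N i) / of_real (equi_node N j - equi_node N i), 1 / of_real (equi_node N j - equi_node N i) :])"

lemma poly_lagrange_basis_poly: "poly (lagrange_basis_poly N j) z = lagrange_basis N j z"
  unfolding lagrange_basis_poly_def lagrange_basis_def poly_prod
  by (intro prod.cong refl) (simp add: diff_divide_distrib)

lemma degree_lagrange_basis_poly: "j \<le> N \<Longrightarrow> degree (lagrange_basis_poly N j) \<le> N"
proof -
  assume j: "j \<le> N"
  have "degree (lagrange_basis_poly N j :: 'a poly) \<le> (\<Sum>i\<in>{..N}-{j}. 1)"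
    unfolding lagrange_basis_poly_def by (rule order_trans[OF degree_prod_sum_le]) (simp, rule sum_mono, unfold o_def, rule order_trans[OF degree_pCons_le], simp)
  then show ?thesis using j by simp
qed

lemma lagrange_basis_node:
  assumes "N \<ge> 1" "i \<le> N" "j \<le> N"
  shows "lagrange_basis N j (of_real (equi_node N i) :: 'a::real_normed_field) = (if i = j then 1 else 0)"
proof (cases "i = j")
  case True
  have "of_real (equi_node N j) - of_real (equi_node N k) \<noteq> (0::'a)" if "k \<noteq> j" for k
    using equi_node_inj[OF assms(1)] that by (metis eq_iff_diff_eq_0 of_real_eq_iff)
  then show ?thesis using True by (auto simp: lagrange_basis_def intro!: prod.neutral)
next
  case False
  then show ?thesis using assms by (auto simp: lagrange_basis_def intro!: bexI[of _ i])
qed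

text \<open>The interpolant minus \<open>p\<close> has degree at most \<open>N\<close> but vanishes
  at \<open>N + 1\<close> distinct nodes.\<close>

lemma lagrange_interpolation_poly:
  fixes p :: "'a::real_normed_field poly"
  assumes N: "N \<ge> 1" and p: "degree p \<le> N"
  shows "(\<Sum>j\<le>N. lagrange_basis N j z * poly p (of_real (equi_node N j))) = poly p z"
proof -
  define q where "q = (\<Sum>j\<le>N. Polynomial.smult (poly p (of_real (equi_node N j))) (lagrange_basis_poly N j)) - p"
  have q: "poly q z = (\<Sum>j\<le>N. lagrange_basis N j z * poly p (of_real (equi_node N j))) - poly p z" for z
    by (simp add: q_def poly_sum poly_lagrange_basis_poly mult.commute)
  have deg: "degree q \<le> N" unfolding q_def
    by (intro degree_diff_le degree_sum_le p order_trans[OF degree_smult_le] degree_lagrange_basis_poly) auto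
  have root: "poly q (of_real (equi_node N i)) = 0" if "i \<le> N" for i
  proof -
    have "(\<Sum>j\<le>N. lagrange_basis N j (of_real (equi_node N i)) * poly p (of_real (equi_node N j)))
        = (\<Sum>j\<le>N. if i = j then poly p (of_real (equi_node N j)) else 0)"
      using N that by (intro sum.cong refl) (auto simp: lagrange_basis_node)
    also have "\<dots> = poly p (of_real (equi_node N i))" using that by simp
    finally show ?thesis by (simp add: q)
  qed
  have "q = 0"
  proof (rule ccontr)
    assume "q \<noteq> 0"
    let ?Z = "(\<lambda>i. of_real (equi_node N i) :: 'a) ` {..N}"
    have "card ?Z = Suc N" using equi_node_inj[OF N] by (subst card_image) (auto simp: inj_on_def)
    moreover have "card ?Z \<le> card {z. poly q z = 0}"
      using root \<open>q \<noteq> 0\<close> by (intro card_mono poly_roots_finite) auto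
    moreover have "card {z. poly q z = 0} \<le> degree q" by (rule card_poly_roots_bound[OF \<open>q \<noteq> 0\<close>])
    ultimately show False using deg by simp
  qed
  then show ?thesis using q[of z] by simp
qed

section \<open>Analyticity of derivatives of fibrewise analytic functions\<close>

text \<open>The constant 72 is chosen so that the square root of the rate, times the growth 6 of the
  Lebesgue constants on the unit disc, applied twice, is still 1/2.  Likewise \<open>31104 = 6 * 72\<^sup>2\<close> below.\<close>

definition fast_interpolation :: "real \<Rightarrow> (real \<Rightarrow> real) \<Rightarrow> bool" where
  "fast_interpolation C \<phi> \<longleftrightarrow> (\<forall>N\<ge>1. \<forall>s. \<bar>s\<bar> \<le> 1 \<longrightarrow>
     \<bar>\<phi> s - (\<Sum>j\<le>N. lagrange_basis N j s * \<phi> (equi_node N j))\<bar> \<le> C * (1/72) ^ (2 * N))"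

text \<open>Interpolation reproduces \<open>p\<close>, so the interpolation error of \<phi> equals
  that of \<phi> - p, which is at most 1 + 6^N times the approximation error. The rate 31104 = 6 *
  72^2 compensates this loss.\<close>

lemma fast_interpolation_from_polys:
  assumes approx: "\<And>N. N \<ge> 1 \<Longrightarrow> \<exists>p::real poly. degree p \<le> N \<and> (\<forall>s. \<bar>s\<bar> \<le> 1 \<longrightarrow> \<bar>\<phi> s - poly p s\<bar> \<le> C * (1/31104) ^ N)"
    and C: "C \<ge> 0"
  shows "fast_interpolation (2 * C) \<phi>"
  unfolding fast_interpolation_def
proof (intro allI impI)
  fix N :: nat and s :: real assume N: "N \<ge> 1" and s: "\<bar>s\<bar> \<le> 1"
  obtain p :: "real poly" where p: "degree p \<le> N" "\<And>s. \<bar>s\<bar> \<le> 1 \<Longrightarrow> \<bar>\<phi> s - poly p s\<bar> \<le> C * (1/31104) ^ N"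
    using approx[OF N] by blast
  let ?L = "\<lambda>\<phi>. (\<Sum>j\<le>N. lagrange_basis N j s * \<phi> (equi_node N j))"
  have "?L (poly p) = poly p s" using lagrange_interpolation_poly[OF N p(1), of s] by simp
  then have "\<phi> s - ?L \<phi> = (\<phi> s - poly p s) - ?L (\<lambda>s. \<phi> s - poly p s)"
    by (simp add: right_diff_distrib sum_subtractf)
  then have "\<bar>\<phi> s - ?L \<phi>\<bar> \<le> \<bar>\<phi> s - poly p s\<bar> + \<bar>?L (\<lambda>s. \<phi> s - poly p s)\<bar>" by simp
  also have "\<bar>?L (\<lambda>s. \<phi> s - poly p s)\<bar> \<le> (\<Sum>j\<le>N. \<bar>lagrange_basis N j s\<bar> * (C * (1/31104) ^ N))"
    unfolding abs_mult[symmetric]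
    by (rule order_trans[OF sum_abs], rule sum_mono)
       (use p(2) equi_node_bounds[OF N] in \<open>auto simp: abs_mult intro!: mult_left_mono\<close>)
  also have "\<dots> \<le> 6 ^ N * (C * (1/31104) ^ N)"
    using lagrange_basis_sum_bound[OF N, of s] s C by (simp only: sum_distrib_right[symmetric]) (intro mult_right_mono, auto)
  also have "\<bar>\<phi> s - poly p s\<bar> \<le> 1 * (C * (1/31104) ^ N)" using p(2)[OF s] by simp
  also have "1 * (C * (1/31104) ^ N) + 6 ^ N * (C * (1/31104) ^ N) \<le> 6 ^ N * (C * (1/31104) ^ N) + 6 ^ N * (C * (1/31104) ^ N)"
    using C by (intro add_right_mono mult_right_mono) auto
  also have "\<dots> = 2 * C * (6 ^ N * (1/31104) ^ N)" by simp
  also have "(6 ^ N * (1/31104) ^ N :: real) = (1/72) ^ (2 * N)"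
    by (simp add: power_mult flip: power_mult_distrib) (simp add: power2_eq_square)
  finally show "\<bar>\<phi> s - ?L \<phi>\<bar> \<le> 2 * C * (1/72) ^ (2 * N)" by simp
qed

text \<open>In every direction \<open>u\<close> some point \<open>y\<close> of \<open>K\<close> lies
  within \<open>h/2\<close> of \<open>z0 + h *\<^sub>R u\<close>. Smallness of \<open>E\<close> at
  \<open>y\<close> and \<open>z0\<close>, with the quadratic remainder, bounds
  \<open>E' (y - z0)\<close>. Replacing \<open>y - z0\<close> by \<open>h *\<^sub>R u\<close> costs
  at most half the operator norm of \<open>E'\<close>, which can be absorbed.\<close>

lemma approachable_derivative_bound:
  fixes E :: "'z::euclidean_space \<Rightarrow> real"
  assumes lin: "linear E'"
    and h: "0 < h" "2 * h < \<delta>"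
    and appr: "\<And>u. norm u \<le> 1 \<Longrightarrow> \<exists>y\<in>K. dist y (z0 + h *\<^sub>R u) \<le> h / 2"
    and rem: "\<And>z. z \<in> ball z0 \<delta> \<Longrightarrow> \<bar>E z - E z0 - E' (z - z0)\<bar> \<le> M * (norm (z - z0))\<^sup>2"
    and M: "M \<ge> 0"
    and small: "\<And>z. z \<in> K \<Longrightarrow> z \<in> ball z0 \<delta> \<Longrightarrow> \<bar>E z\<bar> \<le> \<eta>" "\<bar>E z0\<bar> \<le> \<eta>"
  shows "\<bar>E' u\<bar> \<le> (4 * \<eta> / h + 8 * M * h) * norm u"
proof -
  have bl: "bounded_linear E'" using lin by (simp add: linear_conv_bounded_linear)
  define B where "B = onorm E'"
  have B: "norm (E' u) \<le> B * norm u" for u unfolding B_def by (rule onorm[OF bl])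
  have "B \<ge> 0" using onorm_pos_le[OF bl] by (simp add: B_def)
  have unit: "\<bar>E' u\<bar> \<le> (2 * \<eta> / h + 4 * M * h) + B / 2" if u: "norm u \<le> 1" for u
  proof -
    obtain y where y: "y \<in> K" "dist y (z0 + h *\<^sub>R u) \<le> h / 2" using appr[OF u] by blast
    define w where "w = y - (z0 + h *\<^sub>R u)"
    have w: "norm w \<le> h / 2" using y by (simp add: w_def dist_norm)
    have yz: "y - z0 = h *\<^sub>R u + w" by (simp add: w_def)
    have "norm (y - z0) \<le> norm (h *\<^sub>R u) + norm w" unfolding yz by (rule norm_triangle_ineq)
    also have "\<dots> \<le> h * 1 + h / 2" using h u w by (intro add_mono) (auto simp: mult_left_le)
    finally have n2: "norm (y - z0) \<le> 2 * h" using h by simp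
    then have yb: "y \<in> ball z0 \<delta>" using h by (simp add: dist_norm norm_minus_commute)
    have "(norm (y - z0))\<^sup>2 \<le> (2 * h)\<^sup>2" using n2 by (intro power_mono) auto
    then have "M * (norm (y - z0))\<^sup>2 \<le> M * (2 * h)\<^sup>2" using M by (rule mult_left_mono)
    then have "\<bar>E' (y - z0)\<bar> \<le> 2 * \<eta> + M * (2 * h)\<^sup>2" using rem[OF yb] small(1)[OF y(1) yb] small(2) by linarith
    moreover have "E' (y - z0) = h * E' u + E' w" unfolding yz using lin by (simp add: linear_add linear_cmul)
    moreover have "\<bar>E' w\<bar> \<le> B * (h / 2)" using B[of w] w \<open>B \<ge> 0\<close> by (smt (verit) mult_left_mono real_norm_def)
    ultimately have "\<bar>h * E' u\<bar> \<le> 2 * \<eta> + M * (2 * h)\<^sup>2 + B * (h / 2)" by linarith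
    then have "h * \<bar>E' u\<bar> \<le> h * ((2 * \<eta> / h + 4 * M * h) + B / 2)"
      using h by (simp add: abs_mult algebra_simps power2_eq_square)
    then show ?thesis using h by simp
  qed
  have "norm (E' u) \<le> ((2 * \<eta> / h + 4 * M * h) + B / 2) * norm u" for u
  proof (cases "u = 0")
    case True
    then show ?thesis using lin by (simp add: linear_0)
  next
    case False
    have "E' u = norm u * E' (u /\<^sub>R norm u)" using False lin by (simp add: linear_cmul)
    also have "\<bar>\<dots>\<bar> \<le> norm u * ((2 * \<eta> / h + 4 * M * h) + B / 2)"
      unfolding abs_mult using False by (intro mult_mono unit) auto
    finally show ?thesis by (simp add: mult.commute)
  qed
  \<comment> \<open>Absorption: \<open>B\<close> is the operator norm itself, so the term
    \<open>B / 2\<close> moves to the left side.\<close>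
  then have "B \<le> (2 * \<eta> / h + 4 * M * h) + B / 2" unfolding B_def by (rule onorm_le)
  then have "B \<le> 4 * \<eta> / h + 8 * M * h" by simp
  then show ?thesis using B[of u] by (smt (verit) mult_right_mono norm_ge_zero real_norm_def)
qed

text \<open>Consecutive approximants differ by at most 2 C 12^(-N) at the real nodes. Interpolating
  their difference, of degree at most N + 1, bounds it on the whole complex disc by 6^(N+1) times
  that, i.e. 12 C 2^(-N). The telescoping series thus converges uniformly, and its sum is
  holomorphic.\<close>

lemma polynomial_uniform_limit:
  fixes \<phi> :: "real \<Rightarrow> real"
  assumes p: "\<And>N. N \<ge> N0 \<Longrightarrow> \<exists>p::complex poly. degree p \<le> N \<and>
      (\<forall>s. \<bar>s\<bar> \<le> 1 \<longrightarrow> norm (complex_of_real (\<phi> s) - poly p (of_real s)) \<le> C * (1/12) ^ N)"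
    and C: "C \<ge> 0"
  obtains \<Psi> where "\<Psi> holomorphic_on ball 0 1" "\<And>s. \<bar>s\<bar> < 1 \<Longrightarrow> \<Psi> (of_real s) = of_real (\<phi> s)"
proof -
  define N1 where "N1 = max N0 1"
  obtain P :: "nat \<Rightarrow> complex poly" where P: "\<And>N. N \<ge> N0 \<Longrightarrow> degree (P N) \<le> N"
    "\<And>N s. N \<ge> N0 \<Longrightarrow> \<bar>s\<bar> \<le> 1 \<Longrightarrow> norm (complex_of_real (\<phi> s) - poly (P N) (of_real s)) \<le> C * (1/12) ^ N"
    using p by metis
  have step: "norm (poly (P (Suc N)) z - poly (P N) z) \<le> 12 * C * (1/2) ^ N" if N: "N \<ge> N1" and z: "norm z \<le> 1" for N z
  proof -
    let ?D = "P (Suc N) - P N"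
    let ?L = "lagrange_basis (Suc N)"
    have NN: "N \<ge> N0" "N \<ge> 1" "Suc N \<ge> 1" using N by (auto simp: N1_def)
    have "degree ?D \<le> Suc N" using P(1)[of N] P(1)[of "Suc N"] NN by (intro degree_diff_le) auto
    then have eq: "poly ?D z = (\<Sum>j\<le>Suc N. ?L j z * poly ?D (of_real (equi_node (Suc N) j)))"
      using lagrange_interpolation_poly[OF NN(3), of ?D z] by simp
    have D: "norm (poly ?D (of_real (equi_node (Suc N) j))) \<le> 2 * C * (1/12) ^ N" if "j \<le> Suc N" for j
    proof -
      let ?s = "equi_node (Suc N) j"
      have s: "\<bar>?s\<bar> \<le> 1" using equi_node_bounds[OF NN(3) that] .
      have "poly ?D (of_real ?s) = (complex_of_real (\<phi> ?s) - poly (P N) (of_real ?s)) - (complex_of_real (\<phi> ?s) - poly (P (Suc N)) (of_real ?s))" by simp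
      also have "norm \<dots> \<le> C * (1/12) ^ N + C * (1/12) ^ Suc N"
        using NN s by (intro order_trans[OF norm_triangle_ineq4] add_mono P(2)) auto
      also have "C * (1/12) ^ Suc N \<le> C * (1/12) ^ N" using C by (intro mult_left_mono) auto
      finally show ?thesis by simp
    qed
    have "norm (poly ?D z) \<le> (\<Sum>j\<le>Suc N. norm (?L j z) * (2 * C * (1/12) ^ N))"
      unfolding eq by (rule order_trans[OF norm_sum], rule sum_mono, unfold norm_mult, intro mult_left_mono D) auto
    also have "\<dots> \<le> 6 ^ Suc N * (2 * C * (1/12) ^ N)"
      using lagrange_basis_sum_bound[OF NN(3) z] C by (simp only: sum_distrib_right[symmetric]) (intro mult_right_mono, auto)
    also have "\<dots> = 12 * C * (6 ^ N * (1/12) ^ N)" by simp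
    also have "(6 ^ N * (1/12) ^ N :: real) = (1/2) ^ N" by (simp flip: power_mult_distrib)
    finally show ?thesis by simp
  qed
  define f where "f i z = poly (P (N1 + Suc i)) z - poly (P (N1 + i)) z" for i z
  have "uniform_limit (cball 0 1) (\<lambda>n z. \<Sum>i<n. f i z) (\<lambda>z. suminf (\<lambda>i. f i z)) sequentially"
  proof (rule Weierstrass_m_test)
    fix n :: nat and z :: complex assume "z \<in> cball 0 1"
    then show "norm (f n z) \<le> 12 * C * (1/2) ^ (N1 + n)" using step[of "N1 + n" z] by (simp add: f_def)
  next
    show "summable (\<lambda>n. 12 * C * (1/2::real) ^ (N1 + n))" by (intro summable_mult) (simp add: power_add summable_mult summable_geometric)
  qed
  moreover have "(\<Sum>i<n. f i z) = poly (P (N1 + n)) z - poly (P N1) z" for n z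
    by (induction n) (auto simp: f_def)
  ultimately have ul: "uniform_limit (cball 0 1) (\<lambda>n z. poly (P (N1 + n)) z - poly (P N1) z) (\<lambda>z. suminf (\<lambda>i. f i z)) sequentially"
    by simp
  define \<Psi> where "\<Psi> z = poly (P N1) z + suminf (\<lambda>i. f i z)" for z
  have ul2: "uniform_limit (cball 0 1) (\<lambda>n z. poly (P (N1 + n)) z) \<Psi> sequentially"
  proof -
    have "uniform_limit (cball 0 1) (\<lambda>n z. poly (P N1) z) (\<lambda>z. poly (P N1) z) sequentially"
      by (simp add: uniform_limit_iff)
    from uniform_limit_add[OF ul this] show ?thesis by (simp add: \<Psi>_def[abs_def] add.commute)
  qed
  have hol: "\<Psi> holomorphic_on ball 0 1"
  proof (rule holomorphic_uniform_sequence)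
    show "(\<lambda>z. poly (P (N1 + n)) z) holomorphic_on ball 0 1" for n by (intro holomorphic_intros)
    fix x :: complex assume "x \<in> ball 0 1"
    then obtain d where "d > 0" "cball x d \<subseteq> ball 0 1" by (meson open_ball open_contains_cball)
    then show "\<exists>d>0. cball x d \<subseteq> ball 0 1 \<and> uniform_limit (cball x d) (\<lambda>n z. poly (P (N1 + n)) z) \<Psi> sequentially"
      using uniform_limit_on_subset[OF ul2] by (intro exI[of _ d]) (auto dest: subset_trans[OF _ ball_subset_cball])
  qed auto
  have "\<Psi> (of_real s) = of_real (\<phi> s)" if s: "\<bar>s\<bar> < 1" for s
  proof -
    have l1: "(\<lambda>n. poly (P (N1 + n)) (of_real s)) \<longlonglongrightarrow> \<Psi> (of_real s)"
      by (rule tendsto_uniform_limitI[OF ul2]) (use s in auto)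
    have "(\<lambda>n. complex_of_real (\<phi> s) - poly (P (N1 + n)) (of_real s)) \<longlonglongrightarrow> 0"
    proof (rule Lim_null_comparison)
      show "\<forall>\<^sub>F n in sequentially. norm (complex_of_real (\<phi> s) - poly (P (N1 + n)) (of_real s)) \<le> C * (1/12) ^ (N1 + n)"
        using P(2)[of _ s] s by (auto simp: N1_def intro!: always_eventually)
      have "(\<lambda>n. C * (1/12) ^ N1 * (1/12::real) ^ n) \<longlonglongrightarrow> C * (1/12) ^ N1 * 0"
        by (intro tendsto_mult tendsto_const LIMSEQ_power_zero) auto
      then show "(\<lambda>n. C * (1/12::real) ^ (N1 + n)) \<longlonglongrightarrow> 0" by (simp add: power_add mult.assoc)
    qed
    from tendsto_diff[OF tendsto_const[of "complex_of_real (\<phi> s)"] this]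
    have "(\<lambda>n. poly (P (N1 + n)) (of_real s)) \<longlonglongrightarrow> of_real (\<phi> s)" by simp
    with l1 show ?thesis by (rule LIMSEQ_unique)
  qed
  with hol that show thesis by blast
qed

text \<open>For fixed \<open>s\<close> and \<open>N\<close>, let \<open>E z\<close> be the
  interpolation error of \<open>F z\<close>. Its derivative at \<open>z0\<close> is the
  interpolation error \<open>E'\<close> of \<open>F'\<close>, since the weights do not involve
  \<open>z\<close>. Fast interpolation makes \<open>E\<close> tiny on \<open>K\<close>, and
  approachability transfers this to \<open>E'\<close> at a slower rate that still allows a
  holomorphic limit.\<close>

lemma derivative_holomorphic_extension:
  fixes F :: "'z::euclidean_space \<Rightarrow> real \<Rightarrow> real" and F' :: "real \<Rightarrow> 'z \<Rightarrow> real"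
  assumes lin: "\<And>s. \<bar>s\<bar> \<le> 1 \<Longrightarrow> linear (F' s)"
    and rem: "\<And>s z. \<bar>s\<bar> \<le> 1 \<Longrightarrow> z \<in> ball z0 \<delta> \<Longrightarrow> \<bar>F z s - F z0 s - F' s (z - z0)\<bar> \<le> M * (norm (z - z0))\<^sup>2"
    and \<delta>: "\<delta> > 0" and M: "M \<ge> 0" and C: "C \<ge> 0"
    and K: "z0 \<in> K" "approachable K z0" "\<And>z. z \<in> K \<Longrightarrow> z \<in> ball z0 \<delta> \<Longrightarrow> fast_interpolation C (F z)"
  obtains \<Psi> where "\<Psi> holomorphic_on ball 0 1" "\<And>s. \<bar>s\<bar> < 1 \<Longrightarrow> \<Psi> (of_real s) = of_real (F' s u)"
proof -
  obtain h0 where h0: "h0 > 0" "\<And>h u. 0 < h \<Longrightarrow> h < h0 \<Longrightarrow> norm u \<le> 1 \<Longrightarrow> \<exists>y\<in>K. dist y (z0 + h *\<^sub>R u) \<le> h / 2"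
    using K(2) unfolding approachable_def by metis
  have "(\<lambda>n. (1/72::real) ^ n) \<longlonglongrightarrow> 0" by (rule LIMSEQ_power_zero) auto
  then have "eventually (\<lambda>n. (1/72::real) ^ n < min h0 (\<delta>/2)) sequentially"
    using h0 \<delta> by (intro order_tendstoD(2)[where a = "min h0 (\<delta>/2)"]) auto
  then obtain N0 where N0: "\<And>n. n \<ge> N0 \<Longrightarrow> (1/72::real) ^ n < min h0 (\<delta>/2)" by (auto simp: eventually_sequentially)
  define c where "c = (4 * C + 16 * M) * norm u"
  have c: "c \<ge> 0" using C M by (simp add: c_def)
  have main: "\<exists>p::complex poly. degree p \<le> N \<and>
      (\<forall>s. \<bar>s\<bar> \<le> 1 \<longrightarrow> norm (complex_of_real (F' s u) - poly p (of_real s)) \<le> c * (1/12) ^ N)" if N: "N \<ge> max N0 1" for N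
  \<comment> \<open>The witness is the Lagrange interpolant of \<open>s \<mapsto> F' s u\<close>,
    read as a complex polynomial.\<close>
  proof (intro exI[of _ "\<Sum>j\<le>N. Polynomial.smult (of_real (F' (equi_node N j) u)) (lagrange_basis_poly N j)"] conjI allI impI)
    have N1: "N \<ge> 1" "N \<ge> N0" using N by auto
    show "degree (\<Sum>j\<le>N. Polynomial.smult (complex_of_real (F' (equi_node N j) u)) (lagrange_basis_poly N j)) \<le> N"
      by (intro degree_sum_le order_trans[OF degree_smult_le] degree_lagrange_basis_poly) auto
    fix s :: real assume s: "\<bar>s\<bar> \<le> 1"
    define l where "l j = lagrange_basis N j s" for j
    have l: "(\<Sum>j\<le>N. \<bar>l j\<bar>) \<le> 6 ^ N" using lagrange_basis_sum_bound[OF N1(1), of s] s by (simp add: l_def)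
    define E where "E z = F z s - (\<Sum>j\<le>N. l j * F z (equi_node N j))" for z
    define E' where "E' v = F' s v - (\<Sum>j\<le>N. l j * F' (equi_node N j) v)" for v
    \<comment> \<open>At this scale the value error 72^(-2N), divided by \<open>h\<close>, becomes
      72^(-N), and the remainder 6^N times \<open>h\<close> becomes 12^(-N).\<close>
    define h :: real where "h = (1/72) ^ N"
    have "linear (\<lambda>v. l j * F' (equi_node N j) v)" if "j \<le> N" for j
      using linear_compose_scale_right[OF lin[OF equi_node_bounds[OF N1(1) that]], of "l j"] by simp
    then have linE: "linear E'" unfolding E'_def
      by (intro linear_compose_sub linear_compose_sum ballI lin s) auto
    have "\<bar>E' u\<bar> \<le> (4 * (C * (1/72) ^ (2*N)) / h + 8 * (2 * M * 6 ^ N) * h) * norm u"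
    proof (rule approachable_derivative_bound[where E = E and K = K and ?z0.0 = z0 and \<delta> = \<delta>])
      show "0 < h" by (simp add: h_def)
      show "2 * h < \<delta>" using N0[OF N1(2)] by (simp add: h_def)
      show "\<exists>y\<in>K. dist y (z0 + h *\<^sub>R v) \<le> h / 2" if "norm v \<le> 1" for v
        using h0(2)[of h v] N0[OF N1(2)] that by (simp add: h_def)
      show "\<bar>E z - E z0 - E' (z - z0)\<bar> \<le> 2 * M * 6 ^ N * (norm (z - z0))\<^sup>2" if z: "z \<in> ball z0 \<delta>" for z
      proof -
        let ?R = "\<lambda>s. F z s - F z0 s - F' s (z - z0)"
        have "E z - E z0 - E' (z - z0) = ?R s - (\<Sum>j\<le>N. l j * ?R (equi_node N j))"
          by (simp add: E_def E'_def right_diff_distrib sum_subtractf)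
        also have "\<bar>\<dots>\<bar> \<le> \<bar>?R s\<bar> + (\<Sum>j\<le>N. \<bar>l j * ?R (equi_node N j)\<bar>)"
          using sum_abs[of "\<lambda>j. l j * ?R (equi_node N j)" "{..N}"] by linarith
        also have "\<dots> \<le> M * (norm (z - z0))\<^sup>2 + (\<Sum>j\<le>N. \<bar>l j\<bar> * (M * (norm (z - z0))\<^sup>2))"
          using rem s z equi_node_bounds[OF N1(1)] by (intro add_mono sum_mono) (auto simp: abs_mult intro!: mult_left_mono)
        also have "\<dots> \<le> 6 ^ N * (M * (norm (z - z0))\<^sup>2) + 6 ^ N * (M * (norm (z - z0))\<^sup>2)"
        proof (rule add_mono)
          show "M * (norm (z - z0))\<^sup>2 \<le> 6 ^ N * (M * (norm (z - z0))\<^sup>2)"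
            using M mult_right_mono[of 1 "6 ^ N" "M * (norm (z - z0))\<^sup>2"] by simp
          show "(\<Sum>j\<le>N. \<bar>l j\<bar> * (M * (norm (z - z0))\<^sup>2)) \<le> 6 ^ N * (M * (norm (z - z0))\<^sup>2)"
            unfolding sum_distrib_right[symmetric] using l M by (intro mult_right_mono) auto
        qed
        finally show ?thesis by simp
      qed
      have sm: "\<bar>E z\<bar> \<le> C * (1/72) ^ (2*N)" if "z \<in> K" "z \<in> ball z0 \<delta>" for z
        using K(3)[OF that] N1(1) s by (simp add: fast_interpolation_def E_def l_def)
      then show "\<bar>E z\<bar> \<le> C * (1/72) ^ (2*N)" if "z \<in> K" "z \<in> ball z0 \<delta>" for z using that .
      show "\<bar>E z0\<bar> \<le> C * (1/72) ^ (2*N)" using sm K(1) \<delta> by simp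
    qed (use linE M in auto)
    also have "4 * (C * (1/72) ^ (2*N)) / h = 4 * C * h" by (simp add: h_def mult_2 power_add)
    also have "8 * (2 * M * 6 ^ N) * h = 16 * M * (6 ^ N * h)" by simp
    also have "6 ^ N * h = (1/12) ^ N" unfolding h_def by (simp flip: power_mult_distrib)
    also have "(4 * C * h + 16 * M * (1/12) ^ N) * norm u \<le> (4 * C * (1/12) ^ N + 16 * M * (1/12) ^ N) * norm u"
      using C unfolding h_def by (intro mult_right_mono add_right_mono mult_left_mono power_mono) auto
    also have "\<dots> = c * (1/12) ^ N" by (simp add: c_def algebra_simps)
    finally have fin: "\<bar>E' u\<bar> \<le> c * (1/12) ^ N" .
    have "complex_of_real (F' s u) - poly (\<Sum>j\<le>N. Polynomial.smult (of_real (F' (equi_node N j) u)) (lagrange_basis_poly N j)) (of_real s) = of_real (E' u)"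
      by (simp add: poly_sum poly_lagrange_basis_poly lagrange_basis_of_real E'_def l_def mult.commute)
    then show "norm (complex_of_real (F' s u) - poly (\<Sum>j\<le>N. Polynomial.smult (of_real (F' (equi_node N j) u)) (lagrange_basis_poly N j)) (of_real s)) \<le> c * (1/12) ^ N"
      using fin by (simp only: norm_of_real)
  qed
  show thesis by (rule polynomial_uniform_limit[where ?N0.0 = "max N0 1", OF main c that])
qed

section \<open>Singularity of linear maps depending analytically on a parameter\<close>

text \<open>Kernel vectors of \<open>f\<close> and of its matrix correspond through coordinates in
  an enumerated basis. The determinant makes singularity the vanishing of one polynomial in the
  entries.\<close>

lemma singular_iff_det_zero:
  fixes f :: "'a::euclidean_space \<Rightarrow> 'a"
  assumes f: "linear f" and xs: "distinct xs" "set xs = (Basis :: 'a set)"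
  shows "\<not> inj f \<longleftrightarrow> Determinant.det (mat (length xs) (length xs) (\<lambda>(i, j). inner (f (xs ! j)) (xs ! i))) = 0"
proof -
  let ?n = "length xs"
  let ?A = "mat ?n ?n (\<lambda>(i, j). inner (f (xs ! j)) (xs ! i))"
  have A: "?A \<in> carrier_mat ?n ?n" by simp
  have bij: "bij_betw (\<lambda>i. xs ! i) {..<?n} Basis" using bij_betw_nth[OF xs(1) refl xs(2)[symmetric]] by simp
  have rep: "(\<Sum>j<?n. inner x (xs ! j) *\<^sub>R (xs ! j)) = x" for x
    using sum.reindex_bij_betw[OF bij, of "\<lambda>b. inner x b *\<^sub>R b"] euclidean_representation[of x] by simp
  have entry: "(?A *\<^sub>v v) $ i = inner (f (\<Sum>j<?n. (v $ j) *\<^sub>R (xs ! j))) (xs ! i)" if "i < ?n" "v \<in> carrier_vec ?n" for i v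
  proof -
    have "(?A *\<^sub>v v) $ i = (\<Sum>j<?n. inner (f (xs ! j)) (xs ! i) * (v $ j))"
      using that by (auto simp: scalar_prod_def atLeast0LessThan intro!: sum.cong)
    then show ?thesis using f by (simp add: linear_sum linear_cmul inner_sum_left mult.commute)
  qed
  have "\<not> inj f \<longleftrightarrow> (\<exists>x. x \<noteq> 0 \<and> f x = 0)" using linear_injective_0[OF f] by blast
  also have "\<dots> \<longleftrightarrow> (\<exists>v. v \<in> carrier_vec ?n \<and> v \<noteq> 0\<^sub>v ?n \<and> ?A *\<^sub>v v = 0\<^sub>v ?n)"
  proof
    assume "\<exists>x. x \<noteq> 0 \<and> f x = 0"
    then obtain x where x: "x \<noteq> 0" "f x = 0" by blast
    let ?v = "vec ?n (\<lambda>j. inner x (xs ! j))"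
    have s: "(\<Sum>j<?n. (?v $ j) *\<^sub>R (xs ! j)) = x" by (simp add: rep)
    have "?A *\<^sub>v ?v = 0\<^sub>v ?n"
    proof (rule eq_vecI)
      fix i assume "i < dim_vec (0\<^sub>v ?n :: real vec)"
      then show "(?A *\<^sub>v ?v) $ i = 0\<^sub>v ?n $ i" using entry[of i ?v] s x by simp
    qed simp
    moreover have "?v \<noteq> 0\<^sub>v ?n"
    proof
      assume "?v = 0\<^sub>v ?n"
      then have "?v $ j = 0" if "j < ?n" for j using that by simp
      then have "x = 0" using s by (metis (no_types, lifting) lessThan_iff scaleR_eq_0_iff sum.neutral)
      then show False using x by simp
    qed
    ultimately show "\<exists>v. v \<in> carrier_vec ?n \<and> v \<noteq> 0\<^sub>v ?n \<and> ?A *\<^sub>v v = 0\<^sub>v ?n" by (intro exI[of _ ?v]) simp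
  next
    assume "\<exists>v. v \<in> carrier_vec ?n \<and> v \<noteq> 0\<^sub>v ?n \<and> ?A *\<^sub>v v = 0\<^sub>v ?n"
    then obtain v where v: "v \<in> carrier_vec ?n" "v \<noteq> 0\<^sub>v ?n" "?A *\<^sub>v v = 0\<^sub>v ?n" by blast
    let ?x = "\<Sum>j<?n. (v $ j) *\<^sub>R (xs ! j)"
    have coord: "inner ?x (xs ! i) = v $ i" if i: "i < ?n" for i
    proof -
      have "inner ?x (xs ! i) = (\<Sum>j<?n. if j = i then v $ j else 0)"
        unfolding inner_sum_left
      proof (rule sum.cong[OF refl])
        fix j assume j: "j \<in> {..<?n}"
        have "xs ! j \<in> Basis" "xs ! i \<in> Basis" using i j xs(2) nth_mem by auto
        then have "inner (xs ! j) (xs ! i) = (if j = i then 1 else 0)"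
          using i j xs(1) by (auto simp: inner_Basis nth_eq_iff_index_eq)
        then show "inner ((v $ j) *\<^sub>R (xs ! j)) (xs ! i) = (if j = i then v $ j else 0)" by simp
      qed
      then show ?thesis using i by simp
    qed
    have "f ?x = 0"
    proof (rule euclidean_eqI)
      fix b :: 'a assume "b \<in> Basis"
      then obtain i where i: "i < ?n" "b = xs ! i" using xs(2) by (metis in_set_conv_nth)
      show "inner (f ?x) b = inner 0 b" using entry[OF i(1) v(1)] v(3) i by simp
    qed
    moreover have "?x \<noteq> 0"
    proof
      assume "?x = 0"
      then have "v $ i = 0" if "i < ?n" for i using coord[OF that] by simp
      then have "v = 0\<^sub>v ?n" using v(1) by (intro eq_vecI) auto
      then show False using v(2) by simp
    qed
    ultimately show "\<exists>x. x \<noteq> 0 \<and> f x = 0" by blast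
  qed
  also have "\<dots> \<longleftrightarrow> Determinant.det ?A = 0" using det_0_iff_vec_prod_zero_field[OF A] by blast
  finally show ?thesis .
qed

text \<open>Sums and products of holomorphic functions are holomorphic, so the Leibniz formula turns
  extensions of the matrix entries into an extension of the determinant.\<close>

lemma singular_holomorphic_condition:
  fixes M :: "real \<Rightarrow> 'a::euclidean_space \<Rightarrow> 'a"
  assumes lin: "\<And>s. \<bar>s\<bar> < 1 \<Longrightarrow> linear (M s)"
    and hol: "\<And>u b. b \<in> Basis \<Longrightarrow> \<exists>\<Psi>. \<Psi> holomorphic_on ball 0 1 \<and> (\<forall>s. \<bar>s\<bar> < 1 \<longrightarrow> \<Psi> (complex_of_real s) = of_real (inner (M s u) b))"
  obtains \<psi> where "\<psi> holomorphic_on ball 0 1" "\<And>s. \<bar>s\<bar> < 1 \<Longrightarrow> \<psi> (complex_of_real s) = 0 \<longleftrightarrow> \<not> inj (M s)"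
proof -
  obtain xs :: "'a list" where xs: "distinct xs" "set xs = Basis" using finite_distinct_list[OF finite_Basis] by metis
  let ?n = "length xs"
  have "\<forall>u b. \<exists>\<Psi>. b \<in> Basis \<longrightarrow> \<Psi> holomorphic_on ball 0 1 \<and> (\<forall>s. \<bar>s\<bar> < 1 \<longrightarrow> \<Psi> (complex_of_real s) = of_real (inner (M s u) b))"
    using hol by blast
  then obtain \<Psi> where "\<And>u b. b \<in> Basis \<longrightarrow> \<Psi> u b holomorphic_on ball 0 1 \<and> (\<forall>s. \<bar>s\<bar> < 1 \<longrightarrow> \<Psi> u b (complex_of_real s) = of_real (inner (M s u) b))"
    by metis
  then have \<Psi>: "\<And>u b. b \<in> Basis \<Longrightarrow> \<Psi> u b holomorphic_on ball 0 1"
    "\<And>u b s. b \<in> Basis \<Longrightarrow> \<bar>s\<bar> < 1 \<Longrightarrow> \<Psi> u b (complex_of_real s) = of_real (inner (M s u) b)"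
    by blast+
  \<comment> \<open>Leibniz formula with every entry replaced by its holomorphic extension; on the
    real axis it is the determinant of \<open>M s\<close>.\<close>
  define \<psi> where "\<psi> z = (\<Sum>p | p permutes {0..<?n}. signof p * (\<Prod>i=0..<?n. \<Psi> (xs ! p i) (xs ! i) z))" for z
  have xb: "xs ! i \<in> Basis" if "i \<in> {0..<?n}" for i using that xs(2) nth_mem[of i xs] by simp
  have "\<psi> holomorphic_on ball 0 1" unfolding \<psi>_def by (intro holomorphic_intros \<Psi> xb)
  moreover have "\<psi> (complex_of_real s) = 0 \<longleftrightarrow> \<not> inj (M s)" if s: "\<bar>s\<bar> < 1" for s
  proof -
    let ?A = "mat ?n ?n (\<lambda>(i, j). inner (M s (xs ! j)) (xs ! i))"
    have A: "?A \<in> carrier_mat ?n ?n" by simp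
    have "complex_of_real (Determinant.det ?A) = \<psi> (of_real s)"
      unfolding det_def'[OF A] \<psi>_def of_real_sum
    proof (rule sum.cong[OF refl])
      fix p assume p: "p \<in> {p. p permutes {0..<?n}}"
      have "(\<Prod>i=0..<?n. ?A $$ (i, p i)) = (\<Prod>i=0..<?n. inner (M s (xs ! p i)) (xs ! i))"
        using p permutes_in_image[of p "{0..<?n}"] by (intro prod.cong refl) auto
      then show "complex_of_real (signof p * (\<Prod>i=0..<?n. ?A $$ (i, p i))) = signof p * (\<Prod>i=0..<?n. \<Psi> (xs ! p i) (xs ! i) (of_real s))"
        by (simp add: \<Psi>(2)[OF xb s] sign_def)
    qed
    then show ?thesis using singular_iff_det_zero[OF lin[OF s] xs] by (metis of_real_eq_0_iff)
  qed
  ultimately show thesis by (rule that)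
qed

text \<open>At a limit point of \<open>Z\<close> the zeros of the local \<psi> accumulate at 0, so
  \<psi> vanishes identically and \<open>Z\<close> contains a neighbourhood. Hence the set of limit
  points is open as well as closed. It misses \<beta>, so it is empty, and \<open>Z\<close> meets
  every compact interval in a finite set. The functions at different \<alpha> need not agree; only
  their real zeros are tied to \<open>Z\<close>.\<close>

lemma countable_zero_set_of_analytic_germs:
  fixes Z :: "real set"
  assumes loc: "\<And>\<alpha>. \<exists>r>0. \<exists>\<psi>. \<psi> holomorphic_on ball 0 1 \<and> (\<forall>s. \<bar>s\<bar> < 1 \<longrightarrow> (\<psi> (complex_of_real s) = 0 \<longleftrightarrow> \<alpha> + r * s \<in> Z))"
    and z: "\<beta> \<notin> Z"
  shows "countable Z"
proof -
  define I where "I = {\<alpha>. \<alpha> islimpt Z}"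
  have cl: "closed I" unfolding I_def by (rule closed_limpts)
  have full: "\<exists>r>0. ball \<alpha> r \<subseteq> Z" if \<alpha>: "\<alpha> \<in> I" for \<alpha>
  proof -
    obtain r \<psi> where r: "r > 0" "\<psi> holomorphic_on ball 0 1" "\<And>s. \<bar>s\<bar> < 1 \<Longrightarrow> \<psi> (complex_of_real s) = 0 \<longleftrightarrow> \<alpha> + r * s \<in> Z"
      using loc[of \<alpha>] by blast
    let ?U = "complex_of_real ` {s. \<bar>s\<bar> < 1 \<and> \<alpha> + r * s \<in> Z}"
    have lim: "0 islimpt ?U" unfolding islimpt_approachable
    proof (intro allI impI)
      fix e :: real assume e: "e > 0"
      then have "r * min e 1 > 0" using r by simp
      then obtain x where x: "x \<in> Z" "x \<noteq> \<alpha>" "dist x \<alpha> < r * min e 1"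
        using \<alpha> unfolding I_def islimpt_approachable by blast
      let ?s = "(x - \<alpha>) / r"
      have "\<bar>x - \<alpha>\<bar> / r < min e 1"
        unfolding pos_divide_less_eq[OF r(1)] using x(3) by (simp only: dist_real_def mult.commute)
      then have s: "\<bar>?s\<bar> < min e 1" using r(1) by (simp add: abs_divide)
      have "\<alpha> + r * ?s = x" using r by simp
      then have "complex_of_real ?s \<in> ?U" using s x by (intro imageI) simp
      moreover have "complex_of_real ?s \<noteq> 0" using x r by (simp del: of_real_divide of_real_diff)
      moreover have "dist (complex_of_real ?s) 0 < e" using s by (simp del: of_real_divide of_real_diff)
      ultimately show "\<exists>x'\<in>?U. x' \<noteq> 0 \<and> dist x' 0 < e" by blast
    qed
    have zero: "\<psi> w = 0" if "w \<in> ball 0 1" for w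
      by (rule analytic_continuation[of \<psi> "ball 0 1" ?U 0]) (use r lim that in auto)
    have "x \<in> Z" if x: "x \<in> ball \<alpha> r" for x
    proof -
      have s: "\<bar>(x - \<alpha>) / r\<bar> < 1" using x r by (simp add: dist_real_def abs_minus_commute)
      then have "\<psi> (of_real ((x - \<alpha>) / r)) = 0" by (intro zero) (simp del: of_real_divide of_real_diff)
      then show ?thesis using r(3)[OF s] r(1) by simp
    qed
    then show ?thesis using r(1) by blast
  qed
  have "open I" unfolding open_contains_ball
  proof
    fix \<alpha> assume "\<alpha> \<in> I"
    then obtain r where r: "r > 0" "ball \<alpha> r \<subseteq> Z" using full by blast
    have "ball \<alpha> r \<subseteq> I"
    proof
      fix x assume "x \<in> ball \<alpha> r"
      then have "x islimpt ball \<alpha> r" by (simp add: r islimpt_ball less_imp_le)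
      then show "x \<in> I" using r(2) islimpt_subset by (auto simp: I_def)
    qed
    then show "\<exists>e>0. ball \<alpha> e \<subseteq> I" using r(1) by blast
  qed
  then have "I = {} \<or> I = UNIV" using cl clopen by blast
  moreover have "\<beta> \<notin> I" using full[of \<beta>] z by (auto simp: subset_iff)
  ultimately have "I = {}" by blast
  then have "finite (cball 0 (real n) \<inter> Z)" for n
    by (intro finite_not_islimpt_in_compact) (auto simp: I_def)
  then have "countable (\<Union>n. cball 0 (real n) \<inter> Z)" by (intro countable_UN) (auto intro: countable_finite)
  moreover have "Z \<subseteq> (\<Union>n. cball 0 (real n) \<inter> Z)" using real_arch_simple by fastforce
  ultimately show ?thesis by (meson countable_subset)
qed

section \<open>Local stable sets\<close>

text \<open>The inverse of \<open>f\<close> on the image is Lipschitz, and Lipschitz maps preserve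
  null sets. It serves both for the Lipschitz graph at a saddle and for preimages under step
  maps.\<close>

lemma negligible_lower_lipschitz:
  fixes f :: "'a::euclidean_space \<Rightarrow> 'a"
  assumes c: "c > 0" and low: "\<And>x y. x \<in> W \<Longrightarrow> y \<in> W \<Longrightarrow> norm (f x - f y) \<ge> c * norm (x - y)"
    and neg: "negligible (f ` W)"
  shows "negligible W"
proof -
  have inj: "inj_on f W"
  proof (rule inj_onI)
    fix x y assume "x \<in> W" "y \<in> W" "f x = f y"
    then have "c * norm (x - y) \<le> 0" using low by fastforce
    then show "x = y" using c by (simp add: mult_le_0_iff)
  qed
  let ?g = "inv_into W f"
  have "negligible (?g ` (f ` W))"
  proof (rule negligible_locally_Lipschitz_image[OF order_refl neg])
    fix x assume x: "x \<in> f ` W"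
    have "norm (?g y - ?g x) \<le> (1/c) * norm (y - x)" if "y \<in> f ` W" for y
    proof -
      have "c * norm (?g y - ?g x) \<le> norm (f (?g y) - f (?g x))" using x that by (intro low inv_into_into)
      then have "c * norm (?g y - ?g x) \<le> norm (y - x)" using x that by (simp add: f_inv_into_f)
      then show ?thesis using c by (simp add: field_simps)
    qed
    then show "\<exists>T B. open T \<and> x \<in> T \<and> (\<forall>y\<in>f ` W \<inter> T. norm (?g y - ?g x) \<le> B * norm (y - x))"
      by (intro exI[of _ UNIV] exI[of _ "1/c"]) auto
  qed
  moreover have "?g ` (f ` W) = W" using inj by (simp add: image_comp inv_into_image_cancel)
  ultimately show ?thesis by simp
qed

text \<open>A symmetric bilinear form that is only assumed positive definite plays the role of the
  Riemannian metric at the saddle.\<close>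

locale inner_form =
  fixes B :: "'a::euclidean_space \<Rightarrow> 'a \<Rightarrow> real"
  assumes bil: "bilinear B" and sym: "B u v = B v u" and pos: "u \<noteq> 0 \<Longrightarrow> B u u > 0"
begin

lemma add_left: "B (u + v) w = B u w + B v w" and add_right: "B w (u + v) = B w u + B w v"
  and diff_left: "B (u - v) w = B u w - B v w" and diff_right: "B w (u - v) = B w u - B w v"
  and scale_left: "B (c *\<^sub>R u) w = c * B u w" and scale_right: "B w (c *\<^sub>R u) = c * B w u"
  and zero_left: "B 0 w = 0" and zero_right: "B w 0 = 0"
  using bil by (simp_all add: bilinear_ladd bilinear_radd bilinear_lsub bilinear_rsub bilinear_lmul bilinear_rmul bilinear_lzero bilinear_rzero)

lemma coercive:
  obtains c where "c > 0" "\<And>u. B u u \<ge> c * (norm u)\<^sup>2"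
proof -
  have cont: "continuous_on (sphere 0 1) (\<lambda>u. B u u)"
    using bil bilinear_conv_bounded_bilinear by (intro bounded_bilinear.continuous_on[of B] continuous_on_id) auto
  obtain b :: 'a where "b \<in> Basis" using nonempty_Basis by blast
  then have "(sphere 0 1 :: 'a set) \<noteq> {}" using norm_Basis by fastforce
  then obtain u0 where u0: "u0 \<in> sphere 0 1" "\<And>u. u \<in> sphere 0 1 \<Longrightarrow> B u0 u0 \<le> B u u"
    using continuous_attains_inf[OF compact_sphere _ cont] by metis
  have "B u0 u0 > 0" using u0(1) by (intro pos) auto
  moreover have "B u u \<ge> B u0 u0 * (norm u)\<^sup>2" for u
  proof (cases "u = 0")
    case False
    have "B u0 u0 \<le> B (u /\<^sub>R norm u) (u /\<^sub>R norm u)" using False by (intro u0) simp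
    also have "\<dots> = B u u / (norm u)\<^sup>2" by (simp add: scale_left scale_right power2_eq_square divide_inverse)
    finally show ?thesis using False by (simp add: field_simps)
  qed (simp add: zero_left)
  ultimately show thesis by (rule that)
qed

text \<open>Eigenvectors of a \<open>B\<close>-self-adjoint map for distinct eigenvalues are
  \<open>B\<close>-orthogonal, hence independent, so finite dimension does not allow a whole
  interval of eigenvalues.\<close>

lemma non_eigenvalue:
  assumes A: "linear A" "\<And>u v. B (A u) v = B u (A v)" and ab: "a < b"
  obtains \<kappa> where "a < \<kappa>" "\<kappa> < b" "\<And>v. A v = \<kappa> *\<^sub>R v \<Longrightarrow> v = 0"
proof (rule ccontr)
  assume "\<not> thesis"
  then have "\<forall>\<kappa>\<in>{a<..<b}. \<exists>v. v \<noteq> 0 \<and> A v = \<kappa> *\<^sub>R v" using that by fastforce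
  then obtain v where v: "\<And>\<kappa>. \<kappa> \<in> {a<..<b} \<Longrightarrow> v \<kappa> \<noteq> 0 \<and> A (v \<kappa>) = \<kappa> *\<^sub>R v \<kappa>" by metis
  have orth: "B (v \<kappa>) (v \<kappa>') = 0" if "\<kappa> \<in> {a<..<b}" "\<kappa>' \<in> {a<..<b}" "\<kappa> \<noteq> \<kappa>'" for \<kappa> \<kappa>'
  proof -
    have "\<kappa> * B (v \<kappa>) (v \<kappa>') = \<kappa>' * B (v \<kappa>) (v \<kappa>')"
      using A(2)[of "v \<kappa>" "v \<kappa>'"] v that by (simp add: scale_left scale_right)
    then show ?thesis using that by simp
  qed
  have inj: "inj_on v {a<..<b}"
  proof (rule inj_onI)
    fix x y assume xy: "x \<in> {a<..<b}" "y \<in> {a<..<b}" "v x = v y"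
    show "x = y"
    proof (rule ccontr)
      assume "x \<noteq> y"
      then have "B (v x) (v x) = 0" using orth[OF xy(1,2)] xy(3) by simp
      then show False using pos[of "v x"] v[OF xy(1)] by simp
    qed
  qed
  have "independent (v ` {a<..<b})"
    unfolding independent_explicit_finite_subsets
  proof (intro allI impI ballI)
    fix S u w assume S: "S \<subseteq> v ` {a<..<b}" "finite S" "(\<Sum>x\<in>S. u x *\<^sub>R x) = 0" "w \<in> S"
    have o: "B x w = 0" if "x \<in> S" "x \<noteq> w" for x
      using that S(1,4) orth by blast
    obtain k where k: "k \<in> {a<..<b}" "w = v k" using S(1,4) by (meson imageE subsetD)
    have "w \<noteq> 0" using v[OF k(1)] k(2) by simp
    have lin: "linear (\<lambda>x. B x w)" using bil by (simp add: bilinear_def)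
    have "0 = B (\<Sum>x\<in>S. u x *\<^sub>R x) w" using S(3) by (simp add: zero_left)
    also have "\<dots> = (\<Sum>x\<in>S. u x * B x w)" by (simp add: linear_sum[OF lin] scale_left)
    also have "\<dots> = (\<Sum>x\<in>S. if x = w then u w * B w w else 0)" using o by (intro sum.cong) auto
    also have "\<dots> = u w * B w w" using S by simp
    finally show "u w = 0" using pos[OF \<open>w \<noteq> 0\<close>] by simp
  qed
  then have "finite (v ` {a<..<b})" by (rule independent_imp_finite)
  then show False using inj ab infinite_Ioo[OF ab] by (simp add: finite_image_iff)
qed

text \<open>The difference of two nearby orbits is controlled by \<open>Q v = B (A v) (A v) - \<kappa> B v v\<close>, since
  \<open>Q (A v) - \<kappa> Q v = B (A (A v) - \<kappa> v) (A (A v) - \<kappa> v)\<close>.  Where \<open>Q\<close> is positive it thus grows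
  geometrically, so orbits staying in a small ball have initial points that differ by a vector
  outside a cone around the unstable eigenvector.\<close>

lemma negligible_local_stable_set:
  assumes T: "has_strict_derivative T A a" and self: "\<And>u v. B (A u) v = B u (A v)"
    and eig: "A e = \<nu> *\<^sub>R e" "e \<noteq> 0" "\<nu> > 1"
  obtains d where "d > 0" "negligible {x. \<forall>n. (T ^^ n) x \<in> ball a d}"
proof -
  have blA: "bounded_linear A" using T by (rule has_strict_derivative_bounded_linear)
  then have lA: "linear A" by (rule bounded_linear.linear)
  have "1 < \<nu>\<^sup>2" using eig(3) by (simp add: one_less_power)
  \<comment> \<open>\<kappa> > 1 makes the growth geometric, \<kappa> < \<nu>^2 makes the form
    positive at \<open>e\<close>, and \<kappa> not being an eigenvalue of \<open>A \<circ> A\<close>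
    makes \<open>L\<close> injective, which leaves a gain of \<open>c * (norm v)\<^sup>2\<close> per
    step.\<close>
  then obtain \<kappa> where \<kappa>: "1 < \<kappa>" "\<kappa> < \<nu>\<^sup>2" "\<And>v. A (A v) = \<kappa> *\<^sub>R v \<Longrightarrow> v = 0"
    using non_eigenvalue[of "\<lambda>v. A (A v)" 1 "\<nu>\<^sup>2"] linear_compose[OF lA lA] self by (auto simp: o_def)
  define q where "q u v = B (A u) (A v) - \<kappa> * B u v" for u v
  define L where "L v = A (A v) - \<kappa> *\<^sub>R v" for v
  have linL: "linear L" unfolding L_def[abs_def]
    using linear_compose[OF lA lA] by (intro linear_compose_sub) (auto simp: o_def linear_iff scaleR_right_distrib)
  have injL: "inj L" using \<kappa>(3) by (simp add: linear_injective_0[OF linL] L_def)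
  have qL: "q (A v) (A v) = \<kappa> * q v v + B (L v) (L v)" for v
    using self[of "A v" v] self[of v "A v"] self[of "A v" "A (A v)"] sym[of v "A (A v)"]
    by (simp add: q_def L_def diff_left diff_right scale_left scale_right algebra_simps)
  obtain c1 where c1: "c1 > 0" "\<And>u. B u u \<ge> c1 * (norm u)\<^sup>2" using coercive by blast
  obtain c2 where c2: "c2 > 0" "\<And>u. norm (L u) \<ge> c2 * norm u" using linear_injective_lower_bound[OF linL injL] by blast
  define c where "c = c1 * c2\<^sup>2"
  have c: "c > 0" using c1 c2 by (simp add: c_def)
  have BL: "B (L v) (L v) \<ge> c * (norm v)\<^sup>2" for v
  proof -
    have "c * (norm v)\<^sup>2 = c1 * (c2 * norm v)\<^sup>2" by (simp add: c_def power_mult_distrib)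
    also have "\<dots> \<le> c1 * (norm (L v))\<^sup>2" using c1 c2 by (intro mult_left_mono power_mono) auto
    finally show ?thesis using c1(2)[of "L v"] by simp
  qed
  obtain KB where KB: "KB > 0" "\<And>u v. \<bar>B u v\<bar> \<le> KB * norm u * norm v"
    using bilinear_bounded_pos[OF bil] by auto
  obtain KA where KA: "KA > 0" "\<And>u. norm (A u) \<le> KA * norm u"
    using bounded_linear.pos_bounded[OF blA] by (metis mult.commute)
  define Kq where "Kq = KB * KA\<^sup>2 + \<kappa> * KB"
  have Kq: "Kq > 0" using KB KA \<kappa> by (simp add: Kq_def add_pos_pos)
  have qb: "\<bar>q u v\<bar> \<le> Kq * norm u * norm v" for u v
  proof -
    have "\<bar>q u v\<bar> \<le> \<bar>B (A u) (A v)\<bar> + \<kappa> * \<bar>B u v\<bar>"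
      using abs_triangle_ineq4[of "B (A u) (A v)" "\<kappa> * B u v"] \<kappa>(1) by (simp add: q_def abs_mult)
    also have "\<dots> \<le> KB * (KA * norm u) * (KA * norm v) + \<kappa> * (KB * norm u * norm v)"
      using KB KA \<kappa>(1) by (intro add_mono order_trans[OF KB(2)] mult_mono mult_left_mono KA) auto
    finally show ?thesis by (simp add: Kq_def power2_eq_square algebra_simps)
  qed
  have qsym: "q u v = q v u" for u v by (simp add: q_def sym)
  have qadd: "q (u + v) (u + v) = q u u + 2 * q u v + q v v" for u v
    using qsym[of u v] lA by (simp add: q_def linear_add add_left add_right algebra_simps sym)
  \<comment> \<open>With \<open>E\<close> the strict error, 2 q (A v) E + q E E is at most
    \<open>Kq * (2 * KA + 1) * \<epsilon> * (norm v)\<^sup>2\<close> in absolute value; this choice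
    keeps it below the gain \<open>c * (norm v)\<^sup>2\<close>. The bound 1 replaces \<epsilon>^2
    by \<epsilon>.\<close>
  define \<epsilon> where "\<epsilon> = min 1 (c / (Kq * (2 * KA + 1)))"
  have \<epsilon>: "\<epsilon> > 0" "\<epsilon> \<le> 1" "Kq * (2 * KA + 1) * \<epsilon> \<le> c" 
  proof -
    have D: "Kq * (2 * KA + 1) > 0" using Kq KA by (simp add: add_pos_pos)
    then show "\<epsilon> > 0" "\<epsilon> \<le> 1" using c by (auto simp: \<epsilon>_def)
    have "\<epsilon> \<le> c / (Kq * (2 * KA + 1))" by (simp add: \<epsilon>_def)
    then show "Kq * (2 * KA + 1) * \<epsilon> \<le> c" unfolding pos_le_divide_eq[OF D] by (simp only: mult.commute)
  qed
  obtain d where d: "d > 0" "\<And>x y. x \<in> ball a d \<Longrightarrow> y \<in> ball a d \<Longrightarrow> norm (T x - T y - A (x - y)) \<le> \<epsilon> * norm (x - y)"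
    using has_strict_derivativeD[OF T \<epsilon>(1)] by metis
  have grow: "q (T x - T y) (T x - T y) \<ge> \<kappa> * q (x - y) (x - y)" if "x \<in> ball a d" "y \<in> ball a d" for x y
  proof -
    define v where "v = x - y"
    define E where "E = T x - T y - A v"
    have E: "norm E \<le> \<epsilon> * norm v" using d(2)[OF that] by (simp add: E_def v_def)
    have "q (T x - T y) (T x - T y) = q (A v) (A v) + 2 * q (A v) E + q E E"
      using qadd[of "A v" E] by (simp add: E_def)
    moreover have "\<bar>q (A v) E\<bar> \<le> Kq * (KA * norm v) * (\<epsilon> * norm v)"
      using Kq KA E by (intro order_trans[OF qb] mult_mono mult_left_mono KA(2)) auto
    moreover have "\<bar>q E E\<bar> \<le> Kq * (\<epsilon> * norm v) * (\<epsilon> * norm v)"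
      using Kq E \<epsilon> by (intro order_trans[OF qb] mult_mono mult_left_mono) auto
    moreover have "Kq * (\<epsilon> * norm v) * (\<epsilon> * norm v) \<le> Kq * (1 * norm v) * (\<epsilon> * norm v)"
      using Kq \<epsilon> by (intro mult_right_mono mult_left_mono) auto
    ultimately have "q (T x - T y) (T x - T y) \<ge> q (A v) (A v) - (Kq * (2 * KA + 1) * \<epsilon>) * (norm v)\<^sup>2"
      by (simp add: algebra_simps power2_eq_square)
    moreover have "(Kq * (2 * KA + 1) * \<epsilon>) * (norm v)\<^sup>2 \<le> c * (norm v)\<^sup>2" using \<epsilon>(3) by (rule mult_right_mono) auto
    ultimately show ?thesis using qL[of v] BL[of v] by (simp add: v_def)
  qed
  define W where "W = {x. \<forall>n. (T ^^ n) x \<in> ball a d}"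
  have Wq: "q (x - y) (x - y) \<le> 0" if x: "x \<in> W" and y: "y \<in> W" for x y
  proof (rule ccontr)
    assume "\<not> q (x - y) (x - y) \<le> 0"
    then have p: "q (x - y) (x - y) > 0" by simp
    have it: "q ((T ^^ n) x - (T ^^ n) y) ((T ^^ n) x - (T ^^ n) y) \<ge> \<kappa> ^ n * q (x - y) (x - y)" for n
    proof (induction n)
      case (Suc n)
      have "\<kappa> ^ Suc n * q (x - y) (x - y) \<le> \<kappa> * q ((T ^^ n) x - (T ^^ n) y) ((T ^^ n) x - (T ^^ n) y)"
        using mult_left_mono[OF Suc, of \<kappa>] \<kappa>(1) by (simp add: mult.assoc)
      also have "\<dots> \<le> q ((T ^^ Suc n) x - (T ^^ Suc n) y) ((T ^^ Suc n) x - (T ^^ Suc n) y)"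
        using grow[of "(T ^^ n) x" "(T ^^ n) y"] x y by (simp add: W_def)
      finally show ?case .
    qed simp
    have ub: "q ((T ^^ n) x - (T ^^ n) y) ((T ^^ n) x - (T ^^ n) y) \<le> Kq * (2 * d) * (2 * d)" for n
    proof -
      have "(T ^^ n) x \<in> ball a d" "(T ^^ n) y \<in> ball a d" using x y by (auto simp: W_def)
      then have "norm ((T ^^ n) x - (T ^^ n) y) \<le> 2 * d"
        using dist_triangle2[of "(T ^^ n) x" "(T ^^ n) y" a] by (simp add: dist_norm norm_minus_commute)
      then have "Kq * norm ((T ^^ n) x - (T ^^ n) y) * norm ((T ^^ n) x - (T ^^ n) y) \<le> Kq * (2 * d) * (2 * d)"
        using Kq d by (intro mult_mono mult_left_mono) auto
      then show ?thesis using qb[of "(T ^^ n) x - (T ^^ n) y" "(T ^^ n) x - (T ^^ n) y"] by linarith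
    qed
    \<comment> \<open>A positive value of \<open>q\<close> at the initial difference would grow past
      the bound that the ball imposes on all iterates.\<close>
    obtain n where "Kq * (2 * d) * (2 * d) / q (x - y) (x - y) < \<kappa> ^ n" using real_arch_pow[OF \<kappa>(1)] by blast
    then have "Kq * (2 * d) * (2 * d) < \<kappa> ^ n * q (x - y) (x - y)" using p by (simp add: pos_divide_less_eq)
    then show False using it[of n] ub[of n] by linarith
  qed
  have qe: "q e e > 0"
  proof -
    have "q e e = (\<nu>\<^sup>2 - \<kappa>) * B e e" by (simp add: q_def eig(1) scale_left scale_right power2_eq_square algebra_simps)
    then show ?thesis using \<kappa>(2) pos[OF eig(2)] by simp
  qed
  \<comment> \<open>For a difference s e + z with |z| < \<eta> |s|, the terms 2 s q(e,z) + q(z,z)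
    would be smaller than s^2 q(e,e), making \<open>q\<close> positive. So differences within
    \<open>W\<close> avoid this cone around \<open>e\<close>; the factor 2 makes the final
    comparison strict.\<close>
  define \<eta> where "\<eta> = min 1 (q e e / (2 * Kq * (2 * norm e + 1)))"
  have nn: "Kq * (2 * norm e + 1) > 0" using Kq by (simp add: add_nonneg_pos)
  have \<eta>: "\<eta> > 0" "\<eta> \<le> 1" using qe nn by (auto simp: \<eta>_def)
  have D: "2 * (Kq * (2 * norm e + 1)) > 0" using nn by simp
  have "\<eta> \<le> q e e / (2 * (Kq * (2 * norm e + 1)))" by (simp add: \<eta>_def mult.assoc)
  then have "\<eta> * (2 * (Kq * (2 * norm e + 1))) \<le> q e e" unfolding pos_le_divide_eq[OF D] .
  then have "2 * (Kq * (2 * norm e + 1) * \<eta>) \<le> q e e" by (simp only: mult_ac)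
  then have \<eta>3: "Kq * (2 * norm e + 1) * \<eta> < q e e" using qe by linarith
  \<comment> \<open>Euclidean projection along \<open>e\<close> onto its orthogonal hyperplane. On
    \<open>W\<close> it does not shrink distances by more than a fixed factor, so \<open>W\<close>
    is a Lipschitz graph over a null set.\<close>
  define \<pi> where "\<pi> x = x - (inner e x / inner e e) *\<^sub>R e" for x
  have "norm (\<pi> x - \<pi> y) \<ge> (1 / (norm e / \<eta> + 1)) * norm (x - y)" if x: "x \<in> W" and y: "y \<in> W" for x y
  proof -
    define s where "s = inner e (x - y) / inner e e"
    define z where "z = \<pi> x - \<pi> y"
    have xy: "x - y = s *\<^sub>R e + z" by (simp add: s_def z_def \<pi>_def inner_diff_right diff_divide_distrib scaleR_left_diff_distrib)
    have le: "s\<^sup>2 * q e e + 2 * s * q e z + q z z \<le> 0"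
    proof -
      have "q (s *\<^sub>R e + z) (s *\<^sub>R e + z) = s\<^sup>2 * q e e + 2 * s * q e z + q z z"
        unfolding qadd using lA by (simp add: q_def linear_cmul scale_left scale_right power2_eq_square algebra_simps)
      then show ?thesis using Wq[OF x y] xy by simp
    qed
    have "\<eta> * \<bar>s\<bar> \<le> norm z"
    proof (rule ccontr)
      assume "\<not> \<eta> * \<bar>s\<bar> \<le> norm z"
      then have z: "norm z \<le> \<eta> * \<bar>s\<bar>" "s \<noteq> 0" using \<eta>(1) by auto
      have "\<bar>s * q e z\<bar> \<le> \<bar>s\<bar> * (Kq * norm e * (\<eta> * \<bar>s\<bar>))"
        unfolding abs_mult using Kq z by (intro mult_left_mono order_trans[OF qb]) auto
      moreover have "\<bar>q z z\<bar> \<le> Kq * (\<eta> * \<bar>s\<bar>) * (1 * \<bar>s\<bar>)"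
        using Kq z \<eta> by (intro order_trans[OF qb] mult_mono mult_left_mono order_trans[OF z(1)] mult_right_mono) auto
      ultimately have "s\<^sup>2 * q e e \<le> 2 * (\<bar>s\<bar> * (Kq * norm e * (\<eta> * \<bar>s\<bar>))) + Kq * (\<eta> * \<bar>s\<bar>) * (1 * \<bar>s\<bar>)"
        using le by linarith
      also have "\<dots> = s\<^sup>2 * (Kq * (2 * norm e + 1) * \<eta>)" by (simp add: power2_eq_square algebra_simps flip: abs_mult) 
      also have "\<dots> < s\<^sup>2 * q e e" using \<eta>3 z(2) by (intro mult_strict_left_mono) auto
      finally show False by simp
    qed
    then have "\<bar>s\<bar> \<le> norm z / \<eta>" using \<eta> by (simp add: field_simps)
    have "norm (x - y) \<le> \<bar>s\<bar> * norm e + norm z" unfolding xy using norm_triangle_ineq[of "s *\<^sub>R e" z] by simp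
    also have "\<dots> \<le> norm z / \<eta> * norm e + norm z" using \<open>\<bar>s\<bar> \<le> norm z / \<eta>\<close> by (intro add_right_mono mult_right_mono) auto
    also have "\<dots> = (norm e / \<eta> + 1) * norm z" by (simp add: algebra_simps)
    finally have "norm (x - y) \<le> (norm e / \<eta> + 1) * norm z" .
    moreover have "norm e / \<eta> + 1 > 0" using \<eta> by (simp add: add_nonneg_pos)
    ultimately show ?thesis by (simp add: z_def pos_divide_le_eq mult.commute)
  qed
  moreover have "negligible (\<pi> ` W)"
  proof (rule negligible_subset)
    show "negligible {x. inner e x = 0}" using eig(2) by (intro negligible_hyperplane) auto
    show "\<pi> ` W \<subseteq> {x. inner e x = 0}" using eig(2) by (auto simp: \<pi>_def inner_diff_right)
  qed
  moreover have "1 / (norm e / \<eta> + 1) > 0" using \<eta> by (simp add: add_nonneg_pos)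
  ultimately have "negligible W" by (intro negligible_lower_lipschitz[of "1 / (norm e / \<eta> + 1)" W \<pi>])
  then show thesis using that d(1) by (simp add: W_def)
qed

end

section \<open>Power series\<close>

definition mono_deg :: "('a::euclidean_space \<Rightarrow> nat) \<Rightarrow> nat" where
  "mono_deg \<kappa> = (\<Sum>b\<in>Basis. \<kappa> b)"

definition monomial :: "('a::euclidean_space \<Rightarrow> nat) \<Rightarrow> 'a \<Rightarrow> real" where
  "monomial \<kappa> u = (\<Prod>b\<in>Basis. inner u b ^ \<kappa> b)"

abbreviation multi_indices :: "('a::euclidean_space \<Rightarrow> nat) set" where
  "multi_indices \<equiv> Basis \<rightarrow>\<^sub>E UNIV"

lemma finite_mono_deg_le: "finite {\<kappa> \<in> multi_indices. mono_deg (\<kappa> :: 'a::euclidean_space \<Rightarrow> nat) \<le> N}"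
proof (rule finite_subset)
  show "finite (Basis \<rightarrow>\<^sub>E {..N} :: ('a \<Rightarrow> nat) set)" by (intro finite_PiE) auto
  show "{\<kappa> \<in> multi_indices. mono_deg (\<kappa> :: 'a \<Rightarrow> nat) \<le> N} \<subseteq> Basis \<rightarrow>\<^sub>E {..N}"
  proof
    fix \<kappa> :: "'a \<Rightarrow> nat" assume k: "\<kappa> \<in> {\<kappa> \<in> multi_indices. mono_deg \<kappa> \<le> N}"
    have "\<kappa> b \<le> N" if "b \<in> Basis" for b
    proof -
      have "\<kappa> b \<le> mono_deg \<kappa>" unfolding mono_deg_def using that by (intro member_le_sum) auto
      also have "\<dots> \<le> N" using k by simp
      finally show ?thesis .
    qed
    then show "\<kappa> \<in> Basis \<rightarrow>\<^sub>E {..N}" using k by (simp add: PiE_iff)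
  qed
qed

lemma abs_monomial_le:
  assumes "\<And>b. b \<in> Basis \<Longrightarrow> \<bar>inner u b\<bar> \<le> r"
  shows "\<bar>monomial \<kappa> u\<bar> \<le> r ^ mono_deg \<kappa>"
proof -
  have "\<bar>monomial \<kappa> u\<bar> = (\<Prod>b\<in>Basis. \<bar>inner u b\<bar> ^ \<kappa> b)" by (simp add: monomial_def abs_prod power_abs)
  also have "\<dots> \<le> (\<Prod>b\<in>(Basis :: 'a set). r ^ \<kappa> b)" using assms by (intro prod_mono conjI power_mono) auto
  also have "\<dots> = r ^ mono_deg \<kappa>" by (simp add: mono_deg_def power_sum)
  finally show ?thesis .
qed

lemma monomial_scaleR: "monomial \<kappa> (r *\<^sub>R u) = r ^ mono_deg \<kappa> * monomial \<kappa> u"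
  by (simp add: monomial_def mono_deg_def power_mult_distrib prod.distrib power_sum)

text \<open>After scaling to the unit ball every factor has modulus at most 1, so the difference of
  the products is at most the sum of the differences of the factors. Homogeneity restores the power
  of \<open>r\<close>.\<close>

lemma monomial_lipschitz:
  assumes r: "r > 0" and u: "norm u \<le> r" and v: "norm v \<le> r"
  shows "\<bar>monomial \<kappa> u - monomial \<kappa> v\<bar> \<le> r ^ mono_deg \<kappa> * (real (mono_deg \<kappa>) * norm (u - v) / r)"
proof -
  define U V where "U = u /\<^sub>R r" and "V = v /\<^sub>R r"
  have uv: "u = r *\<^sub>R U" "v = r *\<^sub>R V" using r by (simp_all add: U_def V_def)
  have n: "norm U \<le> 1" "norm V \<le> 1" using r u v by (simp_all add: U_def V_def field_simps)
  have n2: "\<bar>inner U b\<bar> \<le> 1" "\<bar>inner V b\<bar> \<le> 1" if "b \<in> Basis" for b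
    using Basis_le_norm[OF that, of U] Basis_le_norm[OF that, of V] n by linarith+
  have "\<bar>monomial \<kappa> U - monomial \<kappa> V\<bar> \<le> (\<Sum>b\<in>Basis. \<bar>inner U b ^ \<kappa> b - inner V b ^ \<kappa> b\<bar>)"
    unfolding monomial_def
    using norm_prod_diff[of Basis "\<lambda>b. inner U b ^ \<kappa> b" "\<lambda>b. inner V b ^ \<kappa> b"] n2 by (simp add: power_abs power_le_one)
  also have "\<dots> \<le> (\<Sum>b\<in>Basis. real (\<kappa> b) * norm (U - V))"
  proof (rule sum_mono)
    fix b :: 'a assume b: "b \<in> Basis"
    have "\<bar>inner U b ^ \<kappa> b - inner V b ^ \<kappa> b\<bar> \<le> real (\<kappa> b) * \<bar>inner U b - inner V b\<bar>"
      using norm_power_diff[of "inner U b" "inner V b" "\<kappa> b"] n2[OF b] by simp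
    also have "\<dots> \<le> real (\<kappa> b) * norm (U - V)"
      using Basis_le_norm[OF b, of "U - V"] by (intro mult_left_mono) (auto simp: inner_diff_left)
    finally show "\<bar>inner U b ^ \<kappa> b - inner V b ^ \<kappa> b\<bar> \<le> real (\<kappa> b) * norm (U - V)" .
  qed
  also have "\<dots> = real (mono_deg \<kappa>) * norm (U - V)" by (simp add: mono_deg_def sum_distrib_right)
  also have "norm (U - V) = norm (u - v) / r"
    using r by (simp add: U_def V_def divide_inverse mult.commute flip: scaleR_diff_right)
  finally have "r ^ mono_deg \<kappa> * \<bar>monomial \<kappa> U - monomial \<kappa> V\<bar> \<le> r ^ mono_deg \<kappa> * (real (mono_deg \<kappa>) * (norm (u - v) / r))"
    using r by (intro mult_left_mono) auto
  moreover have "\<bar>monomial \<kappa> u - monomial \<kappa> v\<bar> = r ^ mono_deg \<kappa> * \<bar>monomial \<kappa> U - monomial \<kappa> V\<bar>"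
    unfolding uv monomial_scaleR using r by (simp add: abs_mult flip: right_diff_distrib)
  ultimately show ?thesis by simp
qed

lemma monomial_strict_derivative: "\<exists>f'. has_strict_derivative (monomial \<kappa>) f' a"
proof -
  have pow: "\<exists>f'. has_strict_derivative (\<lambda>u. inner u b ^ n) f' a" for b and n :: nat
  proof (induction n)
    case 0
    then show ?case using has_strict_derivative_const by fastforce
  next
    case (Suc n)
    then obtain f' where "has_strict_derivative (\<lambda>u. inner u b ^ n) f' a" by blast
    from bounded_bilinear.has_strict_derivative[OF bounded_bilinear_mult has_strict_derivative_linear[OF bounded_linear_inner_left] this]
    show ?case by auto
  qed
  have "\<exists>f'. has_strict_derivative (\<lambda>u. \<Prod>b\<in>S. inner u b ^ \<kappa> b) f' a" if "finite S" for S
    using that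
  proof (induction S)
    case empty
    then show ?case using has_strict_derivative_const by fastforce
  next
    case (insert b S)
    obtain f' where f': "has_strict_derivative (\<lambda>u. \<Prod>b\<in>S. inner u b ^ \<kappa> b) f' a" using insert by blast
    obtain g' where g': "has_strict_derivative (\<lambda>u. inner u b ^ \<kappa> b) g' a" using pow by blast
    from bounded_bilinear.has_strict_derivative[OF bounded_bilinear_mult g' f'] insert
    show ?case by auto
  qed
  then show ?thesis unfolding monomial_def[abs_def] by simp
qed

text \<open>Comparison with a majorant whose sum is taken over a larger index set: tails of the
  series are estimated by the one constant \<open>infsum g A\<close>.\<close>

lemma has_sum_abs_bound:
  fixes f g :: "'i \<Rightarrow> real"
  assumes f: "(f has_sum x) D" and le: "\<And>i. i \<in> D \<Longrightarrow> \<bar>f i\<bar> \<le> k * g i"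
    and g: "g summable_on A" "D \<subseteq> A" "\<And>i. i \<in> A \<Longrightarrow> g i \<ge> 0" and k: "k \<ge> 0"
  shows "\<bar>x\<bar> \<le> k * infsum g A"
proof -
  have gD: "g summable_on D" using g summable_on_subset_banach by blast
  have hs: "((\<lambda>i. k * g i) has_sum (k * infsum g D)) D" using gD by (intro has_sum_cmult_right has_sum_infsum)
  have "x \<le> k * infsum g D" using le by (intro has_sum_mono[OF f hs]) (simp add: abs_le_iff)
  moreover have "((\<lambda>i. - f i) has_sum (- x)) D" using f by (simp add: has_sum_uminus)
  then have "- x \<le> k * infsum g D" by (rule has_sum_mono[OF _ hs]) (use le in \<open>simp add: abs_le_iff\<close>)
  moreover have "infsum g D \<le> infsum g A" using g gD by (intro infsum_mono2) auto
  then have "k * infsum g D \<le> k * infsum g A" using k by (rule mult_left_mono)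
  ultimately show ?thesis by linarith
qed

text \<open>Absolute convergence at the corner \<open>a + t\<cdot>(1,\<dots>,1)\<close> dominates the series near \<open>a\<close>.\<close>

locale scalar_power_series =
  fixes f :: "'a::euclidean_space \<Rightarrow> real" and a :: 'a and \<rho> :: real and c :: "('a \<Rightarrow> nat) \<Rightarrow> real"
  assumes rho: "\<rho> > 0"
    and series: "\<And>x. x \<in> ball a \<rho> \<Longrightarrow> ((\<lambda>\<kappa>. monomial \<kappa> (x - a) * c \<kappa>) has_sum f x) multi_indices"
begin

text \<open>The corner at coordinate distance \<open>t\<close> is at most \<open>DIM('a) * t\<close>
  away from \<open>a\<close>; this choice makes that half of \<rho>.\<close>

definition t :: real where "t = \<rho> / (2 * DIM('a))"

definition maj :: "('a \<Rightarrow> nat) \<Rightarrow> real" where "maj \<kappa> = t ^ mono_deg \<kappa> * \<bar>c \<kappa>\<bar>"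

lemma t: "t > 0" "t < \<rho>"
proof -
  have d: "real DIM('a) \<ge> 1" using DIM_positive[where 'a='a] by linarith
  show "t > 0" using rho by (simp add: t_def)
  then have "t * 1 < t * (2 * real DIM('a))" using d by (intro mult_strict_left_mono) linarith+
  also have "\<dots> = \<rho>" using d by (simp add: t_def)
  finally show "t < \<rho>" by simp
qed

lemma maj_nonneg: "maj \<kappa> \<ge> 0" using t by (simp add: maj_def)

text \<open>For real families \<open>has_sum\<close> is unconditional and therefore absolute; at the
  corner every monomial equals \<open>t ^ mono_deg \<kappa>\<close>.\<close>

lemma maj_summable: "maj summable_on multi_indices"
proof -
  define u :: 'a where "u = (\<Sum>b\<in>Basis. t *\<^sub>R b)"
  have "norm u \<le> (\<Sum>b\<in>(Basis::'a set). t)" unfolding u_def using t by (intro sum_norm_le) simp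
  also have "\<dots> < \<rho>" using rho by (simp add: t_def)
  finally have "a + u \<in> ball a \<rho>" by (simp add: dist_norm)
  from series[OF this] have "(\<lambda>\<kappa>. monomial \<kappa> u * c \<kappa>) summable_on multi_indices" by (auto simp: summable_on_def)
  then have "(\<lambda>\<kappa>. norm (monomial \<kappa> u * c \<kappa>)) summable_on multi_indices"
    by (rule summable_on_iff_abs_summable_on_real[THEN iffD1])
  moreover have "inner u b = t" if "b \<in> Basis" for b using that by (simp add: u_def inner_sum_left inner_Basis if_distrib sum.delta cong: if_cong)
  then have "monomial \<kappa> u = t ^ mono_deg \<kappa>" for \<kappa> by (simp add: monomial_def mono_deg_def power_sum)
  ultimately show ?thesis using t by (simp add: maj_def[abs_def] abs_mult)
qed

definition trunc :: "nat \<Rightarrow> 'a \<Rightarrow> real" where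
  "trunc N x = (\<Sum>\<kappa>\<in>{\<kappa>\<in>multi_indices. mono_deg \<kappa> \<le> N}. monomial \<kappa> (x - a) * c \<kappa>)"

lemma tail: "x \<in> ball a \<rho> \<Longrightarrow>
    ((\<lambda>\<kappa>. monomial \<kappa> (x - a) * c \<kappa>) has_sum (f x - trunc N x)) {\<kappa>\<in>multi_indices. mono_deg \<kappa> > N}"
proof -
  assume x: "x \<in> ball a \<rho>"
  let ?K = "{\<kappa>\<in>multi_indices. mono_deg \<kappa> \<le> N} :: ('a \<Rightarrow> nat) set"
  have "((\<lambda>\<kappa>. monomial \<kappa> (x - a) * c \<kappa>) has_sum trunc N x) ?K"
    unfolding trunc_def using finite_mono_deg_le by (rule has_sum_finite)
  from has_sum_Diff[OF series[OF x] this] have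
    "((\<lambda>\<kappa>. monomial \<kappa> (x - a) * c \<kappa>) has_sum (f x - trunc N x)) (multi_indices - ?K)" by auto
  moreover have "multi_indices - ?K = {\<kappa>\<in>multi_indices. mono_deg \<kappa> > N}" by auto
  ultimately show ?thesis by simp
qed

text \<open>Shrinking the radius from \<open>t\<close> by the factor 31104 gains that factor once
  per degree, so the terms of degree above \<open>N\<close> lose at least 31104^N against the
  majorant.\<close>

lemma trunc_error:
  assumes x: "norm (x - a) \<le> t / 31104"
  shows "\<bar>f x - trunc N x\<bar> \<le> infsum maj multi_indices * (1/31104) ^ N"
proof -
  have xb: "x \<in> ball a \<rho>" using x t by (simp add: dist_norm norm_minus_commute)
  have "\<bar>f x - trunc N x\<bar> \<le> (1/31104) ^ N * infsum maj multi_indices"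
  proof (rule has_sum_abs_bound[OF tail[OF xb]])
    fix \<kappa> :: "'a \<Rightarrow> nat" assume k: "\<kappa> \<in> {\<kappa>\<in>multi_indices. mono_deg \<kappa> > N}"
    have "\<bar>monomial \<kappa> (x - a)\<bar> \<le> (t / 31104) ^ mono_deg \<kappa>"
      using x Basis_le_norm[of _ "x - a"] by (intro abs_monomial_le) (meson order_trans)
    also have "\<dots> = (1/31104) ^ mono_deg \<kappa> * t ^ mono_deg \<kappa>" by (simp add: power_divide)
    also have "\<dots> \<le> (1/31104) ^ N * t ^ mono_deg \<kappa>" using k t by (intro mult_right_mono power_decreasing) auto
    finally have "\<bar>monomial \<kappa> (x - a)\<bar> * \<bar>c \<kappa>\<bar> \<le> ((1/31104) ^ N * t ^ mono_deg \<kappa>) * \<bar>c \<kappa>\<bar>" by (intro mult_right_mono) auto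
    then show "\<bar>monomial \<kappa> (x - a) * c \<kappa>\<bar> \<le> (1/31104) ^ N * maj \<kappa>" by (simp add: maj_def abs_mult)
  qed (use maj_summable maj_nonneg in auto)
  then show ?thesis by (simp add: mult.commute)
qed

lemma trunc_line_poly: "\<exists>P :: real poly. degree P \<le> N \<and> (\<forall>s. trunc N (p + s *\<^sub>R w) = poly P s)"
proof -
  define Q where "Q \<kappa> = Polynomial.smult (c \<kappa>) (\<Prod>b\<in>Basis. [: inner (p - a) b, inner w b :] ^ \<kappa> b)" for \<kappa> :: "'a \<Rightarrow> nat"
  let ?K = "{\<kappa>\<in>multi_indices. mono_deg \<kappa> \<le> N} :: ('a \<Rightarrow> nat) set"
  have "degree (Q \<kappa>) \<le> mono_deg \<kappa>" for \<kappa>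
  proof -
    have "degree (\<Prod>b\<in>Basis. [: inner (p - a) b, inner w b :] ^ \<kappa> b) \<le> (\<Sum>b\<in>Basis. degree ([: inner (p - a) b, inner w b :] ^ \<kappa> b))"
      using degree_prod_sum_le[of Basis "\<lambda>b. [: inner (p - a) b, inner w b :] ^ \<kappa> b"] by (simp add: o_def)
    also have "\<dots> \<le> (\<Sum>b\<in>Basis. \<kappa> b)"
    proof (rule sum_mono)
      fix b :: 'a
      have "degree ([: inner (p - a) b, inner w b :] ^ \<kappa> b) \<le> degree [: inner (p - a) b, inner w b :] * \<kappa> b" by (rule degree_power_le)
      also have "\<dots> \<le> 1 * \<kappa> b" by (intro mult_right_mono) auto
      finally show "degree ([: inner (p - a) b, inner w b :] ^ \<kappa> b) \<le> \<kappa> b" by simp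
    qed
    finally show ?thesis unfolding Q_def mono_deg_def using degree_smult_le order_trans by blast
  qed
  then have "degree (\<Sum>\<kappa>\<in>?K. Q \<kappa>) \<le> N" by (intro degree_sum_le finite_mono_deg_le) (auto intro: order_trans)
  moreover have "trunc N (p + s *\<^sub>R w) = poly (\<Sum>\<kappa>\<in>?K. Q \<kappa>) s" for s
    unfolding trunc_def poly_sum
  proof (rule sum.cong[OF refl])
    fix \<kappa> :: "'a \<Rightarrow> nat"
    have "inner (p + s *\<^sub>R w - a) b = inner (p - a) b + s * inner w b" for b by (simp add: inner_diff_left inner_add_left)
    then show "monomial \<kappa> (p + s *\<^sub>R w - a) * c \<kappa> = poly (Q \<kappa>) s"
      by (simp add: Q_def monomial_def poly_prod poly_power mult.commute)
  qed
  ultimately show ?thesis by blast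
qed

lemma line_fast_interpolation:
  assumes "\<And>s. \<bar>s\<bar> \<le> 1 \<Longrightarrow> norm (p + s *\<^sub>R w - a) \<le> t / 31104"
  shows "fast_interpolation (2 * infsum maj multi_indices) (\<lambda>s. f (p + s *\<^sub>R w))"
proof (rule fast_interpolation_from_polys)
  fix N
  obtain P :: "real poly" where "degree P \<le> N" "\<And>s. trunc N (p + s *\<^sub>R w) = poly P s" using trunc_line_poly by blast
  then show "\<exists>P :: real poly. degree P \<le> N \<and> (\<forall>s. \<bar>s\<bar> \<le> 1 \<longrightarrow> \<bar>f (p + s *\<^sub>R w) - poly P s\<bar> \<le> infsum maj multi_indices * (1/31104) ^ N)"
    using trunc_error[OF assms, of _ N] by (intro exI[of _ P]) metis
qed (use maj_nonneg in \<open>intro infsum_nonneg\<close>)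

text \<open>The part of degree at most 1 is a finite sum. Every other term has degree at least 2, so
  on a ball of radius \<open>t * \<theta>\<close> the remainder has a Lipschitz constant of order
  \<theta>; its strict derivative is zero.\<close>

lemma strict_derivative: "\<exists>f'. has_strict_derivative f f' a"
proof -
  have "\<exists>f'. has_strict_derivative (\<lambda>x. monomial \<kappa> (x - a) * c \<kappa>) f' a" for \<kappa>
  proof -
    obtain m' where m': "has_strict_derivative (monomial \<kappa>) m' (a - a)" using monomial_strict_derivative by blast
    have s: "has_strict_derivative (\<lambda>x. x - a) (\<lambda>h. h + 0) a"
      using has_strict_derivative_add[OF has_strict_derivative_ident has_strict_derivative_const[of "- a"]] by simp
    from has_strict_derivative_compose[OF has_strict_derivative_compose[OF s m'] has_strict_derivative_linear[OF bounded_linear_mult_left[of "c \<kappa>"]]]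
    show ?thesis by blast
  qed
  then obtain m' where m': "\<And>\<kappa>. has_strict_derivative (\<lambda>x. monomial \<kappa> (x - a) * c \<kappa>) (m' \<kappa>) a" by metis
  have tr: "has_strict_derivative (trunc 1) (\<lambda>h. \<Sum>\<kappa>\<in>{\<kappa>\<in>multi_indices. mono_deg \<kappa> \<le> 1}. m' \<kappa> h) a"
    unfolding trunc_def[abs_def] by (intro has_strict_derivative_sum m')
  define S where "S = infsum maj multi_indices"
  have S: "S \<ge> 0" unfolding S_def by (intro infsum_nonneg maj_nonneg)
  have rem: "has_strict_derivative (\<lambda>x. f x - trunc 1 x) (\<lambda>h. 0) a"
    unfolding has_strict_derivative_def
  proof (intro conjI allI impI)
    fix e :: real assume e: "e > 0"
    \<comment> \<open>The bound 1/4 gives \<open>(k + 2) * \<theta> ^ k \<le> 2\<close>; the other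
      one brings the Lipschitz constant \<open>2 * \<theta> * S / t\<close> below \<open>e\<close>.
      Using \<open>S + 1\<close> keeps the denominator positive.\<close>
    define \<theta> where "\<theta> = min (1/4) (e * t / (2 * (S + 1)))"
    have \<theta>: "\<theta> > 0" "\<theta> \<le> 1/4" using e t S unfolding \<theta>_def by (simp, intro min.cobounded1)
    have "\<theta> \<le> e * t / (2 * (S + 1))" by (simp add: \<theta>_def)
    then have "\<theta> * (2 * (S + 1)) \<le> e * t" using S by (simp add: pos_le_divide_eq)
    moreover have "\<theta> * (2 * S) \<le> \<theta> * (2 * (S + 1))" using \<theta> by (intro mult_left_mono) auto
    ultimately have \<theta>e: "2 * \<theta> * S \<le> e * t" by linarith
    show "\<exists>d>0. \<forall>x\<in>ball a d. \<forall>y\<in>ball a d. norm (f x - trunc 1 x - (f y - trunc 1 y) - 0) \<le> e * norm (x - y)"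
    proof (intro exI[of _ "t * \<theta>"] conjI ballI)
      show "t * \<theta> > 0" using t \<theta> by simp
      have "t * \<theta> \<le> t * 1" using t \<theta> by (intro mult_left_mono) auto
      then have tt: "t * \<theta> < \<rho>" using t(2) by linarith
      fix x y assume xy: "x \<in> ball a (t * \<theta>)" "y \<in> ball a (t * \<theta>)"
      then have xyb: "x \<in> ball a \<rho>" "y \<in> ball a \<rho>" using tt by auto
      have n: "norm (x - a) \<le> t * \<theta>" "norm (y - a) \<le> t * \<theta>" using xy by (auto simp: dist_norm norm_minus_commute)
      have "((\<lambda>\<kappa>. - (monomial \<kappa> (y - a) * c \<kappa>)) has_sum - (f y - trunc 1 y)) {\<kappa>\<in>multi_indices. mono_deg \<kappa> > 1}"
        using tail[OF xyb(2), of 1] by (simp only: has_sum_uminus minus_minus)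
      from has_sum_add[OF tail[OF xyb(1)] this]
      have hs: "((\<lambda>\<kappa>. (monomial \<kappa> (x - a) - monomial \<kappa> (y - a)) * c \<kappa>) has_sum (f x - trunc 1 x - (f y - trunc 1 y))) {\<kappa>\<in>multi_indices. mono_deg \<kappa> > 1}"
        by (simp only: left_diff_distrib add_uminus_conv_diff)
      have "\<bar>f x - trunc 1 x - (f y - trunc 1 y)\<bar> \<le> (2 * \<theta> * norm (x - y) / t) * infsum maj multi_indices"
      proof (rule has_sum_abs_bound[OF hs])
        fix \<kappa> :: "'a \<Rightarrow> nat" assume k: "\<kappa> \<in> {\<kappa>\<in>multi_indices. mono_deg \<kappa> > 1}"
        \<comment> \<open>Of the \<open>k + 2\<close> factors \<theta>, one cancels against the
          denominator of \<open>monomial_lipschitz\<close>, \<open>k\<close> absorb the degree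
          \<open>k + 2\<close>, and one remains to make the estimate small.\<close>
        define k where "k = mono_deg \<kappa> - 2"
        have kk: "mono_deg \<kappa> = k + 2" using k unfolding k_def mem_Collect_eq by linarith
        have "real (k + 2) \<le> 2 * 4 ^ k" by (induction k) auto
        then have "real (k + 2) * \<theta> ^ k \<le> (2 * 4 ^ k) * \<theta> ^ k" using \<theta> by (intro mult_right_mono) auto
        also have "\<dots> = 2 * (4 * \<theta>) ^ k" by (simp add: power_mult_distrib)
        also have "\<dots> \<le> 2 * 1" using \<theta> by (intro mult_left_mono power_le_one) auto
        finally have k2: "real (k + 2) * \<theta> ^ k \<le> 2" by simp
        have "\<bar>monomial \<kappa> (x - a) - monomial \<kappa> (y - a)\<bar> \<le> (t * \<theta>) ^ (k + 2) * (real (k + 2) * norm (x - y) / (t * \<theta>))"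
          using monomial_lipschitz[of "t * \<theta>" "x - a" "y - a" \<kappa>] n t \<theta> kk by simp
        also have "\<dots> = (real (k + 2) * \<theta> ^ k) * (\<theta> * t ^ (k + 2) * norm (x - y) / t)"
          using t \<theta> by (simp add: power_mult_distrib field_simps)
        also have "\<dots> \<le> 2 * (\<theta> * t ^ (k + 2) * norm (x - y) / t)"
          using k2 t \<theta> by (intro mult_right_mono) auto
        finally have "\<bar>monomial \<kappa> (x - a) - monomial \<kappa> (y - a)\<bar> * \<bar>c \<kappa>\<bar> \<le> 2 * (\<theta> * t ^ (k + 2) * norm (x - y) / t) * \<bar>c \<kappa>\<bar>"
          by (intro mult_right_mono) auto
        then show "\<bar>(monomial \<kappa> (x - a) - monomial \<kappa> (y - a)) * c \<kappa>\<bar> \<le> 2 * \<theta> * norm (x - y) / t * maj \<kappa>"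
          using t(1) by (simp add: maj_def abs_mult kk mult_ac)
      qed (use maj_summable maj_nonneg t \<theta> in auto)
      also have "\<dots> = (2 * \<theta> * S) * norm (x - y) / t" by (simp add: S_def)
      also have "\<dots> \<le> (e * t) * norm (x - y) / t" using \<theta>e t by (intro divide_right_mono mult_right_mono) auto
      also have "\<dots> = e * norm (x - y)" using t by simp
      finally show "norm (f x - trunc 1 x - (f y - trunc 1 y) - 0) \<le> e * norm (x - y)" by simp
    qed
  qed auto
  from has_strict_derivative_add[OF rem tr] show ?thesis by auto
qed

end

lemma real_analytic_on_components:
  assumes "real_analytic_on S f" "a \<in> S"
  obtains \<rho> c where "\<And>b. scalar_power_series (\<lambda>x. inner (f x) b) a \<rho> (c b)"
proof -
  obtain \<rho> coef where r: "\<rho> > 0" "\<And>x. x \<in> ball a \<rho> \<Longrightarrow>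
        ((\<lambda>\<kappa>. (\<Prod>b\<in>Basis. (inner (x - a) b) ^ \<kappa> b) *\<^sub>R coef \<kappa>) has_sum f x) (Basis \<rightarrow>\<^sub>E UNIV)"
    using assms unfolding real_analytic_on_def by blast
  have "scalar_power_series (\<lambda>x. inner (f x) b) a \<rho> (\<lambda>\<kappa>. inner (coef \<kappa>) b)" for b
  proof
    fix x assume "x \<in> ball a \<rho>"
    from has_sum_bounded_linear[OF bounded_linear_inner_left r(2)[OF this], of b]
    show "((\<lambda>\<kappa>. monomial \<kappa> (x - a) * inner (coef \<kappa>) b) has_sum inner (f x) b) multi_indices"
      by (simp add: o_def monomial_def)
  qed (fact r)
  then show thesis by (rule that)
qed

lemma real_analytic_on_strict_derivative:
  fixes f :: "'a::euclidean_space \<Rightarrow> 'b::euclidean_space"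
  assumes "real_analytic_on S f" "a \<in> S"
  shows "has_strict_derivative f (frechet_derivative f (at a)) a"
proof -
  obtain \<rho> c where sp: "\<And>b. scalar_power_series (\<lambda>x. inner (f x) b) a \<rho> (c b)"
    using real_analytic_on_components[OF assms] by blast
  have "\<exists>f'. has_strict_derivative (\<lambda>x. inner (f x) b) f' a" for b
    using scalar_power_series.strict_derivative[OF sp] .
  then obtain f' where f': "\<And>b. has_strict_derivative (\<lambda>x. inner (f x) b) (f' b) a" by metis
  have "has_strict_derivative (\<lambda>x. \<Sum>b\<in>Basis. inner (f x) b *\<^sub>R b) (\<lambda>h. \<Sum>b\<in>Basis. f' b h *\<^sub>R b) a"
    by (intro has_strict_derivative_sum has_strict_derivative_compose[OF f' has_strict_derivative_linear] bounded_linear_scaleR_left)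
  then have d: "has_strict_derivative f (\<lambda>h. \<Sum>b\<in>Basis. f' b h *\<^sub>R b) a" by (simp add: euclidean_representation)
  then have "frechet_derivative f (at a) = (\<lambda>h. \<Sum>b\<in>Basis. f' b h *\<^sub>R b)"
    by (rule has_strict_derivative_frechet)
  then show ?thesis using d by simp
qed

text \<open>On a ball around \<open>a\<close>, the same \<eta> and \<open>C\<close> serve for every
  segment inside it. This uniformity is what allows base points to be sorted into countably many
  classes later. Adding the bounds of the components gives one constant for all
  \<open>b\<close>.\<close>

lemma real_analytic_on_fast_interpolation:
  fixes f :: "'a::euclidean_space \<Rightarrow> 'b::euclidean_space"
  assumes "real_analytic_on S f" "a \<in> S"
  obtains \<eta> C where "\<eta> > 0" "C \<ge> 0"
    "\<And>p w b. b \<in> Basis \<Longrightarrow> (\<And>s. \<bar>s\<bar> \<le> 1 \<Longrightarrow> p + s *\<^sub>R w \<in> ball a \<eta>) \<Longrightarrow> fast_interpolation C (\<lambda>s. inner (f (p + s *\<^sub>R w)) b)"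
proof -
  obtain \<rho> c where sp: "\<And>b. scalar_power_series (\<lambda>x. inner (f x) b) a \<rho> (c b)"
    using real_analytic_on_components[OF assms] by blast
  define C where "C b = 2 * infsum (scalar_power_series.maj \<rho> (c b)) multi_indices" for b
  have C: "C b \<ge> 0" for b unfolding C_def using scalar_power_series.maj_nonneg[OF sp, of b] by (intro mult_nonneg_nonneg infsum_nonneg) auto
  show thesis
  proof (rule that[of "scalar_power_series.t TYPE('a) \<rho> / 31104" "\<Sum>b\<in>Basis. C b"])
    show "scalar_power_series.t TYPE('a) \<rho> / 31104 > 0" using scalar_power_series.t(1)[OF sp] by simp
    show "(\<Sum>b\<in>Basis. C b) \<ge> 0" by (intro sum_nonneg C)
    fix p w and b :: 'b assume b: "b \<in> Basis" and pw: "\<And>s. \<bar>s\<bar> \<le> 1 \<Longrightarrow> p + s *\<^sub>R w \<in> ball a (scalar_power_series.t TYPE('a) \<rho> / 31104)"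
    have "fast_interpolation (C b) (\<lambda>s. inner (f (p + s *\<^sub>R w)) b)"
      unfolding C_def by (rule scalar_power_series.line_fast_interpolation[OF sp])
        (use pw in \<open>auto simp: dist_norm norm_minus_commute less_imp_le\<close>)
    moreover have "C b \<le> (\<Sum>b\<in>Basis. C b)" using b C by (intro member_le_sum) auto
    then have "C b * (1/72) ^ (2*N) \<le> (\<Sum>b\<in>Basis. C b) * (1/72) ^ (2*N)" for N by (intro mult_right_mono) auto
    ultimately show "fast_interpolation (\<Sum>b\<in>Basis. C b) (\<lambda>s. inner (f (p + s *\<^sub>R w)) b)"
      unfolding fast_interpolation_def by (blast intro: order_trans)
  qed
qed

section \<open>Riesz representatives depending on a point\<close>

text \<open>Variations of the Lipschitz factor \<open>q\<close> are multiplied by values of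
  \<open>p\<close> near \<open>a\<close>, which tend to zero. So \<open>q\<close> needs no
  derivative, and only \<open>p' h * q a\<close> survives.\<close>

lemma has_strict_derivative_vanishing_product:
  fixes p q :: "'a::real_normed_vector \<Rightarrow> real"
  assumes p: "has_strict_derivative p p' a" "p a = 0"
    and q: "d > 0" "\<And>x y. x \<in> ball a d \<Longrightarrow> y \<in> ball a d \<Longrightarrow> \<bar>q x - q y\<bar> \<le> M * norm (x - y)"
  shows "has_strict_derivative (\<lambda>x. p x * q x) (\<lambda>h. p' h * q a) a"
  unfolding has_strict_derivative_def
proof (intro conjI allI impI)
  have bl: "bounded_linear p'" using p(1) by (rule has_strict_derivative_bounded_linear)
  show "bounded_linear (\<lambda>h. p' h * q a)" using bl by (rule bounded_linear_mult_const)
  fix e :: real assume e: "e > 0"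
  define M1 where "M1 = \<bar>M\<bar> + 1"
  have M1: "M1 > 0" "\<And>x y. x \<in> ball a d \<Longrightarrow> y \<in> ball a d \<Longrightarrow> \<bar>q x - q y\<bar> \<le> M1 * norm (x - y)"
  proof -
    show "M1 > 0" by (simp add: M1_def)
    fix x y assume "x \<in> ball a d" "y \<in> ball a d"
    then have "\<bar>q x - q y\<bar> \<le> M * norm (x - y)" by (rule q)
    also have "\<dots> \<le> M1 * norm (x - y)" by (intro mult_right_mono) (auto simp: M1_def)
    finally show "\<bar>q x - q y\<bar> \<le> M1 * norm (x - y)" .
  qed
  obtain K where K: "K > 0" "\<And>h. \<bar>p' h\<bar> \<le> norm h * K" using bounded_linear.pos_bounded[OF bl] by auto
  obtain B d1 where B: "B > 0" "d1 > 0" "\<And>x y. x \<in> ball a d1 \<Longrightarrow> y \<in> ball a d1 \<Longrightarrow> norm (p x - p y) \<le> B * norm (x - y)"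
    using has_strict_derivative_lipschitz[OF p(1)] by metis
  define Q where "Q = \<bar>q a\<bar> + M1"
  have Q: "Q > 0" using M1 by (simp add: Q_def add_nonneg_pos)
  obtain d2 where d2: "d2 > 0" "\<And>x y. x \<in> ball a d2 \<Longrightarrow> y \<in> ball a d2 \<Longrightarrow> norm (p x - p y - p' (x - y)) \<le> e / (3 * Q) * norm (x - y)"
    using has_strict_derivativeD[OF p(1), of "e / (3 * Q)"] e Q by (metis divide_pos_pos mult_pos_pos zero_less_numeral)
  \<comment> \<open>The increment splits into three terms, each to be at most
    \<open>e / 3 * norm (x - y)\<close>: the strict error of \<open>p\<close> times
    \<open>q x\<close>, then \<open>p'\<close> times \<open>q x - q a\<close>, then
    \<open>p y\<close> times \<open>q x - q y\<close>. The last two bounds on \<open>D\<close>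
    handle the second and third; \<open>D \<le> 1\<close> bounds \<open>q x\<close> by
    \<open>Q\<close>.\<close>
  define D where "D = Min {1, d, d1, d2, e / (3 * K * M1), e / (3 * B * M1)}"
  have D: "D > 0" "D \<le> 1" "D \<le> d" "D \<le> d1" "D \<le> d2" "D \<le> e / (3 * K * M1)" "D \<le> e / (3 * B * M1)"
    using q(1) B d2 e K M1 by (auto simp: D_def)
  show "\<exists>d>0. \<forall>x\<in>ball a d. \<forall>y\<in>ball a d. norm (p x * q x - p y * q y - p' (x - y) * q a) \<le> e * norm (x - y)"
  proof (intro exI[of _ D] conjI ballI D(1))
    fix x y assume xy: "x \<in> ball a D" "y \<in> ball a D"
    have n: "norm (x - a) \<le> D" "norm (y - a) \<le> D" using xy by (auto simp: dist_norm norm_minus_commute)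
    have a: "a \<in> ball a d" "a \<in> ball a d1" using q(1) B by auto
    have qa: "\<bar>q x - q a\<bar> \<le> M1 * D" using M1(2)[of x a] a xy D n M1(1) by (smt (verit) mem_ball mult_left_mono)
    have qx: "\<bar>q x\<bar> \<le> Q"
    proof -
      have "M1 * D \<le> M1 * 1" using M1 D by (intro mult_left_mono) auto
      then show ?thesis using qa by (simp add: Q_def)
    qed
    have py: "\<bar>p y\<bar> \<le> B * D" using B(3)[of y a] a xy D n B(1) p(2) by (smt (verit) mem_ball mult_left_mono real_norm_def)
    have e1: "\<bar>(p x - p y - p' (x - y)) * q x\<bar> \<le> (e / (3 * Q) * norm (x - y)) * Q"
      unfolding abs_mult using d2(2)[of x y] xy D qx e Q by (intro mult_mono) auto
    have e2: "\<bar>p' (x - y) * (q x - q a)\<bar> \<le> (norm (x - y) * K) * (M1 * D)"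
      unfolding abs_mult using K qa by (intro mult_mono) auto
    have e3: "\<bar>p y * (q x - q y)\<bar> \<le> (B * D) * (M1 * norm (x - y))"
      unfolding abs_mult using py M1(2)[of x y] xy D B by (intro mult_mono) auto
    have "K * M1 * D \<le> e / 3" using D(6) K M1 by (simp add: pos_le_divide_eq mult_ac)
    then have "norm (x - y) * (K * M1 * D) \<le> norm (x - y) * (e / 3)" by (intro mult_left_mono) auto
    moreover have "B * M1 * D \<le> e / 3" using D(7) B M1 by (simp add: pos_le_divide_eq mult_ac)
    then have "norm (x - y) * (B * M1 * D) \<le> norm (x - y) * (e / 3)" by (intro mult_left_mono) auto
    moreover have "(e / (3 * Q) * norm (x - y)) * Q = norm (x - y) * (e / 3)" using Q by simp
    moreover have "(norm (x - y) * K) * (M1 * D) = norm (x - y) * (K * M1 * D)" "(B * D) * (M1 * norm (x - y)) = norm (x - y) * (B * M1 * D)" by simp_all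
    moreover have "p x * q x - p y * q y - p' (x - y) * q a =
        (p x - p y - p' (x - y)) * q x + p' (x - y) * (q x - q a) + p y * (q x - q y)" by (simp add: algebra_simps)
    ultimately have "\<bar>p x * q x - p y * q y - p' (x - y) * q a\<bar> \<le> 3 * (norm (x - y) * (e / 3))"
      using e1 e2 e3 by linarith
    then show "norm (p x * q x - p y * q y - p' (x - y) * q a) \<le> e * norm (x - y)" by (simp add: mult.commute)
  qed
qed

lemma has_strict_derivative_eventually_lipschitz_family:
  fixes F :: "'i \<Rightarrow> 'a::real_normed_vector \<Rightarrow> real"
  assumes "finite I" "\<And>i. i \<in> I \<Longrightarrow> has_strict_derivative (F i) (F' i) a"
  obtains L d where "L > 0" "d > 0" "\<And>i x y. i \<in> I \<Longrightarrow> x \<in> ball a d \<Longrightarrow> y \<in> ball a d \<Longrightarrow> \<bar>F i x - F i y\<bar> \<le> L * norm (x - y)"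
proof -
  have "\<exists>B d. B > 0 \<and> d > 0 \<and> (\<forall>x\<in>ball a d. \<forall>y\<in>ball a d. \<bar>F i x - F i y\<bar> \<le> B * norm (x - y))" if "i \<in> I" for i
    using has_strict_derivative_lipschitz[OF assms(2)[OF that]] by (metis real_norm_def)
  then obtain B d where Bd: "\<And>i. i \<in> I \<Longrightarrow> B i > 0" "\<And>i. i \<in> I \<Longrightarrow> d i > 0"
    "\<And>i x y. i \<in> I \<Longrightarrow> x \<in> ball a (d i) \<Longrightarrow> y \<in> ball a (d i) \<Longrightarrow> \<bar>F i x - F i y\<bar> \<le> B i * norm (x - y)"
    by metis
  define L where "L = Max (insert 1 (B ` I))"
  define D where "D = Min (insert 1 (d ` I))"
  have L: "L \<ge> 1" "\<And>i. i \<in> I \<Longrightarrow> B i \<le> L" using assms(1) by (auto simp: L_def)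
  have D: "D > 0" "\<And>i. i \<in> I \<Longrightarrow> D \<le> d i" using assms(1) Bd(2) by (auto simp: D_def simp del: Min_insert intro!: Min_le)
  show thesis
  proof (rule that[of L D])
    fix i x y assume i: "i \<in> I" "x \<in> ball a D" "y \<in> ball a D"
    then have "\<bar>F i x - F i y\<bar> \<le> B i * norm (x - y)" using D(2)[OF i(1)] by (intro Bd) auto
    also have "\<dots> \<le> L * norm (x - y)" using L(2)[OF i(1)] by (intro mult_right_mono) auto
    finally show "\<bar>F i x - F i y\<bar> \<le> L * norm (x - y)" .
  qed (use L D in auto)
qed

context inner_form
begin

text \<open>Positive definiteness makes \<open>u \<mapsto> B u\<close> injective, hence onto by
  dimension. \<open>P\<close> encodes the functional \<open>B u\<close> by its values on the
  basis.\<close>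

lemma riesz:
  assumes "linear l"
  obtains u where "\<And>v. B u v = l v"
proof -
  define P where "P u = (\<Sum>b\<in>Basis. B u b *\<^sub>R b)" for u
  have Pb: "inner (P u) b = B u b" if "b \<in> Basis" for u b using that by (simp add: P_def)
  have lin: "linear P" unfolding P_def[abs_def]
    by (intro linearI) (simp_all add: add_left scale_left scaleR_left_distrib sum.distrib scaleR_sum_right)
  have ext: "B u v = l' v" if "linear l'" "\<And>b. b \<in> Basis \<Longrightarrow> B u b = l' b" for u v l'
  proof -
    have lB: "linear (B u)" using bil by (simp add: bilinear_def)
    show ?thesis using linear_eq_stdbasis[OF lB that(1)] that(2) by metis
  qed
  have "inj P" unfolding linear_injective_0[OF lin]
  proof (intro allI impI)
    fix u assume "P u = 0"
    then have "B u b = 0" if "b \<in> Basis" for b using Pb[OF that, of u] by simp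
    then have "B u u = 0" using ext[of "\<lambda>_. 0" u u] by (simp add: linear_zero)
    then show "u = 0" using pos[of u] by force
  qed
  then have "surj P" using lin linear_injective_imp_surjective by blast
  then obtain u where u: "P u = (\<Sum>b\<in>Basis. l b *\<^sub>R b)" by (metis surjD)
  have "B u b = l b" if "b \<in> Basis" for b
  proof -
    have "B u b = inner (\<Sum>b\<in>Basis. l b *\<^sub>R b) b" using Pb[OF that, of u] u by simp
    then show ?thesis using that by simp
  qed
  then show thesis using that ext[OF assms] by blast
qed

lemma nondegenerate: "(\<And>v. B u v = B w v) \<Longrightarrow> u = w"
  using pos[of "u - w"] by (force simp: diff_left)

end

text \<open>Strict derivatives are given for fixed arguments only. Applying the basis estimate once
  per argument makes the Lipschitz bound uniform in both, at the cost of a factor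
  \<open>DIM('a)\<close> each time.\<close>

lemma bilinear_field_lipschitz:
  fixes B :: "'a::euclidean_space \<Rightarrow> 'a \<Rightarrow> 'a \<Rightarrow> real"
  assumes S: "open S" "y0 \<in> S" and B: "\<And>y. y \<in> S \<Longrightarrow> bilinear (B y)"
    and B': "\<And>a b. has_strict_derivative (\<lambda>y. B y a b) (B' a b) y0"
  obtains L d where "L > 0" "d > 0" "ball y0 d \<subseteq> S"
    "\<And>x y u v. x \<in> ball y0 d \<Longrightarrow> y \<in> ball y0 d \<Longrightarrow> \<bar>B x u v - B y u v\<bar> \<le> L * norm (x - y) * norm u * norm v"
proof -
  obtain d0 where d0: "d0 > 0" "ball y0 d0 \<subseteq> S" using S openE by blast
  let ?n = "real DIM('a)"
  obtain LB dB where LB: "LB > 0" "dB > 0"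
    "\<And>i x y. i \<in> Basis \<times> Basis \<Longrightarrow> x \<in> ball y0 dB \<Longrightarrow> y \<in> ball y0 dB \<Longrightarrow> \<bar>B x (fst i) (snd i) - B y (fst i) (snd i)\<bar> \<le> LB * norm (x - y)"
    using has_strict_derivative_eventually_lipschitz_family[of "Basis \<times> Basis" "\<lambda>i y. B y (fst i) (snd i)" "\<lambda>i. B' (fst i) (snd i)" y0] B'
    by (metis finite_Basis finite_cartesian_product)
  show thesis
  proof (rule that[of "?n * ?n * LB" "min d0 dB"])
    fix x y u v assume x: "x \<in> ball y0 (min d0 dB)" and y: "y \<in> ball y0 (min d0 dB)"
    have S': "x \<in> S" "y \<in> S" using x y d0 by auto
    have lin: "linear (\<lambda>u. B x u v - B y u v)" "linear (\<lambda>v. B x u v - B y u v)" for u v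
      using B[OF S'(1)] B[OF S'(2)] by (auto simp: bilinear_def intro!: linear_compose_sub)
    have 1: "norm (B x b v - B y b v) \<le> ?n * (LB * norm (x - y)) * norm v" if "b \<in> Basis" for b v
      by (rule bounded_linear_small_on_Basis[OF lin(2)]) (use LB(3)[of "(b, _)" x y] that x y in auto)
    have "norm (B x u v - B y u v) \<le> ?n * (?n * (LB * norm (x - y)) * norm v) * norm u"
      by (rule bounded_linear_small_on_Basis[OF lin(1) 1])
    then show "\<bar>B x u v - B y u v\<bar> \<le> ?n * ?n * LB * norm (x - y) * norm u * norm v" by (simp add: mult_ac)
  qed (use d0 LB in auto)
qed

text \<open>Coercivity with constant \<open>c\<close> at \<open>y0\<close> survives a perturbation
  of size \<open>c/2\<close>, which the Lipschitz bound grants nearby.\<close>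

lemma inner_form_field_bounds:
  fixes B :: "'a::euclidean_space \<Rightarrow> 'a \<Rightarrow> 'a \<Rightarrow> real"
  assumes S: "open S" "y0 \<in> S" and B: "\<And>y. y \<in> S \<Longrightarrow> inner_form (B y)"
    and B': "\<And>a b. has_strict_derivative (\<lambda>y. B y a b) (B' a b) y0"
  obtains k K d where "k > 0" "K > 0" "d > 0" "ball y0 d \<subseteq> S"
    "\<And>y u. y \<in> ball y0 d \<Longrightarrow> B y u u \<ge> k * (norm u)\<^sup>2"
    "\<And>y u v. y \<in> ball y0 d \<Longrightarrow> \<bar>B y u v\<bar> \<le> K * norm u * norm v"
proof -
  interpret B0: inner_form "B y0" using B S(2) .
  have bil: "bilinear (B y)" if "y \<in> S" for y using B[OF that] by (simp add: inner_form_def)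
  obtain L d1 where L: "L > 0" "d1 > 0" "ball y0 d1 \<subseteq> S"
    "\<And>x y u v. x \<in> ball y0 d1 \<Longrightarrow> y \<in> ball y0 d1 \<Longrightarrow> \<bar>B x u v - B y u v\<bar> \<le> L * norm (x - y) * norm u * norm v"
    by (rule bilinear_field_lipschitz[OF S bil B']) blast+
  obtain c where c: "c > 0" "\<And>u. B y0 u u \<ge> c * (norm u)\<^sup>2" using B0.coercive by blast
  obtain K0 where K0: "K0 > 0" "\<And>u v. \<bar>B y0 u v\<bar> \<le> K0 * norm u * norm v"
    using bilinear_bounded_pos[OF B0.bil] by auto
  define d where "d = min d1 (c / (2 * L))"
  have d: "d > 0" "d \<le> d1" "d \<le> c / (2 * L)" using c L by (auto simp: d_def)
  have y0: "y0 \<in> ball y0 d1" using L by simp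
  have close: "\<bar>B y u v - B y0 u v\<bar> \<le> c/2 * norm u * norm v" if y: "y \<in> ball y0 d" for y u v
  proof -
    have y1: "y \<in> ball y0 d1" using y d by auto
    have "L * norm (y - y0) \<le> L * (c / (2 * L))" using y d L by (intro mult_left_mono) (auto simp: dist_norm norm_minus_commute)
    also have "\<dots> = c / 2" using L by simp
    finally have "L * norm (y - y0) * norm u * norm v \<le> c/2 * norm u * norm v" by (intro mult_right_mono) auto
    then show ?thesis using L(4)[OF y1 y0, of u v] by linarith
  qed
  show thesis
  proof (rule that[of "c/2" "K0 + c/2" d])
    fix y u v assume y: "y \<in> ball y0 d"
    show "B y u u \<ge> c/2 * (norm u)\<^sup>2"
    proof -
      have "\<bar>B y u u - B y0 u u\<bar> \<le> c/2 * (norm u)\<^sup>2" using close[OF y, of u u] by (simp add: power2_eq_square mult.assoc)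
      moreover have "c * (norm u)\<^sup>2 = c/2 * (norm u)\<^sup>2 + c/2 * (norm u)\<^sup>2" by simp
      ultimately show ?thesis using c(2)[of u] by linarith
    qed
    show "\<bar>B y u v\<bar> \<le> (K0 + c/2) * norm u * norm v"
    proof -
      have "(K0 + c/2) * norm u * norm v = K0 * norm u * norm v + c/2 * norm u * norm v" by (simp only: distrib_right)
      then show ?thesis using close[OF y, of u v] K0(2)[of u v] by linarith
    qed
  qed (use c K0 d L in auto)
qed

text \<open>Writing \<open>B y0 (G y) b = l y b - (B y - B y0) (G y) b\<close> expresses \<open>G\<close> through strictly
  differentiable functions and a product of a function vanishing at \<open>y0\<close> with the components of
  \<open>G\<close>, for which local Lipschitz continuity is enough.\<close>

lemma riesz_field_strict_derivative:
  fixes B :: "'a::euclidean_space \<Rightarrow> 'a \<Rightarrow> 'a \<Rightarrow> real"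
  assumes S: "open S" "y0 \<in> S" and B: "\<And>y. y \<in> S \<Longrightarrow> inner_form (B y)"
    and B': "\<And>a b. has_strict_derivative (\<lambda>y. B y a b) (B' a b) y0"
    and l: "\<And>y. y \<in> S \<Longrightarrow> linear (l y)" "\<And>b. has_strict_derivative (\<lambda>y. l y b) (l' b) y0"
    and G: "\<And>y b. y \<in> S \<Longrightarrow> B y (G y) b = l y b"
  obtains G' where "has_strict_derivative G G' y0" "\<And>u b. B y0 (G' u) b = l' b u - B' (G y0) b u"
proof -
  interpret B0: inner_form "B y0" using B S(2) .
  have bilB: "bilinear (B y)" if "y \<in> S" for y using B[OF that] by (simp add: inner_form_def)
  obtain L dB where L: "L > 0" "dB > 0" "ball y0 dB \<subseteq> S"
    "\<And>x y u v. x \<in> ball y0 dB \<Longrightarrow> y \<in> ball y0 dB \<Longrightarrow> \<bar>B x u v - B y u v\<bar> \<le> L * norm (x - y) * norm u * norm v"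
    by (rule bilinear_field_lipschitz[OF S bilB B']) blast+
  obtain k K1 dk where k: "k > 0" "K1 > 0" "dk > 0" "ball y0 dk \<subseteq> S"
    "\<And>y u. y \<in> ball y0 dk \<Longrightarrow> B y u u \<ge> k * (norm u)\<^sup>2"
    "\<And>y u v. y \<in> ball y0 dk \<Longrightarrow> \<bar>B y u v\<bar> \<le> K1 * norm u * norm v"
    by (rule inner_form_field_bounds[OF S B B']) blast+
  obtain Ll dl where Ll: "Ll > 0" "dl > 0"
    "\<And>i x y. i \<in> Basis \<Longrightarrow> x \<in> ball y0 dl \<Longrightarrow> y \<in> ball y0 dl \<Longrightarrow> \<bar>l x i - l y i\<bar> \<le> Ll * norm (x - y)"
    using has_strict_derivative_eventually_lipschitz_family[of Basis "\<lambda>i y. l y i" l' y0] l(2) by (metis finite_Basis)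
  define L2 where "L2 = real DIM('a) * Ll"
  have L2: "L2 > 0" using Ll by (simp add: L2_def)
  define d where "d = min dB (min dl dk)"
  have d: "d > 0" "d \<le> dB" "d \<le> dk" using L Ll k by (auto simp: d_def)
  have inS: "y \<in> S" if "y \<in> ball y0 d" for y using that L(3) d by auto
  have y0: "y0 \<in> ball y0 d" using d by simp
  have llip: "\<bar>l x v - l y v\<bar> \<le> L2 * norm (x - y) * norm v" if x: "x \<in> ball y0 d" and y: "y \<in> ball y0 d" for x y v
  proof -
    have "norm (l x v - l y v) \<le> real DIM('a) * (Ll * norm (x - y)) * norm v"
      by (rule bounded_linear_small_on_Basis[OF linear_compose_sub[OF l(1)[OF inS[OF x]] l(1)[OF inS[OF y]]]])
        (use Ll(3)[of _ x y] x y in \<open>auto simp: d_def\<close>)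
    then show ?thesis by (simp add: L2_def mult_ac)
  qed
  have coer: "B y u u \<ge> k * (norm u)\<^sup>2" if "y \<in> ball y0 d" for y u using that d by (intro k(5)) auto
  have Blip: "\<bar>B x u v - B y u v\<bar> \<le> L * norm (x - y) * norm u * norm v" if "x \<in> ball y0 d" "y \<in> ball y0 d" for x y u v
    using that d by (intro L(4)) auto
  obtain K0 where K0: "K0 > 0" "\<And>v. \<bar>l y0 v\<bar> \<le> norm v * K0"
    using bounded_linear.pos_bounded[OF linear_conv_bounded_linear[THEN iffD1, OF l(1)[OF S(2)]]] by auto
  define K where "K = K0 + L2 * d"
  have K: "K > 0" using K0 L2 d by (simp add: K_def add_pos_pos)
  have lK: "\<bar>l y v\<bar> \<le> K * norm v" if y: "y \<in> ball y0 d" for y v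
  proof -
    have "L2 * norm (y - y0) * norm v \<le> L2 * d * norm v"
      using y L2 by (intro mult_right_mono mult_left_mono) (auto simp: dist_norm norm_minus_commute)
    then have "\<bar>l y v\<bar> \<le> norm v * K0 + L2 * d * norm v" using llip[OF y y0, of v] K0(2)[of v] by linarith
    then show ?thesis by (simp add: K_def algebra_simps)
  qed
  have cancel: "norm u \<le> M / k" if "k * (norm u)\<^sup>2 \<le> M * norm u" "M \<ge> 0" for u :: 'a and M
  proof (cases "u = 0")
    case False
    then have "k * norm u \<le> M" using that by (simp add: power2_eq_square)
    then show ?thesis using k(1) by (simp add: field_simps)
  qed (use that k in auto)
  have Gb: "norm (G y) \<le> K / k" if y: "y \<in> ball y0 d" for y
  proof -
    have "k * (norm (G y))\<^sup>2 \<le> l y (G y)" using coer[OF y, of "G y"] G[OF inS[OF y], of "G y"] by simp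
    also have "\<dots> \<le> K * norm (G y)" using lK[OF y, of "G y"] by linarith
    finally show ?thesis using K by (intro cancel) auto
  qed
  define M where "M = (L2 + L * (K / k)) / k"
  \<comment> \<open>With \<open>w = G x - G y\<close>, the value \<open>B x w w\<close> equals a
    difference of \<open>l\<close> minus a difference of \<open>B\<close>, both Lipschitz in the
    point. Coercivity turns this into a bound for \<open>w\<close>.\<close>
  have Glip: "norm (G x - G y) \<le> M * norm (x - y)" if x: "x \<in> ball y0 d" and y: "y \<in> ball y0 d" for x y
  proof -
    define w where "w = G x - G y"
    have "B x w w = l x w - l y w - (B x (G y) w - B y (G y) w)"
      using G[OF inS[OF x], of w] G[OF inS[OF y], of w] bilinear_lsub[OF bilB[OF inS[OF x]], of "G x" "G y" w] by (simp add: w_def)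
    then have "k * (norm w)\<^sup>2 \<le> L2 * norm (x - y) * norm w + L * norm (x - y) * norm (G y) * norm w"
      using coer[OF x, of w] llip[OF x y, of w] Blip[OF x y, of "G y" w] by linarith
    also have "\<dots> \<le> L2 * norm (x - y) * norm w + L * norm (x - y) * (K / k) * norm w"
      using L Gb[OF y] by (intro add_left_mono mult_right_mono mult_left_mono) auto
    also have "\<dots> = ((L2 + L * (K / k)) * norm (x - y)) * norm w" by (simp add: algebra_simps)
    finally have "norm w \<le> ((L2 + L * (K / k)) * norm (x - y)) / k"
      using L L2 K k by (intro cancel) auto
    then show ?thesis unfolding M_def w_def[symmetric] by (simp only: times_divide_eq_left)
  qed
  \<comment> \<open>Coordinates of the right side of the identity stated above. \<open>G y\<close>
    is recovered from \<open>H y\<close> by the fixed inverse \<open>P\<close> of the Gram map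
    \<open>P0\<close> of \<open>B y0\<close>.\<close>
  define H where "H y = (\<Sum>b\<in>Basis. (l y b - (\<Sum>b'\<in>Basis. (B y b' b - B y0 b' b) * inner (G y) b')) *\<^sub>R b)" for y
  define H' where "H' h = (\<Sum>b\<in>Basis. (l' b h - (\<Sum>b'\<in>Basis. B' b' b h * inner (G y0) b')) *\<^sub>R b)" for h
  have H: "has_strict_derivative H H' y0"
  proof -
    have 1: "has_strict_derivative (\<lambda>y. (B y b' b - B y0 b' b) * inner (G y) b') (\<lambda>h. B' b' b h * inner (G y0) b') y0" if "b' \<in> Basis" for b b'
    proof (rule has_strict_derivative_vanishing_product[where d = d and M = M])
      show "has_strict_derivative (\<lambda>y. B y b' b - B y0 b' b) (B' b' b) y0"
        using has_strict_derivative_add[OF B'[of b' b] has_strict_derivative_const[of "- B y0 b' b"]] by simp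
      show "\<bar>inner (G x) b' - inner (G y) b'\<bar> \<le> M * norm (x - y)" if "x \<in> ball y0 d" "y \<in> ball y0 d" for x y
        using Basis_le_norm[OF \<open>b' \<in> Basis\<close>, of "G x - G y"] Glip[OF that] by (simp add: inner_diff_left)
    qed (use d in auto)
    have neg: "has_strict_derivative (\<lambda>y. - F y) (\<lambda>h. - F' h) y0" if "has_strict_derivative F F' y0" for F F' :: "'a \<Rightarrow> real"
      by (rule has_strict_derivative_compose[OF that has_strict_derivative_linear]) (intro bounded_linear_minus bounded_linear_ident)
    have "has_strict_derivative (\<lambda>y. l y b + - (\<Sum>b'\<in>Basis. (B y b' b - B y0 b' b) * inner (G y) b')) (\<lambda>h. l' b h + - (\<Sum>b'\<in>Basis. B' b' b h * inner (G y0) b')) y0" for b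
      by (intro has_strict_derivative_add l(2) neg has_strict_derivative_sum 1)
    then show ?thesis unfolding H_def[abs_def] H'_def[abs_def]
      by (intro has_strict_derivative_sum has_strict_derivative_compose[OF _ has_strict_derivative_linear[OF bounded_linear_scaleR_left]]) simp
  qed
  define P0 where "P0 u = (\<Sum>b\<in>Basis. B y0 u b *\<^sub>R b)" for u
  have linP0: "linear P0" unfolding P0_def[abs_def]
    by (intro linearI) (simp_all add: B0.add_left B0.scale_left scaleR_left_distrib sum.distrib scaleR_sum_right)
  have P0b: "inner (P0 u) b = B y0 u b" if "b \<in> Basis" for u b using that by (simp add: P0_def)
  have ext: "B y0 u v = l0 v" if "linear l0" "\<And>b. b \<in> Basis \<Longrightarrow> B y0 u b = l0 b" for u v l0
  proof -
    have lB: "linear (B y0 u)" using B0.bil by (simp add: bilinear_def)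
    show ?thesis using linear_eq_stdbasis[OF lB that(1)] that(2) by metis
  qed
  have "inj P0" unfolding linear_injective_0[OF linP0]
  proof (intro allI impI)
    fix u assume "P0 u = 0"
    then have "B y0 u b = 0" if "b \<in> Basis" for b using P0b[OF that, of u] by simp
    then have "B y0 u u = 0" using ext[of "\<lambda>_. 0" u u] by (simp add: linear_zero)
    then show "u = 0" using B0.pos[of u] by force
  qed
  then obtain P where P: "linear P" "\<And>x. P (P0 x) = x"
    using linear_injective_left_inverse[OF linP0] by (metis comp_apply id_apply)
  have PH: "G y = P (H y)" if y: "y \<in> ball y0 d" for y
  proof -
    have yS: "y \<in> S" by (rule inS[OF y])
    have "P0 (G y) = H y"
    proof (rule euclidean_eqI)
      fix b :: 'a assume b: "b \<in> Basis"
      have e: "B z (G y) b = (\<Sum>b'\<in>Basis. inner (G y) b' * B z b' b)" if "z \<in> S" for z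
      proof -
        have "linear (\<lambda>u. B z u b)" using bilB[OF that] by (simp add: bilinear_def)
        from linear_sum[OF this, of "\<lambda>b'. inner (G y) b' *\<^sub>R b'" Basis] linear_cmul[OF this]
        show ?thesis by (simp add: euclidean_representation)
      qed
      have "(\<Sum>b'\<in>Basis. (B y b' b - B y0 b' b) * inner (G y) b') = B y (G y) b - B y0 (G y) b"
        by (simp add: e[OF yS] e[OF S(2)] algebra_simps sum_subtractf)
      then have "inner (H y) b = l y b - (B y (G y) b - B y0 (G y) b)" using b by (simp add: H_def)
      then show "inner (P0 (G y)) b = inner (H y) b" using G[OF yS, of b] P0b[OF b] by simp
    qed
    then show ?thesis using P(2)[of "G y"] by simp
  qed
  have "has_strict_derivative (\<lambda>y. P (H y)) (\<lambda>h. P (H' h)) y0"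
    by (rule has_strict_derivative_compose[OF H has_strict_derivative_linear]) (use P(1) in \<open>simp add: linear_conv_bounded_linear\<close>)
  then have G': "has_strict_derivative G (\<lambda>h. P (H' h)) y0"
    by (rule has_strict_derivative_transform[of _ _ _ "ball y0 d"]) (use d PH in auto)
  have "surj P0" using linP0 \<open>inj P0\<close> linear_injective_imp_surjective by blast
  then have P0P: "P0 (P z) = z" for z using P(2) by (metis surjD)
  \<comment> \<open>Derivative of \<open>z \<mapsto> B z (G y0) b\<close> with the vector
    \<open>G y0\<close> frozen, expanded in the coordinates of that vector.\<close>
  have linB': "B' (G y0) b h = (\<Sum>b'\<in>Basis. B' b' b h * inner (G y0) b')" for b h
  proof -
    have e: "B z (G y0) b = (\<Sum>b'\<in>Basis. B z b' b * inner (G y0) b')" if "z \<in> S" for z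
    proof -
      have "linear (\<lambda>u. B z u b)" using bilB[OF that] by (simp add: bilinear_def)
      from linear_sum[OF this, of "\<lambda>b'. inner (G y0) b' *\<^sub>R b'" Basis] linear_cmul[OF this]
      show ?thesis by (simp add: euclidean_representation mult.commute)
    qed
    have "has_strict_derivative (\<lambda>z. \<Sum>b'\<in>Basis. B z b' b * inner (G y0) b') (\<lambda>h. \<Sum>b'\<in>Basis. B' b' b h * inner (G y0) b') y0"
      by (intro has_strict_derivative_sum has_strict_derivative_compose[OF B' has_strict_derivative_linear[OF bounded_linear_mult_left]])
    then have "has_strict_derivative (\<lambda>z. B z (G y0) b) (\<lambda>h. \<Sum>b'\<in>Basis. B' b' b h * inner (G y0) b') y0"
      by (rule has_strict_derivative_transform[OF _ S]) (rule e)
    then show ?thesis using has_strict_derivative_unique[OF B'[of "G y0" b]] by (auto dest: fun_cong)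
  qed
  have "B y0 (P (H' u)) b = l' b u - B' (G y0) b u" for u b
  proof -
    have "B y0 (P (H' u)) b = l' b u - B' (G y0) b u" if "b \<in> Basis" for b
      using P0b[OF that, of "P (H' u)"] that by (simp add: P0P H'_def linB')
    \<comment> \<open>Linearity of \<open>l'\<close> and \<open>B'\<close> in \<open>b\<close> is
      inherited from \<open>l y\<close> and \<open>B y\<close> by uniqueness of strict derivatives;
      it extends the formula from basis vectors to all \<open>b\<close>.\<close>
    moreover have "linear (\<lambda>b. l' b u - B' (G y0) b u)"
    proof -
      have 1: "l' (r *\<^sub>R b + b') u = r * l' b u + l' b' u" for r b b'
      proof -
        have "has_strict_derivative (\<lambda>y. r * l y b + l y b') (\<lambda>h. r * l' b h + l' b' h) y0"
          by (intro has_strict_derivative_add l(2) has_strict_derivative_compose[OF l(2) has_strict_derivative_linear[OF bounded_linear_mult_right]])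
        then have "has_strict_derivative (\<lambda>y. l y (r *\<^sub>R b + b')) (\<lambda>h. r * l' b h + l' b' h) y0"
          by (rule has_strict_derivative_transform[OF _ S]) (use l(1) in \<open>simp add: linear_add linear_cmul\<close>)
        then show ?thesis using has_strict_derivative_unique[OF l(2)[of "r *\<^sub>R b + b'"]] by (auto dest: fun_cong)
      qed
      have 2: "B' a (r *\<^sub>R b + b') u = r * B' a b u + B' a b' u" for r a b b'
      proof -
        have "has_strict_derivative (\<lambda>y. r * B y a b + B y a b') (\<lambda>h. r * B' a b h + B' a b' h) y0"
          by (intro has_strict_derivative_add B' has_strict_derivative_compose[OF B' has_strict_derivative_linear[OF bounded_linear_mult_right]])
        then have "has_strict_derivative (\<lambda>y. B y a (r *\<^sub>R b + b')) (\<lambda>h. r * B' a b h + B' a b' h) y0"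
          by (rule has_strict_derivative_transform[OF _ S]) (use bilB in \<open>simp add: bilinear_radd bilinear_rmul\<close>)
        then show ?thesis using has_strict_derivative_unique[OF B'[of a "r *\<^sub>R b + b'"]] by (auto dest: fun_cong)
      qed
      show ?thesis
      proof (rule linearI)
        fix b b' :: 'a and r :: real
        show "l' (b + b') u - B' (G y0) (b + b') u = (l' b u - B' (G y0) b u) + (l' b' u - B' (G y0) b' u)"
          using 1[of 1 b b'] 2[of "G y0" 1 b b'] by simp
        have "l' 0 u = 0" "B' (G y0) 0 u = 0" using 1[of 1 0 0] 2[of "G y0" 1 0 0] by auto
        then show "l' (r *\<^sub>R b) u - B' (G y0) (r *\<^sub>R b) u = r *\<^sub>R (l' b u - B' (G y0) b u)"
          using 1[of r b 0] 2[of "G y0" r b 0] by (simp add: right_diff_distrib)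
      qed
    qed
    ultimately show ?thesis using ext by blast
  qed
  with G' show thesis by (rule that)
qed

section \<open>Charts, tangent vectors and null sets\<close>

lemma
  assumes "is_chart c"
  shows is_chart_open_dom: "open (cdom c)" and is_chart_open_img: "open (cimg c)"
    and is_chart_cont_map: "continuous_on (cdom c) (cmap c)"
    and is_chart_cont_inv: "continuous_on (cimg c) (cinv c)"
    and is_chart_cinv_cmap: "x \<in> cdom c \<Longrightarrow> cinv c (cmap c x) = x"
    and is_chart_cmap_cinv: "y \<in> cimg c \<Longrightarrow> cmap c (cinv c y) = y"
    and is_chart_cinv_dom: "y \<in> cimg c \<Longrightarrow> cinv c y \<in> cdom c"
  using assms unfolding is_chart_def homeomorphism_def by (auto simp: inv_into_into f_inv_into_f)

lemma is_chart_image_eq: "is_chart c \<Longrightarrow> cmap c ` (cdom c \<inter> U) = cimg c \<inter> cinv c -` U"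
  by (auto simp: is_chart_cinv_cmap)

lemma is_chart_open_image: "is_chart c \<Longrightarrow> open U \<Longrightarrow> open (cmap c ` (cdom c \<inter> U))"
  unfolding is_chart_image_eq
  by (intro continuous_open_preimage is_chart_cont_inv is_chart_open_img)

lemma is_chart_open_cinv_image:
  assumes c: "is_chart c" and W: "open W" "W \<subseteq> cimg c"
  shows "open (cinv c ` W)"
proof -
  have "cinv c ` W = cdom c \<inter> cmap c -` W"
    using W(2) c by (auto simp: is_chart_cinv_dom is_chart_cmap_cinv subset_iff) (metis image_iff is_chart_cinv_cmap)
  then show ?thesis using continuous_open_preimage[OF is_chart_cont_map[OF c] is_chart_open_dom[OF c] W(1)] by simp
qed

lemma negligible_chart_change:
  fixes c d :: "('m::topological_space, 'a::euclidean_space) chart"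
  assumes c: "is_chart c" and d: "is_chart d" and S: "S \<subseteq> cdom c \<inter> cdom d" "negligible (cmap c ` S)"
    and diff: "(cmap d \<circ> cinv c) differentiable_on (cmap c ` (cdom c \<inter> cdom d))"
  shows "negligible (cmap d ` S)"
proof -
  have "negligible ((cmap d \<circ> cinv c) ` (cmap c ` S))"
    using S by (intro negligible_differentiable_image_negligible differentiable_on_subset[OF diff]) auto
  moreover have "(cmap d \<circ> cinv c) ` (cmap c ` S) = cmap d ` S"
    unfolding image_comp using S(1) c by (intro image_cong) (auto simp: is_chart_cinv_cmap)
  ultimately show ?thesis by simp
qed

locale analytic_manifold =
  fixes A :: "('m::{t2_space, second_countable_topology}, 'a::euclidean_space) chart set"
  assumes atlas: "real_analytic_atlas A"
begin

lemma chart: "c \<in> A \<Longrightarrow> is_chart c" and cover: "\<exists>c\<in>A. x \<in> cdom c"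
  and compat: "c \<in> A \<Longrightarrow> d \<in> A \<Longrightarrow> compatible real_analytic_on c d"
  using atlas unfolding is_atlas_def by blast+

lemmas open_dom = is_chart_open_dom[OF chart] and open_img = is_chart_open_img[OF chart]
  and cont_map = is_chart_cont_map[OF chart] and cont_inv = is_chart_cont_inv[OF chart]
  and cinv_cmap = is_chart_cinv_cmap[OF chart] and cmap_cinv = is_chart_cmap_cinv[OF chart]
  and cinv_dom = is_chart_cinv_dom[OF chart] and open_image = is_chart_open_image[OF chart]

lemma transition_strict:
  assumes "c \<in> A" "d \<in> A" "x \<in> cdom c" "x \<in> cdom d"
  shows "has_strict_derivative (cmap d \<circ> cinv c) (transition_deriv c d x) (cmap c x)"
  unfolding transition_deriv_def
  by (rule real_analytic_on_strict_derivative[of "cmap c ` (cdom c \<inter> cdom d)"])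
     (use assms compat[of c d] in \<open>auto simp: compatible_def\<close>)

lemma transition_diff_on:
  assumes "c \<in> A" "d \<in> A"
  shows "(cmap d \<circ> cinv c) differentiable_on (cmap c ` (cdom c \<inter> cdom d))"
  unfolding differentiable_on_def
proof
  fix y assume "y \<in> cmap c ` (cdom c \<inter> cdom d)"
  then obtain x where x: "x \<in> cdom c" "x \<in> cdom d" "y = cmap c x" by blast
  have "(cmap d \<circ> cinv c) differentiable at y"
    using has_strict_derivative_imp_has_derivative[OF transition_strict[OF assms x(1,2)]] x(3) by (auto simp: differentiable_def)
  then show "(cmap d \<circ> cinv c) differentiable at y within cmap c ` (cdom c \<inter> cdom d)"
    by (rule differentiable_at_withinI)
qed

lemma transition_linear:
  assumes "c \<in> A" "d \<in> A" "x \<in> cdom c" "x \<in> cdom d"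
  shows "linear (transition_deriv c d x)"
  using has_strict_derivative_bounded_linear[OF transition_strict[OF assms]] bounded_linear.linear by blast

lemma transition_chain:
  assumes "c \<in> A" "d \<in> A" "e \<in> A" "x \<in> cdom c" "x \<in> cdom d" "x \<in> cdom e"
  shows "transition_deriv d e x (transition_deriv c d x u) = transition_deriv c e x u"
proof -
  have eq: "(cmap d \<circ> cinv c) (cmap c x) = cmap d x" using assms by (simp add: cinv_cmap)
  have "has_strict_derivative (cmap e \<circ> cinv d) (transition_deriv d e x) ((cmap d \<circ> cinv c) (cmap c x))"
    unfolding eq by (rule transition_strict[OF assms(2,3,5,6)])
  from has_strict_derivative_compose[OF transition_strict[OF assms(1,2,4,5)] this]
  have "has_strict_derivative (\<lambda>y. (cmap e \<circ> cinv d) ((cmap d \<circ> cinv c) y)) (\<lambda>u. transition_deriv d e x (transition_deriv c d x u)) (cmap c x)" .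
  then have "has_strict_derivative (cmap e \<circ> cinv c) (\<lambda>u. transition_deriv d e x (transition_deriv c d x u)) (cmap c x)"
  proof (rule has_strict_derivative_transform)
    show "open (cmap c ` (cdom c \<inter> cdom d))" using assms by (intro open_image open_dom)
    show "cmap c x \<in> cmap c ` (cdom c \<inter> cdom d)" using assms by blast
    show "(cmap e \<circ> cinv c) y = (cmap e \<circ> cinv d) ((cmap d \<circ> cinv c) y)" if "y \<in> cmap c ` (cdom c \<inter> cdom d)" for y
      using that assms by (auto simp: cinv_cmap)
  qed
  then show ?thesis using has_strict_derivative_unique[OF _ transition_strict[OF assms(1,3,4,6)]] by (auto dest: fun_cong)
qed

lemma transition_self:
  assumes "c \<in> A" "x \<in> cdom c"
  shows "transition_deriv c c x u = u"
proof -
  have "has_strict_derivative (cmap c \<circ> cinv c) (\<lambda>u. u) (cmap c x)"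
    by (rule has_strict_derivative_transform[OF has_strict_derivative_ident open_img[OF assms(1)]])
       (use assms in \<open>auto simp: cmap_cinv\<close>)
  then show ?thesis using has_strict_derivative_unique[OF _ transition_strict[OF assms(1,1,2,2)]] by (auto dest: fun_cong)
qed

section \<open>Tangent vectors in a single chart\<close>

lemma coord_vec_tangent:
  assumes "c \<in> A" "x \<in> cdom c"
  shows "coord_vec A c x a \<in> tangent_space A x"
  using assms by (auto simp: tangent_space_def coord_vec_def charts_at_def transition_chain)

lemma coord_vec_self: "c \<in> A \<Longrightarrow> x \<in> cdom c \<Longrightarrow> coord_vec A c x a c = a"
  by (simp add: coord_vec_def charts_at_def transition_self)

lemma tangent_eq_coord_vec:
  assumes "c \<in> A" "x \<in> cdom c" "v \<in> tangent_space A x"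
  shows "coord_vec A c x (v c) = v"
proof
  fix d
  have c: "c \<in> charts_at A x" using assms(1,2) by (simp add: charts_at_def)
  show "coord_vec A c x (v c) d = v d"
  proof (cases "d \<in> charts_at A x")
    case True
    then have "v d = transition_deriv c d x (v c)" using assms(3) c unfolding tangent_space_def by blast
    then show ?thesis using True by (simp only: coord_vec_def if_True)
  next
    case False
    then have "v d = 0" using assms(3) unfolding tangent_space_def by blast
    then show ?thesis using False by (simp only: coord_vec_def if_False)
  qed
qed

lemma tangent_transition:
  assumes "c \<in> A" "x \<in> cdom c" "d \<in> A" "x \<in> cdom d" "v \<in> tangent_space A x"
  shows "v d = transition_deriv c d x (v c)"
  using assms unfolding tangent_space_def charts_at_def by blast

lemma tangent_eqI:
  assumes "c \<in> A" "x \<in> cdom c" "u \<in> tangent_space A x" "v \<in> tangent_space A x" "u c = v c"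
  shows "u = v"
proof -
  have "u = coord_vec A c x (u c)" by (rule tangent_eq_coord_vec[OF assms(1,2,3), symmetric])
  also have "\<dots> = coord_vec A c x (v c)" by (simp only: assms(5))
  also have "\<dots> = v" by (rule tangent_eq_coord_vec[OF assms(1,2,4)])
  finally show ?thesis .
qed

lemma coord_vec_add:
  assumes "c \<in> A" "x \<in> cdom c"
  shows "coord_vec A c x (a + b) = tadd (coord_vec A c x a) (coord_vec A c x b)"
  using transition_linear[OF assms(1) _ assms(2)] by (auto simp: coord_vec_def tadd_def fun_eq_iff charts_at_def linear_add)

lemma coord_vec_scale:
  assumes "c \<in> A" "x \<in> cdom c"
  shows "coord_vec A c x (s *\<^sub>R a) = tscale s (coord_vec A c x a)"
  using transition_linear[OF assms(1) _ assms(2)] by (auto simp: coord_vec_def tscale_def fun_eq_iff charts_at_def linear_cmul)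

lemma coord_vec_eq_zero_iff:
  assumes "c \<in> A" "x \<in> cdom c"
  shows "coord_vec A c x a = tzero \<longleftrightarrow> a = 0"
proof
  assume "coord_vec A c x a = tzero"
  then show "a = 0" using fun_cong[of "coord_vec A c x a" tzero c] coord_vec_self[OF assms, of a] by (simp add: tzero_def)
next
  assume "a = 0"
  then show "coord_vec A c x a = tzero" using coord_vec_scale[OF assms, of 0 0] by (simp add: tscale_def tzero_def)
qed

section \<open>Null sets on the manifold\<close>

text \<open>Tests nullness in the charts of the atlas only; \<open>measure_zero\<close> tests all
  smooth charts. The proof works with the former and converts at the very end.\<close>

definition null_in :: "'m set \<Rightarrow> bool" where
  "null_in N \<longleftrightarrow> (\<forall>c\<in>A. negligible (cmap c ` (N \<inter> cdom c)))"

text \<open>Second countability enters here, through Lindelof. Countability is what lets null sets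
  be glued from chart pieces.\<close>

lemma countable_subatlas:
  obtains A' where "A' \<subseteq> A" "countable A'" "(\<Union>c\<in>A'. cdom c) = UNIV"
proof -
  obtain F where F: "F \<subseteq> cdom ` A" "countable F" "\<Union>F = \<Union>(cdom ` A)"
    using Lindelof[of "cdom ` A"] open_dom by blast
  have "\<forall>U\<in>F. \<exists>c\<in>A. cdom c = U" using F(1) by blast
  then obtain k where k: "\<And>U. U \<in> F \<Longrightarrow> k U \<in> A \<and> cdom (k U) = U" by metis
  have "(\<Union>c\<in>k ` F. cdom c) = \<Union>F" using k by auto
  moreover have "\<Union>(cdom ` A) = UNIV" using cover by blast
  ultimately show thesis using that[of "k ` F"] F k by auto
qed

lemma null_in_subset: "null_in N \<Longrightarrow> M \<subseteq> N \<Longrightarrow> null_in M"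
  unfolding null_in_def by (meson Int_mono image_mono negligible_subset order_refl)

lemma null_in_UN:
  assumes "countable I" "\<And>i. i \<in> I \<Longrightarrow> null_in (N i)"
  shows "null_in (\<Union>i\<in>I. N i)"
  unfolding null_in_def
proof
  fix c assume c: "c \<in> A"
  have "cmap c ` ((\<Union>i\<in>I. N i) \<inter> cdom c) = (\<Union>i\<in>I. cmap c ` (N i \<inter> cdom c))" by blast
  moreover have "negligible (\<Union>i\<in>I. cmap c ` (N i \<inter> cdom c))"
    using assms c by (intro negligible_countable_Union) (auto simp: null_in_def)
  ultimately show "negligible (cmap c ` ((\<Union>i\<in>I. N i) \<inter> cdom c))" by simp
qed

lemma null_in_chart:
  assumes c: "c \<in> A" and S: "S \<subseteq> cdom c" "negligible (cmap c ` S)"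
  shows "null_in S"
  unfolding null_in_def
proof
  fix d assume d: "d \<in> A"
  show "negligible (cmap d ` (S \<inter> cdom d))"
    by (rule negligible_chart_change[OF chart[OF c] chart[OF d] _ _ transition_diff_on[OF c d]])
       (use S in \<open>auto intro: negligible_subset\<close>)
qed

lemma null_in_subatlas:
  assumes A': "A' \<subseteq> A" "countable A'" "(\<Union>c\<in>A'. cdom c) = UNIV"
    and N: "\<And>c. c \<in> A' \<Longrightarrow> negligible (cmap c ` (N \<inter> cdom c))"
  shows "null_in N"
proof -
  have "null_in (\<Union>c\<in>A'. N \<inter> cdom c)"
    using A' N by (intro null_in_UN) (auto intro: null_in_chart)
  moreover have "N = (\<Union>c\<in>A'. N \<inter> cdom c)" using A'(3) by blast
  ultimately show ?thesis by simp
qed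

text \<open>The domain of a smooth chart is cut into countably many pieces by atlas charts, and on
  each piece the transition map is differentiable, so it preserves null sets.\<close>

lemma null_in_imp_measure_zero:
  assumes "null_in N"
  shows "measure_zero A N"
  unfolding measure_zero_def
proof
  fix c assume c: "c \<in> smooth_charts A"
  then have cc: "is_chart c" and comp: "\<And>d. d \<in> A \<Longrightarrow> compatible smooth_on c d" by (auto simp: smooth_charts_def)
  obtain A' where A': "A' \<subseteq> A" "countable A'" "(\<Union>c\<in>A'. cdom c) = UNIV" by (rule countable_subatlas)
  have "negligible (cmap c ` (N \<inter> cdom c \<inter> cdom d))" if d: "d \<in> A'" for d
  proof (rule negligible_chart_change)
    have dA: "d \<in> A" using d A' by blast
    show "is_chart d" "is_chart c" using dA cc chart by auto
    show "negligible (cmap d ` (N \<inter> cdom c \<inter> cdom d))"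
      using assms dA by (auto simp: null_in_def intro: negligible_subset)
    have "Ck_on (Suc 0) (cmap d ` (cdom c \<inter> cdom d)) (cmap c \<circ> cinv d)"
      using comp[OF dA] by (simp add: compatible_def smooth_on_def del: Ck_on.simps)
    then show "(cmap c \<circ> cinv d) differentiable_on cmap d ` (cdom d \<inter> cdom c)"
      by (auto simp: differentiable_on_def Int_commute intro: differentiable_at_withinI)
  qed auto
  then have "negligible (\<Union>d\<in>A'. cmap c ` (N \<inter> cdom c \<inter> cdom d))"
    using A' by (intro negligible_countable_Union) auto
  moreover have "cmap c ` (N \<inter> cdom c) = (\<Union>d\<in>A'. cmap c ` (N \<inter> cdom c \<inter> cdom d))" using A'(3) by blast
  ultimately show "cmap c ` (N \<inter> cdom c) \<in> null_sets lebesgue" by (simp add: negligible_iff_null_sets)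
qed

end

section \<open>Gradient and Hessian in coordinates\<close>

text \<open>A product rule that asks only for continuity of the linear factor \<open>J\<close> at
  \<open>a\<close>: since \<open>G\<close> vanishes there, variations of \<open>J\<close> are
  multiplied by something of first order.\<close>

lemma has_derivative_moving_linear:
  fixes G :: "'a::real_normed_vector \<Rightarrow> 'b::real_normed_vector" and J0 :: "'b \<Rightarrow> 'c::real_normed_vector"
  assumes J: "\<And>e. e > 0 \<Longrightarrow> \<exists>d>0. \<forall>y\<in>ball a d. \<forall>u. norm (J y u - J0 u) \<le> e * norm u"
    and J0: "bounded_linear J0" and G: "(G has_derivative G') (at a)" "G a = 0"
  shows "((\<lambda>y. J y (G y)) has_derivative (\<lambda>u. J0 (G' u))) (at a)"
  unfolding has_derivative_at_alt
proof (intro conjI allI impI)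
  have bG: "bounded_linear G'" using G(1) by (rule has_derivative_bounded_linear)
  show "bounded_linear (\<lambda>u. J0 (G' u))" by (rule bounded_linear_compose[OF J0 bG])
  obtain KJ where KJ: "KJ > 0" "\<And>u. norm (J0 u) \<le> norm u * KJ" using bounded_linear.pos_bounded[OF J0] by blast
  obtain KG where KG: "KG > 0" "\<And>u. norm (G' u) \<le> norm u * KG" using bounded_linear.pos_bounded[OF bG] by blast
  fix e :: real assume e: "e > 0"
  define e1 where "e1 = min 1 (e / (2 * KJ))"
  define e2 where "e2 = e / (2 * (KG + 1))"
  have e1: "e1 > 0" "e1 \<le> 1" "e1 * KJ \<le> e / 2" using e KJ by (auto simp: e1_def min_def field_simps)
  have e2: "e2 > 0" "e2 * (KG + 1) = e / 2" using e KG by (auto simp: e2_def field_simps)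
  obtain d1 where d1: "d1 > 0" "\<And>y. norm (y - a) < d1 \<Longrightarrow> norm (G y - G a - G' (y - a)) \<le> e1 * norm (y - a)"
    using G(1) e1(1) unfolding has_derivative_at_alt by blast
  obtain d2 where d2: "d2 > 0" "\<And>y u. y \<in> ball a d2 \<Longrightarrow> norm (J y u - J0 u) \<le> e2 * norm u" using J[OF e2(1)] by blast
  have zero: "J a (G a) = 0"
  proof -
    have "norm (J a (G a) - J0 (G a)) \<le> e2 * norm (G a)" using d2 by simp
    then show ?thesis using G(2) J0 by (simp add: linear_0 bounded_linear.linear)
  qed
  show "\<exists>d>0. \<forall>y. norm (y - a) < d \<longrightarrow> norm (J y (G y) - J a (G a) - J0 (G' (y - a))) \<le> e * norm (y - a)"
  proof (intro exI[of _ "min d1 d2"] conjI allI impI)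
    fix y assume y: "norm (y - a) < min d1 d2"
    have r: "norm (G y - G' (y - a)) \<le> e1 * norm (y - a)" using d1(2)[of y] y G(2) by simp
    have "norm (G y) \<le> norm (G y - G' (y - a)) + norm (G' (y - a))" using norm_triangle_ineq[of "G y - G' (y - a)" "G' (y - a)"] by simp
    also have "\<dots> \<le> 1 * norm (y - a) + norm (y - a) * KG" 
    proof (rule add_mono)
      show "norm (G y - G' (y - a)) \<le> 1 * norm (y - a)" using r mult_right_mono[OF e1(2), of "norm (y - a)"] by simp
    qed (rule KG)
    finally have Gy: "norm (G y) \<le> (KG + 1) * norm (y - a)" by (simp add: algebra_simps)
    have "J y (G y) - J0 (G' (y - a)) = (J y (G y) - J0 (G y)) + J0 (G y - G' (y - a))"
      using J0 by (simp add: linear_diff bounded_linear.linear)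
    then have "norm (J y (G y) - J0 (G' (y - a))) \<le> norm (J y (G y) - J0 (G y)) + norm (J0 (G y - G' (y - a)))"
      by (simp only: norm_triangle_ineq)
    also have "\<dots> \<le> e2 * ((KG + 1) * norm (y - a)) + (e1 * norm (y - a)) * KJ"
    proof (rule add_mono)
      have "norm (J y (G y) - J0 (G y)) \<le> e2 * norm (G y)" using d2(2)[of y] y by (simp add: dist_norm norm_minus_commute)
      also have "\<dots> \<le> e2 * ((KG + 1) * norm (y - a))" using Gy e2(1) by (intro mult_left_mono) auto
      finally show "norm (J y (G y) - J0 (G y)) \<le> e2 * ((KG + 1) * norm (y - a))" .
      show "norm (J0 (G y - G' (y - a))) \<le> (e1 * norm (y - a)) * KJ"
        using KJ r by (intro order_trans[OF KJ(2)] mult_right_mono) auto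
    qed
    also have "\<dots> = (e2 * (KG + 1)) * norm (y - a) + (e1 * KJ) * norm (y - a)" by simp
    also have "\<dots> \<le> (e/2) * norm (y - a) + (e/2) * norm (y - a)" using e1(3) e2(2) by (intro add_mono mult_right_mono) auto
    finally show "norm (J y (G y) - J a (G a) - J0 (G' (y - a))) \<le> e * norm (y - a)" using zero by simp
  qed (use d1 d2 in auto)
qed

locale riemannian_retraction = analytic_manifold A
  for A :: "('m::{t2_space, second_countable_topology}, 'a::euclidean_space) chart set" +
  fixes g :: "('m, 'a) metric" and R :: "'m \<Rightarrow> ('m, 'a) tvec \<Rightarrow> 'm" and f :: "'m \<Rightarrow> real"
  assumes metric: "riemannian_metric A g" and retraction: "is_retraction A R"
    and fiber: "fiberwise_real_analytic A R" and f_C2: "Ck_fun 2 A f"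
begin

abbreviation mc where "mc \<equiv> metric_coeff A g"

lemma mc_cmap:
  assumes "c \<in> A" "x \<in> cdom c" "u \<in> tangent_space A x" "v \<in> tangent_space A x"
  shows "mc c (cmap c x) (u c) (v c) = g x u v"
  using tangent_eq_coord_vec[OF assms(1,2,3)] tangent_eq_coord_vec[OF assms(1,2,4)]
  by (simp only: metric_coeff_def cinv_cmap[OF assms(1,2)])

lemma inner_form_mc:
  assumes c: "c \<in> A" and y: "y \<in> cimg c"
  shows "inner_form (mc c y)"
proof
  let ?x = "cinv c y"
  have x: "?x \<in> cdom c" using cinv_dom[OF c y] .
  note ct = coord_vec_tangent[OF c x]
  have M: "\<And>u v. u \<in> tangent_space A ?x \<Longrightarrow> v \<in> tangent_space A ?x \<Longrightarrow> g ?x u v = g ?x v u"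
    "\<And>u v w. u \<in> tangent_space A ?x \<Longrightarrow> v \<in> tangent_space A ?x \<Longrightarrow> w \<in> tangent_space A ?x \<Longrightarrow> g ?x (tadd u v) w = g ?x u w + g ?x v w"
    "\<And>u v s. u \<in> tangent_space A ?x \<Longrightarrow> v \<in> tangent_space A ?x \<Longrightarrow> g ?x (tscale s u) v = s * g ?x u v"
    "\<And>u. u \<in> tangent_space A ?x \<Longrightarrow> u \<noteq> tzero \<Longrightarrow> g ?x u u > 0"
    using metric unfolding riemannian_metric_def by blast+
  show sym: "mc c y u v = mc c y v u" for u v unfolding metric_coeff_def by (intro M(1) ct)
  have l: "linear (\<lambda>u. mc c y u v)" for v
  proof (rule linearI)
    show "mc c y (u1 + u2) v = mc c y u1 v + mc c y u2 v" for u1 u2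
      unfolding metric_coeff_def coord_vec_add[OF c x] by (intro M(2) ct)
    show "mc c y (s *\<^sub>R u) v = s *\<^sub>R mc c y u v" for s u
      unfolding metric_coeff_def coord_vec_scale[OF c x] real_scaleR_def by (intro M(3) ct)
  qed
  have "linear (\<lambda>v. mc c y u v)" for u unfolding sym[of u] by (rule l)
  with l show "bilinear (mc c y)" by (simp add: bilinear_def)
  show "mc c y u u > 0" if "u \<noteq> 0" for u
    unfolding metric_coeff_def by (intro M(4) ct) (use that coord_vec_eq_zero_iff[OF c x] in blast)
qed

lemma mc_strict:
  assumes "c \<in> A" "y \<in> cimg c"
  shows "has_strict_derivative (\<lambda>y. mc c y u v) (frechet_derivative (\<lambda>y. mc c y u v) (at y)) y"
  by (rule smooth_on_strict[OF _ open_img[OF assms(1)] assms(2)])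
     (use metric assms(1) in \<open>simp add: riemannian_metric_def\<close>)

definition fh :: "('m, 'a) chart \<Rightarrow> 'a \<Rightarrow> real" where "fh c = f \<circ> cinv c"
definition df :: "('m, 'a) chart \<Rightarrow> 'a \<Rightarrow> 'a \<Rightarrow> real" where "df c y = frechet_derivative (fh c) (at y)"
definition d2f :: "('m, 'a) chart \<Rightarrow> 'a \<Rightarrow> 'a \<Rightarrow> 'a \<Rightarrow> real" where
  "d2f c y b = frechet_derivative (\<lambda>y. df c y b) (at y)"

lemma fh_C2: "c \<in> A \<Longrightarrow> Ck_on 2 (cimg c) (fh c)"
  using f_C2 by (simp add: Ck_fun_def fh_def)

lemma fh_strict: "c \<in> A \<Longrightarrow> y \<in> cimg c \<Longrightarrow> has_strict_derivative (fh c) (df c y) y"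
  unfolding df_def using fh_C2 open_img by (intro Ck_on_Suc_strict[of 1]) (auto simp: numeral_2_eq_2 simp del: Ck_on.simps)

lemma df_linear: "c \<in> A \<Longrightarrow> y \<in> cimg c \<Longrightarrow> linear (df c y)"
  using has_strict_derivative_bounded_linear[OF fh_strict] bounded_linear.linear by blast

lemma df_strict:
  assumes "c \<in> A" "y \<in> cimg c"
  shows "has_strict_derivative (\<lambda>y. df c y b) (d2f c y b) y"
proof -
  have "Ck_on (Suc (Suc 0)) (cimg c) (fh c)" using fh_C2[OF assms(1)] by (simp only: numeral_2_eq_2)
  then have "Ck_on (Suc 0) (cimg c) (\<lambda>y. df c y b)" unfolding df_def by (subst (asm) Ck_on.simps(2)) blast
  then show ?thesis unfolding d2f_def using Ck_on_Suc0_strict open_img assms by blast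
qed

lemma d2f_symmetric:
  assumes c: "c \<in> A" and y: "y \<in> cimg c"
  shows "d2f c y b u = d2f c y u b"
  by (rule symmetric_second_derivative[OF open_img[OF c] y, of "fh c" "df c" "\<lambda>h u. d2f c y u h"])
     (use has_strict_derivative_imp_has_derivative[OF fh_strict] df_strict c y in auto)

lemma df_chain:
  assumes c: "c \<in> A" "x \<in> cdom c" and d: "d \<in> A" "x \<in> cdom d"
  shows "df d (cmap d x) (transition_deriv c d x u) = df c (cmap c x) u"
proof -
  have eq: "(cmap d \<circ> cinv c) (cmap c x) = cmap d x" using c by (simp add: cinv_cmap)
  have "has_strict_derivative (fh d) (df d (cmap d x)) ((cmap d \<circ> cinv c) (cmap c x))"
    unfolding eq using d by (intro fh_strict) auto
  from has_strict_derivative_compose[OF transition_strict[OF c(1) d(1) c(2) d(2)] this]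
  have "has_strict_derivative (fh c) (\<lambda>u. df d (cmap d x) (transition_deriv c d x u)) (cmap c x)"
  proof (rule has_strict_derivative_transform)
    show "open (cmap c ` (cdom c \<inter> cdom d))" using c d by (intro open_image open_dom)
    show "cmap c x \<in> cmap c ` (cdom c \<inter> cdom d)" using c d by blast
    show "fh c y = fh d ((cmap d \<circ> cinv c) y)" if "y \<in> cmap c ` (cdom c \<inter> cdom d)" for y
      using that c d by (auto simp: fh_def cinv_cmap)
  qed
  moreover have "has_strict_derivative (fh c) (df c (cmap c x)) (cmap c x)" using c by (intro fh_strict) auto
  ultimately show ?thesis using has_strict_derivative_unique by (metis (no_types, lifting))
qed

abbreviation gr where "gr \<equiv> grad A g f"
definition gradc :: "('m, 'a) chart \<Rightarrow> 'a \<Rightarrow> 'a" where "gradc c y = gr (cinv c y) c"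

text \<open>The \<open>THE\<close> in \<open>grad\<close> asks for the Riesz property in all charts
  at once. Existence comes from one chart, and the chain rule carries the property to the others;
  uniqueness comes from nondegeneracy in that chart.\<close>

lemma
  shows grad_tangent: "gr x \<in> tangent_space A x"
    and grad_riesz: "c \<in> A \<Longrightarrow> x \<in> cdom c \<Longrightarrow> v \<in> tangent_space A x \<Longrightarrow> g x (gr x) v = df c (cmap c x) (v c)"
proof -
  let ?P = "\<lambda>u. u \<in> tangent_space A x \<and>
        (\<forall>c\<in>charts_at A x. \<forall>v\<in>tangent_space A x. g x u v = frechet_derivative (f \<circ> cinv c) (at (cmap c x)) (v c))"
  obtain c where c: "c \<in> A" "x \<in> cdom c" using cover by blast
  have cc: "c \<in> charts_at A x" using c by (simp add: charts_at_def)
  have y: "cmap c x \<in> cimg c" using c by blast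
  interpret B: inner_form "mc c (cmap c x)" by (rule inner_form_mc[OF c(1) y])
  obtain u where u: "\<And>v. mc c (cmap c x) u v = df c (cmap c x) v" using B.riesz[OF df_linear[OF c(1) y]] by blast
  let ?u = "coord_vec A c x u"
  have ut: "?u \<in> tangent_space A x" by (rule coord_vec_tangent[OF c])
  have "?P ?u"
  proof (intro conjI ballI ut)
    fix d v assume d: "d \<in> charts_at A x" and v: "v \<in> tangent_space A x"
    have d': "d \<in> A" "x \<in> cdom d" using d by (auto simp: charts_at_def)
    have "g x ?u v = mc c (cmap c x) u (v c)" using mc_cmap[OF c ut v] coord_vec_self[OF c, of u] by simp
    also have "\<dots> = df c (cmap c x) (v c)" by (rule u)
    also have "\<dots> = df d (cmap d x) (transition_deriv c d x (v c))" by (rule df_chain[OF c d', symmetric])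
    also have "transition_deriv c d x (v c) = v d"
      by (rule tangent_transition[OF c d' v, symmetric])
    finally show "g x ?u v = frechet_derivative (f \<circ> cinv d) (at (cmap d x)) (v d)" by (simp add: df_def fh_def)
  qed
  moreover have "w = ?u" if w: "?P w" for w
  proof (rule tangent_eqI[OF c _ ut])
    show wt: "w \<in> tangent_space A x" using w by blast
    have "mc c (cmap c x) (w c) b = mc c (cmap c x) u b" for b
    proof -
      have "mc c (cmap c x) (w c) (coord_vec A c x b c) = g x w (coord_vec A c x b)"
        by (rule mc_cmap[OF c wt coord_vec_tangent[OF c]])
      also have "\<dots> = df c (cmap c x) (coord_vec A c x b c)"
        using w cc coord_vec_tangent[OF c, of b] unfolding df_def fh_def by blast
      finally show ?thesis by (simp add: coord_vec_self[OF c] u)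
    qed
    then have "w c = u" by (rule B.nondegenerate)
    then show "w c = ?u c" by (simp add: coord_vec_self[OF c])
  qed
  ultimately have Pg: "?P (gr x)" unfolding grad_def by (rule theI)
  then show "gr x \<in> tangent_space A x" by blast
  show "g x (gr x) v = df c (cmap c x) (v c)" if "c \<in> A" "x \<in> cdom c" "v \<in> tangent_space A x" for c v
    using Pg that unfolding df_def fh_def charts_at_def by blast
qed

lemma gradc_riesz:
  assumes c: "c \<in> A" and y: "y \<in> cimg c"
  shows "mc c y (gradc c y) b = df c y b"
proof -
  have x: "cinv c y \<in> cdom c" "cmap c (cinv c y) = y" using cinv_dom[OF c y] cmap_cinv[OF c y] by auto
  let ?v = "coord_vec A c (cinv c y) b"
  have v: "?v \<in> tangent_space A (cinv c y)" by (rule coord_vec_tangent[OF c x(1)])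
  show ?thesis
    using grad_riesz[OF c x(1) v] mc_cmap[OF c x(1) grad_tangent v] by (simp add: gradc_def x(2) coord_vec_self[OF c x(1)])
qed

lemma grad_coord: "c \<in> A \<Longrightarrow> y \<in> cimg c \<Longrightarrow> gr (cinv c y) = coord_vec A c (cinv c y) (gradc c y)"
  unfolding gradc_def by (rule tangent_eq_coord_vec[symmetric]) (auto intro: cinv_dom grad_tangent)

lemma tnorm_grad:
  assumes c: "c \<in> A" and y: "y \<in> cimg c"
  shows "(tnorm g (cinv c y) (gr (cinv c y)))\<^sup>2 = mc c y (gradc c y) (gradc c y)"
proof -
  have "g (cinv c y) (gr (cinv c y)) (gr (cinv c y)) = mc c y (gradc c y) (gradc c y)"
    using grad_coord[OF c y] by (simp add: metric_coeff_def)
  moreover have "mc c y (gradc c y) (gradc c y) \<ge> 0"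
    using inner_form.pos[OF inner_form_mc[OF c y], of "gradc c y"] inner_form.zero_left[OF inner_form_mc[OF c y]]
    by (cases "gradc c y = 0") auto
  ultimately show ?thesis by (simp add: tnorm_def)
qed

definition dG :: "('m, 'a) chart \<Rightarrow> 'a \<Rightarrow> 'a \<Rightarrow> 'a" where "dG c y = frechet_derivative (gradc c) (at y)"

lemma gradc_derivative:
  assumes c: "c \<in> A" and y: "y \<in> cimg c"
  shows "has_strict_derivative (gradc c) (dG c y) y"
    and "mc c y (dG c y u) b = d2f c y b u - frechet_derivative (\<lambda>z. mc c z (gradc c y) b) (at y) u"
proof -
  obtain G' where G': "has_strict_derivative (gradc c) G' y"
    "\<And>u b. mc c y (G' u) b = d2f c y b u - frechet_derivative (\<lambda>z. mc c z (gradc c y) b) (at y) u"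
    by (rule riesz_field_strict_derivative[OF open_img[OF c] y, of "mc c" "\<lambda>a b. frechet_derivative (\<lambda>z. mc c z a b) (at y)" "df c" "d2f c y" "gradc c"])
       (use inner_form_mc mc_strict df_linear df_strict gradc_riesz c y in auto)
  have "dG c y = G'" unfolding dG_def by (rule has_strict_derivative_frechet[OF G'(1)])
  then show "has_strict_derivative (gradc c) (dG c y) y"
    and "mc c y (dG c y u) b = d2f c y b u - frechet_derivative (\<lambda>z. mc c z (gradc c y) b) (at y) u"
    using G' by auto
qed

lemmas gradc_strict = gradc_derivative(1)

text \<open>The metric is paired with the vanishing gradient, so its derivative contributes nothing,
  and the linearised gradient is the metric dual of the plain second derivative of
  \<open>f\<close>.\<close>

lemma dG_critical:
  assumes c: "c \<in> A" and y: "y \<in> cimg c" and crit: "gradc c y = 0"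
  shows "mc c y (dG c y u) b = d2f c y b u"
proof -
  have "has_strict_derivative (\<lambda>z. mc c z 0 b) (\<lambda>_. 0) y"
    by (rule has_strict_derivative_transform[OF has_strict_derivative_const[of 0] open_img[OF c] y])
       (simp add: inner_form.zero_left[OF inner_form_mc[OF c]])
  then have "frechet_derivative (\<lambda>z. mc c z 0 b) (at y) = (\<lambda>_. 0)" by (rule has_strict_derivative_frechet)
  then show ?thesis using gradc_derivative(2)[OF c y, of u b] crit by simp
qed

text \<open>Symmetry of the second derivative, read through the metric at the point.\<close>

lemma dG_self_adjoint:
  assumes "c \<in> A" "y \<in> cimg c" "gradc c y = 0"
  shows "mc c y (dG c y u) v = mc c y u (dG c y v)"
proof -
  have "mc c y u (dG c y v) = mc c y (dG c y v) u" by (rule inner_form.sym[OF inner_form_mc[OF assms(1,2)]])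
  then show ?thesis using dG_critical[OF assms] d2f_symmetric[OF assms(1,2)] by simp
qed

lemma gradc_transition:
  assumes c: "c \<in> A" "x \<in> cdom c" and d: "d \<in> A" "x \<in> cdom d"
  shows "gradc d (cmap d x) = transition_deriv c d x (gradc c (cmap c x))"
proof -
  have "gr x \<in> tangent_space A x" by (rule grad_tangent)
  then have "gr x d = transition_deriv c d x (gr x c)" using c d unfolding tangent_space_def charts_at_def by blast
  then show ?thesis by (simp add: gradc_def cinv_cmap c d)
qed

text \<open>The identity \<open>gradc d \<circ> \<psi> = J (gradc c)\<close>, for the transition map
  \<psi> with derivative \<open>J\<close>, is differentiated at a critical point; the term with the
  derivative of \<open>J\<close> would be multiplied by zero. So the linearised gradient transforms
  like an endomorphism of the tangent space.\<close>

lemma dG_transition: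
  assumes c: "c \<in> A" "x \<in> cdom c" and d: "d \<in> A" "x \<in> cdom d" and crit: "gradc c (cmap c x) = 0"
  shows "dG d (cmap d x) (transition_deriv c d x u) = transition_deriv c d x (dG c (cmap c x) u)"
proof -
  let ?\<psi> = "cmap d \<circ> cinv c"
  let ?S = "cmap c ` (cdom c \<inter> cdom d)"
  let ?J = "\<lambda>y. transition_deriv c d (cinv c y)"
  have S: "open ?S" "cmap c x \<in> ?S" using c d by (auto intro!: open_image open_dom)
  have eq: "?\<psi> (cmap c x) = cmap d x" using c by (simp add: cinv_cmap)
  note tr = transition_strict[OF c(1) d(1) c(2) d(2)]
  have "has_strict_derivative (gradc d) (dG d (cmap d x)) (?\<psi> (cmap c x))" unfolding eq using d by (intro gradc_strict) auto
  from has_strict_derivative_compose[OF tr this]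
  have "has_strict_derivative (\<lambda>y. ?J y (gradc c y)) (\<lambda>u. dG d (cmap d x) (transition_deriv c d x u)) (cmap c x)"
  proof (rule has_strict_derivative_transform[OF _ S])
    fix y assume "y \<in> ?S"
    then obtain z where z: "z \<in> cdom c" "z \<in> cdom d" "y = cmap c z" by blast
    show "?J y (gradc c y) = gradc d (?\<psi> y)"
      using gradc_transition[OF c(1) z(1) d(1) z(2)] z by (simp add: cinv_cmap c)
  qed
  then have 1: "((\<lambda>y. ?J y (gradc c y)) has_derivative (\<lambda>u. dG d (cmap d x) (transition_deriv c d x u))) (at (cmap c x))"
    by (rule has_strict_derivative_imp_has_derivative)
  have 2: "((\<lambda>y. ?J y (gradc c y)) has_derivative (\<lambda>u. transition_deriv c d x (dG c (cmap c x) u))) (at (cmap c x))"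
  proof (rule has_derivative_moving_linear[where J = ?J and G = "gradc c" and ?J0.0 = "transition_deriv c d x" and G' = "dG c (cmap c x)"])
    fix e :: real assume e: "e > 0"
    obtain r where r: "r > 0" "\<And>y F u. y \<in> ball (cmap c x) r \<Longrightarrow> (?\<psi> has_derivative F) (at y) \<Longrightarrow> norm (F u - transition_deriv c d x u) \<le> e * norm u"
      using has_strict_derivative_derivative_close[OF tr e] by metis
    obtain r' where r': "r' > 0" "ball (cmap c x) r' \<subseteq> ?S" using S openE by blast
    show "\<exists>\<rho>>0. \<forall>y\<in>ball (cmap c x) \<rho>. \<forall>u. norm (?J y u - transition_deriv c d x u) \<le> e * norm u"
    proof (intro exI[of _ "min r r'"] conjI ballI allI)
      fix y u assume y: "y \<in> ball (cmap c x) (min r r')"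
      then have "y \<in> ?S" using r'(2) by auto
      then obtain z where z: "z \<in> cdom c" "z \<in> cdom d" "y = cmap c z" by blast
      have "(?\<psi> has_derivative transition_deriv c d z) (at y)"
        using has_strict_derivative_imp_has_derivative[OF transition_strict[OF c(1) d(1) z(1,2)]] z(3) by simp
      then have "norm (transition_deriv c d z u - transition_deriv c d x u) \<le> e * norm u" using y by (intro r(2)) auto
      then show "norm (?J y u - transition_deriv c d x u) \<le> e * norm u" using z c by (simp add: cinv_cmap)
    qed (use r r' in auto)
  next
    show "bounded_linear (transition_deriv c d x)" by (rule has_strict_derivative_bounded_linear[OF tr])
    show "(gradc c has_derivative dG c (cmap c x)) (at (cmap c x))"
      using gradc_strict[OF c(1)] c(2) has_strict_derivative_imp_has_derivative by blast
  qed (rule crit)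
  from has_derivative_unique[OF 1 2] show ?thesis by (auto dest: fun_cong)
qed

text \<open>Two Koszul terms contain the zero vector as an argument of the metric, the third is a
  derivative in direction zero. Positive definiteness then makes zero the only solution for
  \<open>THE\<close>.\<close>

lemma christoffel_zero:
  assumes c: "c \<in> A" and y: "y \<in> cimg c"
  shows "christoffel A g c y a 0 = 0"
proof -
  interpret B: inner_form "mc c y" by (rule inner_form_mc[OF c y])
  have z: "frechet_derivative (\<lambda>z. mc c z 0 w) (at y) = (\<lambda>_. 0)" "frechet_derivative (\<lambda>z. mc c z w 0) (at y) = (\<lambda>_. 0)" for w
  proof -
    have "has_strict_derivative (\<lambda>z. mc c z 0 w) (\<lambda>_. 0) y" "has_strict_derivative (\<lambda>z. mc c z w 0) (\<lambda>_. 0) y"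
      by (rule has_strict_derivative_transform[OF has_strict_derivative_const[of 0] open_img[OF c] y],
          simp add: inner_form.zero_left[OF inner_form_mc[OF c]] inner_form.zero_right[OF inner_form_mc[OF c]])+
    then show "frechet_derivative (\<lambda>z. mc c z 0 w) (at y) = (\<lambda>_. 0)" "frechet_derivative (\<lambda>z. mc c z w 0) (at y) = (\<lambda>_. 0)"
      by (auto dest: has_strict_derivative_frechet)
  qed
  have l: "frechet_derivative (\<lambda>z. mc c z a w) (at y) 0 = 0" for w
    using has_strict_derivative_bounded_linear[OF mc_strict[OF c y]] by (simp add: linear_0 bounded_linear.linear)
  have "(\<forall>w. 2 * mc c y z w = 0) \<longleftrightarrow> z = 0" for z
    using B.pos[of z] B.zero_left by (cases "z = 0") force+
  then show ?thesis unfolding christoffel_def by (simp add: z l)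
qed

text \<open>At a critical point the Christoffel term vanishes, so \<open>Hess\<close> in a chart is
  \<open>dG\<close>. The \<open>THE\<close> in \<open>cov_deriv\<close> demands this in all charts
  simultaneously, which \<open>dG_transition\<close> makes consistent.\<close>

lemma saddle_eigenvector:
  assumes sad: "strict_saddle A g f x" and c: "c \<in> A" "x \<in> cdom c"
  shows "gradc c (cmap c x) = 0"
    and "\<exists>\<mu> e. \<mu> < 0 \<and> e \<noteq> 0 \<and> dG c (cmap c x) e = \<mu> *\<^sub>R e"
proof -
  have cc: "c \<in> charts_at A x" using c by (simp add: charts_at_def)
  have g0: "gr x = tzero" using sad by (simp add: strict_saddle_def)
  have crit: "gradc d (cmap d x) = 0" if "d \<in> A" "x \<in> cdom d" for d
    using g0 by (simp add: gradc_def cinv_cmap that tzero_def)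
  then show "gradc c (cmap c x) = 0" using c by blast
  obtain \<mu> v where v: "\<mu> < 0" "v \<in> tangent_space A x" "v \<noteq> tzero" "Hess A g f x v = tscale \<mu> v"
    using sad by (auto simp: strict_saddle_def)
  let ?P = "\<lambda>u. u \<in> tangent_space A x \<and>
        (\<forall>c\<in>charts_at A x. u c = frechet_derivative (\<lambda>y. gr (cinv c y) c) (at (cmap c x)) (v c) +
                 christoffel A g c (cmap c x) (v c) (gr x c))"
  have P: "?P u \<longleftrightarrow> u \<in> tangent_space A x \<and> (\<forall>c\<in>charts_at A x. u c = dG c (cmap c x) (v c))" for u
  proof -
    have "frechet_derivative (\<lambda>y. gr (cinv d y) d) (at (cmap d x)) (v d) + christoffel A g d (cmap d x) (v d) (gr x d)
        = dG d (cmap d x) (v d)" if "d \<in> charts_at A x" for d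
      using that christoffel_zero[of d "cmap d x" "v d"] g0 by (simp add: dG_def gradc_def[abs_def] charts_at_def tzero_def)
    then show ?thesis by auto
  qed
  let ?u = "coord_vec A c x (dG c (cmap c x) (v c))"
  have "?P ?u" unfolding P
  proof (intro conjI ballI coord_vec_tangent[OF c])
    fix d assume d: "d \<in> charts_at A x"
    then have d': "d \<in> A" "x \<in> cdom d" by (auto simp: charts_at_def)
    have "?u d = transition_deriv c d x (dG c (cmap c x) (v c))" using d by (simp add: coord_vec_def)
    also have "\<dots> = dG d (cmap d x) (transition_deriv c d x (v c))"
      by (rule dG_transition[OF c d' crit[OF c], symmetric])
    also have "transition_deriv c d x (v c) = v d" by (rule tangent_transition[OF c d' v(2), symmetric])
    finally show "?u d = dG d (cmap d x) (v d)" .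
  qed
  moreover have "w = ?u" if "?P w" for w
  proof (rule tangent_eqI[OF c _ coord_vec_tangent[OF c]])
    show "w \<in> tangent_space A x" using that by blast
    have "w c = dG c (cmap c x) (v c)" using that cc unfolding P by blast
    then show "w c = ?u c" by (simp add: coord_vec_self[OF c])
  qed
  ultimately have "Hess A g f x v = ?u" unfolding Hess_def cov_deriv_def by (rule the_equality)
  then have "?u c = tscale \<mu> v c" using v(4) by simp
  then have "dG c (cmap c x) (v c) = \<mu> *\<^sub>R v c" by (simp add: coord_vec_self[OF c] tscale_def)
  moreover have "v c \<noteq> 0"
    using tangent_eq_coord_vec[OF c v(2)] coord_vec_eq_zero_iff[OF c, of "v c"] v(3) by metis
  ultimately show "\<exists>\<mu> e. \<mu> < 0 \<and> e \<noteq> 0 \<and> dG c (cmap c x) e = \<mu> *\<^sub>R e" using v(1) by blast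
qed

end

section \<open>The step map in coordinates\<close>

context riemannian_retraction
begin

definition Rh :: "('m, 'a) chart \<Rightarrow> 'a \<times> 'a \<Rightarrow> 'm" where
  "Rh c = (\<lambda>(y, a). R (cinv c y) (coord_vec A c (cinv c y) a))"
definition W :: "('m, 'a) chart \<Rightarrow> ('m, 'a) chart \<Rightarrow> ('a \<times> 'a) set" where
  "W c d = (cimg c \<times> UNIV) \<inter> Rh c -` cdom d"
definition Phi :: "('m, 'a) chart \<Rightarrow> ('m, 'a) chart \<Rightarrow> 'a \<times> 'a \<Rightarrow> 'a" where
  "Phi c d = cmap d \<circ> Rh c"
definition DPhi :: "('m, 'a) chart \<Rightarrow> ('m, 'a) chart \<Rightarrow> 'a \<times> 'a \<Rightarrow> 'a \<times> 'a \<Rightarrow> 'a" where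
  "DPhi c d z = frechet_derivative (Phi c d) (at z)"

lemma Rh_map_into: "c \<in> A \<Longrightarrow> map_into smooth_on A (cimg c \<times> UNIV) (Rh c)"
  using retraction by (simp add: is_retraction_def Rh_def)

lemma Rh_cont: "c \<in> A \<Longrightarrow> continuous_on (cimg c \<times> UNIV) (Rh c)"
  using Rh_map_into by (simp add: map_into_def)

lemma W_open: "c \<in> A \<Longrightarrow> d \<in> A \<Longrightarrow> open (W c d)"
  unfolding W_def by (intro continuous_open_preimage Rh_cont open_Times open_img open_dom open_UNIV)

lemma Phi_smooth: "c \<in> A \<Longrightarrow> d \<in> A \<Longrightarrow> smooth_on (W c d) (Phi c d)"
  using Rh_map_into[of c] by (simp add: map_into_def W_def Phi_def)

lemma Phi_strict: "c \<in> A \<Longrightarrow> d \<in> A \<Longrightarrow> z \<in> W c d \<Longrightarrow> has_strict_derivative (Phi c d) (DPhi c d z) z"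
  unfolding DPhi_def by (rule smooth_on_strict[OF Phi_smooth W_open])

lemma DPhi_linear: "c \<in> A \<Longrightarrow> d \<in> A \<Longrightarrow> z \<in> W c d \<Longrightarrow> linear (DPhi c d z)"
  using has_strict_derivative_bounded_linear[OF Phi_strict] bounded_linear.linear by blast

abbreviation step where "step \<equiv> gd_step A g R f"

lemma step_coord:
  assumes c: "c \<in> A" and y: "y \<in> cimg c"
  shows "step \<alpha> (cinv c y) = Rh c (y, (- \<alpha>) *\<^sub>R gradc c y)"
  by (simp add: gd_step_def Rh_def grad_coord[OF c y] flip: coord_vec_scale[OF c cinv_dom[OF c y]] scaleR_minus_left)

lemma Rh_zero:
  assumes c: "c \<in> A" and y: "y \<in> cimg c"
  shows "Rh c (y, 0) = cinv c y"
proof -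
  have x: "cinv c y \<in> cdom c" by (rule cinv_dom[OF c y])
  have "R (cinv c y) (tscale 0 (coord_vec A c (cinv c y) 0)) = cinv c y"
    using retraction coord_vec_tangent[OF c x] unfolding is_retraction_def by blast
  then show ?thesis by (simp add: Rh_def flip: coord_vec_scale[OF c x])
qed

lemma zero_in_W: "c \<in> A \<Longrightarrow> y \<in> cimg c \<Longrightarrow> (y, 0) \<in> W c c"
  by (simp add: W_def Rh_zero cinv_dom)

lemma Phi_zero: "c \<in> A \<Longrightarrow> y \<in> cimg c \<Longrightarrow> Phi c c (y, 0) = y"
  by (simp add: Phi_def Rh_zero cmap_cinv)

text \<open>The base direction is read off from the zero section, where the retraction is the
  identity; the fibre direction from the prescribed initial velocity of
  \<open>t \<mapsto> R x (t v)\<close>.\<close>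

lemma DPhi_zero:
  assumes c: "c \<in> A" and y: "y \<in> cimg c"
  shows "DPhi c c (y, 0) (u, w) = u + w"
proof -
  have x: "cinv c y \<in> cdom c" by (rule cinv_dom[OF c y])
  note P = Phi_strict[OF c c zero_in_W[OF c y]]
  have lin: "linear (DPhi c c (y, 0))" by (rule DPhi_linear[OF c c zero_in_W[OF c y]])
  have d1: "has_strict_derivative (\<lambda>z. Phi c c (z, 0)) (\<lambda>u. DPhi c c (y, 0) (u, 0)) y"
    by (rule has_strict_derivative_compose[where f = "\<lambda>z. (z, 0)" and f' = "\<lambda>u. (u, 0)", OF has_strict_derivative_Pair[OF has_strict_derivative_ident has_strict_derivative_const] P])
  have d2: "has_strict_derivative (\<lambda>z. Phi c c (z, 0)) (\<lambda>u. u) y"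
    by (rule has_strict_derivative_transform[OF has_strict_derivative_ident open_img[OF c] y]) (rule Phi_zero[OF c])
  have 1: "DPhi c c (y, 0) (u, 0) = u" using fun_cong[OF has_strict_derivative_unique[OF d1 d2]] .
  let ?v = "coord_vec A c (cinv c y) w"
  let ?\<gamma> = "\<lambda>t. R (cinv c y) (tscale t ?v)"
  have v: "?v \<in> tangent_space A (cinv c y)" by (rule coord_vec_tangent[OF c x])
  have \<gamma>0: "?\<gamma> 0 = cinv c y" and vel: "has_velocity A ?\<gamma> ?v 0"
    using retraction v unfolding is_retraction_def by blast+
  have "c \<in> charts_at A (?\<gamma> 0)" using c x \<gamma>0 by (simp add: charts_at_def)
  then have "((cmap c \<circ> ?\<gamma>) has_vector_derivative ?v c) (at 0)" using vel unfolding has_velocity_def by blast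
  moreover have "(cmap c \<circ> ?\<gamma>) = (\<lambda>t. Phi c c (y, t *\<^sub>R w))"
    by (simp add: fun_eq_iff Phi_def Rh_def coord_vec_scale[OF c x])
  ultimately have a: "((\<lambda>t. Phi c c (y, t *\<^sub>R w)) has_derivative (\<lambda>t. t *\<^sub>R w)) (at 0)"
    by (simp add: has_vector_derivative_def coord_vec_self[OF c x])
  have "has_strict_derivative (\<lambda>t. (y, t *\<^sub>R w)) (\<lambda>t. (0, t *\<^sub>R w)) (0::real)"
    by (intro has_strict_derivative_Pair has_strict_derivative_const has_strict_derivative_linear bounded_linear_scaleR_left)
  from has_strict_derivative_compose[OF this, of "Phi c c" "DPhi c c (y, 0)"] P
  have "has_strict_derivative (\<lambda>t. Phi c c (y, t *\<^sub>R w)) (\<lambda>t. DPhi c c (y, 0) (0, t *\<^sub>R w)) (0::real)" by simp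
  from has_derivative_unique[OF a has_strict_derivative_imp_has_derivative[OF this]]
  have 2: "DPhi c c (y, 0) (0, w) = w" using fun_cong[of "\<lambda>t. t *\<^sub>R w" _ 1] by fastforce
  have "DPhi c c (y, 0) (u, w) = DPhi c c (y, 0) (u, 0) + DPhi c c (y, 0) (0, w)"
    using linear_add[OF lin, of "(u, 0)" "(0, w)"] by simp
  then show ?thesis using 1 2 by simp
qed

definition Tm :: "('m, 'a) chart \<Rightarrow> ('m, 'a) chart \<Rightarrow> real \<Rightarrow> 'a \<Rightarrow> 'a" where
  "Tm c d \<alpha> y = Phi c d (y, (- \<alpha>) *\<^sub>R gradc c y)"
definition dT :: "('m, 'a) chart \<Rightarrow> ('m, 'a) chart \<Rightarrow> real \<Rightarrow> 'a \<Rightarrow> 'a \<Rightarrow> 'a" where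
  "dT c d \<alpha> y u = DPhi c d (y, (- \<alpha>) *\<^sub>R gradc c y) (u, (- \<alpha>) *\<^sub>R dG c y u)"
definition dom_step :: "('m, 'a) chart \<Rightarrow> ('m, 'a) chart \<Rightarrow> real \<Rightarrow> 'a \<Rightarrow> bool" where
  "dom_step c d \<alpha> y \<longleftrightarrow> (y, (- \<alpha>) *\<^sub>R gradc c y) \<in> W c d"
text \<open>The target chart is quantified so that the notion does not refer to it;
  \<open>nonsing_iff\<close> shows that any chart around the image point decides.\<close>

definition nonsing :: "('m, 'a) chart \<Rightarrow> 'a \<Rightarrow> real \<Rightarrow> bool" where
  "nonsing c y \<alpha> \<longleftrightarrow> (\<exists>d\<in>A. dom_step c d \<alpha> y \<and> inj (dT c d \<alpha> y))"

lemma Tm_eq: "c \<in> A \<Longrightarrow> y \<in> cimg c \<Longrightarrow> Tm c d \<alpha> y = cmap d (step \<alpha> (cinv c y))"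
  by (simp add: Tm_def Phi_def step_coord)

lemma dom_step_iff: "c \<in> A \<Longrightarrow> y \<in> cimg c \<Longrightarrow> dom_step c d \<alpha> y \<longleftrightarrow> step \<alpha> (cinv c y) \<in> cdom d"
  by (simp add: dom_step_def W_def step_coord)

lemma curve_strict:
  assumes "c \<in> A" "y \<in> cimg c"
  shows "has_strict_derivative (\<lambda>z. (fst z, (- snd z) *\<^sub>R gradc c (fst z)))
           (\<lambda>h. (fst h, (- \<alpha>) *\<^sub>R dG c y (fst h) + (- snd h) *\<^sub>R gradc c y)) (y, \<alpha>)"
proof -
  have 1: "has_strict_derivative (\<lambda>z::'a \<times> real. - snd z) (\<lambda>h. - snd h) (y, \<alpha>)"
    by (intro has_strict_derivative_linear bounded_linear_minus bounded_linear_snd)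
  have 2: "has_strict_derivative (\<lambda>z::'a \<times> real. gradc c (fst z)) (\<lambda>h. dG c y (fst h)) (y, \<alpha>)"
    by (rule has_strict_derivative_compose[OF has_strict_derivative_linear[OF bounded_linear_fst]]) (simp add: gradc_strict assms)
  from has_strict_derivative_Pair[OF has_strict_derivative_linear[OF bounded_linear_fst] bounded_bilinear.has_strict_derivative[OF bounded_bilinear_scaleR 1 2]]
  show ?thesis by simp
qed

lemma step_joint_strict:
  assumes c: "c \<in> A" "y \<in> cimg c" and d: "d \<in> A" "dom_step c d \<alpha> y"
  shows "has_strict_derivative (\<lambda>z. Tm c d (snd z) (fst z))
    (\<lambda>h. DPhi c d (y, (- \<alpha>) *\<^sub>R gradc c y) (fst h, (- \<alpha>) *\<^sub>R dG c y (fst h) + (- snd h) *\<^sub>R gradc c y)) (y, \<alpha>)"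
  unfolding Tm_def
  by (rule has_strict_derivative_compose[OF curve_strict[OF c]]) (use Phi_strict[OF c(1) d(1)] d(2) in \<open>simp add: dom_step_def\<close>)

lemma step_strict:
  assumes c: "c \<in> A" "y \<in> cimg c" and d: "d \<in> A" "dom_step c d \<alpha> y"
  shows "has_strict_derivative (Tm c d \<alpha>) (dT c d \<alpha> y) y"
proof -
  have 1: "has_strict_derivative (\<lambda>y. (y, \<alpha>)) (\<lambda>u. (u, 0)) y"
    by (intro has_strict_derivative_Pair has_strict_derivative_ident has_strict_derivative_const)
  from has_strict_derivative_compose[OF 1 step_joint_strict[OF assms]]
  show ?thesis by (simp add: dT_def[abs_def])
qed

lemma dom_step_open:
  assumes c: "c \<in> A" "y \<in> cimg c" and d: "d \<in> A" "dom_step c d \<alpha> y"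
  obtains r where "r > 0" "\<And>z. z \<in> ball (y, \<alpha>) r \<Longrightarrow> fst z \<in> cimg c \<and> dom_step c d (snd z) (fst z)"
proof -
  have "isCont (\<lambda>z. (fst z, (- snd z) *\<^sub>R gradc c (fst z))) (y, \<alpha>)" by (rule has_strict_derivative_isCont[OF curve_strict[OF c]])
  then have "((\<lambda>z. (fst z, (- snd z) *\<^sub>R gradc c (fst z))) \<longlongrightarrow> (y, (- \<alpha>) *\<^sub>R gradc c y)) (at (y, \<alpha>))" by (simp add: isCont_def)
  then have "eventually (\<lambda>z. (fst z, (- snd z) *\<^sub>R gradc c (fst z)) \<in> W c d) (at (y, \<alpha>))"
    using W_open[OF c(1) d(1)] d(2) unfolding dom_step_def by (rule topological_tendstoD)
  then obtain r where r: "r > 0" "\<And>z. z \<noteq> (y, \<alpha>) \<Longrightarrow> dist z (y, \<alpha>) < r \<Longrightarrow> (fst z, (- snd z) *\<^sub>R gradc c (fst z)) \<in> W c d"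
    unfolding eventually_at by blast
  have "(fst z, (- snd z) *\<^sub>R gradc c (fst z)) \<in> W c d" if "z \<in> ball (y, \<alpha>) r" for z
    using r(2)[of z] that d(2) by (cases "z = (y, \<alpha>)") (auto simp: dom_step_def dist_commute)
  then show thesis using that[of r] r(1) unfolding dom_step_def W_def by auto
qed

lemma DPhi_change:
  assumes c: "c \<in> A" and d: "d \<in> A" "z \<in> W c d" and e: "e \<in> A" "z \<in> W c e"
  shows "DPhi c e z h = transition_deriv d e (Rh c z) (DPhi c d z h)"
proof -
  have x: "Rh c z \<in> cdom d" "Rh c z \<in> cdom e" using d e by (auto simp: W_def)
  have "has_strict_derivative (cmap e \<circ> cinv d) (transition_deriv d e (Rh c z)) (Phi c d z)"
    using transition_strict[OF d(1) e(1) x] by (simp add: Phi_def)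
  from has_strict_derivative_compose[OF Phi_strict[OF c d] this]
  have "has_strict_derivative (Phi c e) (\<lambda>h. transition_deriv d e (Rh c z) (DPhi c d z h)) z"
  proof (rule has_strict_derivative_transform)
    show "open (W c d \<inter> W c e)" by (intro open_Int W_open c d(1) e(1))
    show "Phi c e z' = (cmap e \<circ> cinv d) (Phi c d z')" if "z' \<in> W c d \<inter> W c e" for z'
      using that d(1) by (simp add: Phi_def W_def cinv_cmap)
  qed (use d e in auto)
  from fun_cong[OF has_strict_derivative_unique[OF this Phi_strict[OF c e]], of h] show ?thesis by simp
qed

lemma nonsing_iff:
  assumes c: "c \<in> A" and d: "d \<in> A" "dom_step c d \<alpha> y"
  shows "nonsing c y \<alpha> \<longleftrightarrow> inj (dT c d \<alpha> y)"
proof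
  assume "nonsing c y \<alpha>"
  then obtain e where e: "e \<in> A" "dom_step c e \<alpha> y" "inj (dT c e \<alpha> y)" by (auto simp: nonsing_def)
  let ?z = "(y, (- \<alpha>) *\<^sub>R gradc c y)"
  have "dT c e \<alpha> y = transition_deriv d e (Rh c ?z) \<circ> dT c d \<alpha> y"
    using DPhi_change[OF c d[unfolded dom_step_def] e(1,2)[unfolded dom_step_def]] by (simp add: dT_def fun_eq_iff)
  then show "inj (dT c d \<alpha> y)" using e(3) inj_on_imageI2 by (metis)
qed (use d in \<open>auto simp: nonsing_def\<close>)

lemma nonsing_zero:
  assumes c: "c \<in> A" and y: "y \<in> cimg c"
  shows "nonsing c y 0"
  unfolding nonsing_def
  by (rule bexI[OF _ c]) (use zero_in_W[OF c y] in \<open>auto simp: dom_step_def dT_def DPhi_zero[OF c y] inj_on_def\<close>)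

text \<open>Provides the joint measurability behind Fubini. A lower Lipschitz bound near a
  nonsingular pair excludes kernel vectors of the derivative at all neighbouring pairs.\<close>

lemma nonsing_open:
  assumes c: "c \<in> A"
  shows "open {z. fst z \<in> cimg c \<and> nonsing c (fst z) (snd z)}"
  unfolding open_contains_ball
proof
  fix z0 assume z0: "z0 \<in> {z. fst z \<in> cimg c \<and> nonsing c (fst z) (snd z)}"
  obtain y \<alpha> where z0_eq: "z0 = (y, \<alpha>)" by (cases z0)
  have y: "y \<in> cimg c" and "nonsing c y \<alpha>" using z0 z0_eq by auto
  then obtain d where d: "d \<in> A" "dom_step c d \<alpha> y" "inj (dT c d \<alpha> y)" by (auto simp: nonsing_def)
  obtain r where r: "r > 0" "\<And>z. z \<in> ball (y, \<alpha>) r \<Longrightarrow> fst z \<in> cimg c \<and> dom_step c d (snd z) (fst z)"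
    using dom_step_open[OF c y d(1,2)] by metis
  let ?D = "\<lambda>h. DPhi c d (y, (- \<alpha>) *\<^sub>R gradc c y) (fst h, (- \<alpha>) *\<^sub>R dG c y (fst h) + (- snd h) *\<^sub>R gradc c y)"
  \<comment> \<open>Recording the step size as a second component makes the joint derivative
    injective, so one lower bound covers nearby points and nearby step sizes.\<close>
  let ?F = "\<lambda>z. (Tm c d (snd z) (fst z), snd z)"
  have F: "has_strict_derivative ?F (\<lambda>h. (?D h, snd h)) (y, \<alpha>)"
    by (rule has_strict_derivative_Pair[OF step_joint_strict[OF c y d(1,2)] has_strict_derivative_linear[OF bounded_linear_snd]])
  have lin: "linear (\<lambda>h. (?D h, snd h))" using has_strict_derivative_bounded_linear[OF F] bounded_linear.linear by blast
  have injF: "inj (\<lambda>h. (?D h, snd h))" unfolding linear_injective_0[OF lin]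
  proof (intro allI impI)
    fix h :: "'a \<times> real" assume h: "(?D h, snd h) = 0"
    then have "snd h = 0" "dT c d \<alpha> y (fst h) = 0" by (auto simp: dT_def zero_prod_def)
    moreover have "linear (dT c d \<alpha> y)" using has_strict_derivative_bounded_linear[OF step_strict[OF c y d(1,2)]] bounded_linear.linear by blast
    ultimately show "h = 0" using d(3) by (simp add: linear_injective_0 prod_eq_iff)
  qed
  obtain k r' where k: "k > 0" "r' > 0" "\<And>z w. z \<in> ball (y, \<alpha>) r' \<Longrightarrow> w \<in> ball (y, \<alpha>) r' \<Longrightarrow> norm (?F z - ?F w) \<ge> k * norm (z - w)"
    by (rule has_strict_derivative_lower_bound[OF F injF]) blast
  show "\<exists>e>0. ball z0 e \<subseteq> {z. fst z \<in> cimg c \<and> nonsing c (fst z) (snd z)}"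
    unfolding z0_eq
  proof (intro exI[of _ "min r r'"] conjI subsetI)
    show "min r r' > 0" using r k by simp
    fix z assume z: "z \<in> ball (y, \<alpha>) (min r r')"
    obtain y1 \<beta> where zz: "z = (y1, \<beta>)" by (cases z)
    have z1: "y1 \<in> cimg c" "dom_step c d \<beta> y1" using r(2)[of z] z zz by auto
    note st = step_strict[OF c z1(1) d(1) z1(2)]
    have lin1: "linear (dT c d \<beta> y1)" using has_strict_derivative_bounded_linear[OF st] bounded_linear.linear by blast
    have "inj (dT c d \<beta> y1)" unfolding linear_injective_0[OF lin1]
    proof (intro allI impI)
      fix u assume u: "dT c d \<beta> y1 u = 0"
      show "u = 0"
      proof (rule ccontr)
        \<comment> \<open>Along a kernel vector the map would move by at most half of what the lower
          bound demands.\<close>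
        assume un: "u \<noteq> 0"
        obtain r2 where r2: "r2 > 0" "\<And>p q. p \<in> ball y1 r2 \<Longrightarrow> q \<in> ball y1 r2 \<Longrightarrow> norm (Tm c d \<beta> p - Tm c d \<beta> q - dT c d \<beta> y1 (p - q)) \<le> k/2 * norm (p - q)"
          using has_strict_derivativeD[OF st, of "k/2"] k(1) by (metis half_gt_zero)
        obtain r3 where r3: "r3 > 0" "ball z r3 \<subseteq> ball (y, \<alpha>) (min r r')" using z openE[OF open_ball] by blast
        define t where "t = min r2 r3 / (2 * norm u)"
        have t: "t > 0" "t * norm u < r2" "t * norm u < r3" using r2(1) r3(1) un by (auto simp: t_def min_def field_simps)
        let ?p = "y1 + t *\<^sub>R u"
        have "(?p, \<beta>) \<in> ball z r3" using t zz by (simp add: dist_Pair_Pair dist_norm)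
        then have pb: "(?p, \<beta>) \<in> ball (y, \<alpha>) r'" using r3(2) by auto
        have zb: "(y1, \<beta>) \<in> ball (y, \<alpha>) r'" using z zz by auto
        have "k * norm (t *\<^sub>R u) \<le> norm (Tm c d \<beta> ?p - Tm c d \<beta> y1)" using k(3)[OF pb zb] by (simp add: norm_Pair)
        also have "\<dots> \<le> k/2 * norm (t *\<^sub>R u)"
          using r2(2)[of ?p y1] t r2(1) u lin1 by (simp add: dist_norm linear_cmul)
        finally show False using k(1) t(1) un by simp
      qed
    qed
    then show "z \<in> {z. fst z \<in> cimg c \<and> nonsing c (fst z) (snd z)}" using z1 d(1) zz by (auto simp: nonsing_def)
  qed
qed

lemma nonsing_local:
  assumes c: "c \<in> A" "y \<in> cimg c" and ns: "nonsing c y \<alpha>"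
  obtains d k r where "d \<in> A" "k > 0" "r > 0" "ball y r \<subseteq> cimg c" "\<And>p. p \<in> ball y r \<Longrightarrow> dom_step c d \<alpha> p"
    "\<And>p q. p \<in> ball y r \<Longrightarrow> q \<in> ball y r \<Longrightarrow> norm (Tm c d \<alpha> p - Tm c d \<alpha> q) \<ge> k * norm (p - q)"
proof -
  obtain d where d: "d \<in> A" "dom_step c d \<alpha> y" "inj (dT c d \<alpha> y)" using ns by (auto simp: nonsing_def)
  obtain r1 where r1: "r1 > 0" "\<And>z. z \<in> ball (y, \<alpha>) r1 \<Longrightarrow> fst z \<in> cimg c \<and> dom_step c d (snd z) (fst z)"
    using dom_step_open[OF c d(1,2)] by metis
  obtain k r2 where k: "k > 0" "r2 > 0" "\<And>p q. p \<in> ball y r2 \<Longrightarrow> q \<in> ball y r2 \<Longrightarrow> norm (Tm c d \<alpha> p - Tm c d \<alpha> q) \<ge> k * norm (p - q)"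
    using has_strict_derivative_lower_bound[OF step_strict[OF c d(1,2)] d(3)] by metis
  have in1: "p \<in> cimg c \<and> dom_step c d \<alpha> p" if "p \<in> ball y (min r1 r2)" for p
    using r1(2)[of "(p, \<alpha>)"] that by (simp add: dist_Pair_Pair)
  show thesis
    by (rule that[of d k "min r1 r2"]) (use d(1) k r1(1) in1 in auto)
qed

text \<open>Near nonsingular points the step has a lower Lipschitz bound and maps the preimage into
  a null set, so the preimage is locally null, and locally null sets are null. Singular points are
  null by assumption.\<close>

lemma null_in_step_preimage:
  assumes A': "A' \<subseteq> A" "countable A'" "(\<Union>c\<in>A'. cdom c) = UNIV"
    and good: "\<And>c. c \<in> A' \<Longrightarrow> negligible {y \<in> cimg c. \<not> nonsing c y \<alpha>}"
    and N: "null_in N"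
  shows "null_in {x. step \<alpha> x \<in> N}"
proof (rule null_in_subatlas[OF A'])
  fix c assume c': "c \<in> A'"
  then have c: "c \<in> A" using A' by blast
  let ?S = "{y \<in> cimg c. nonsing c y \<alpha> \<and> step \<alpha> (cinv c y) \<in> N}"
  have "negligible ?S"
  proof (subst locally_negligible_alt, intro ballI)
    fix y assume y: "y \<in> ?S"
    then have yc: "y \<in> cimg c" and ns: "nonsing c y \<alpha>" by auto
    obtain d k r where dkr: "d \<in> A" "k > 0" "r > 0" "ball y r \<subseteq> cimg c" "\<And>p. p \<in> ball y r \<Longrightarrow> dom_step c d \<alpha> p"
      "\<And>p q. p \<in> ball y r \<Longrightarrow> q \<in> ball y r \<Longrightarrow> norm (Tm c d \<alpha> p - Tm c d \<alpha> q) \<ge> k * norm (p - q)"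
      using nonsing_local[OF c yc ns] by metis
    have "negligible (?S \<inter> ball y r)"
    proof (rule negligible_lower_lipschitz[OF dkr(2)])
      show "negligible (Tm c d \<alpha> ` (?S \<inter> ball y r))"
      proof (rule negligible_subset)
        show "negligible (cmap d ` (N \<inter> cdom d))" using N dkr(1) by (simp add: null_in_def)
        show "Tm c d \<alpha> ` (?S \<inter> ball y r) \<subseteq> cmap d ` (N \<inter> cdom d)"
        proof
          fix w assume "w \<in> Tm c d \<alpha> ` (?S \<inter> ball y r)"
          then obtain p where p: "p \<in> cimg c" "step \<alpha> (cinv c p) \<in> N" "p \<in> ball y r" "w = Tm c d \<alpha> p" by blast
          have "step \<alpha> (cinv c p) \<in> cdom d" using dkr(5)[OF p(3)] dom_step_iff[OF c p(1)] by simp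
          then show "w \<in> cmap d ` (N \<inter> cdom d)" using p Tm_eq[OF c p(1)] by blast
        qed
      qed
    qed (use dkr(6) in auto)
    moreover have "openin (top_of_set ?S) (?S \<inter> ball y r)" by (simp add: openin_open_Int)
    ultimately show "\<exists>U. openin (top_of_set ?S) U \<and> y \<in> U \<and> negligible U" using y dkr(3) by (intro exI[of _ "?S \<inter> ball y r"]) auto
  qed
  then have "negligible (?S \<union> {y \<in> cimg c. \<not> nonsing c y \<alpha>})" using good[OF c'] by (rule negligible_Un)
  moreover have "cmap c ` ({x. step \<alpha> x \<in> N} \<inter> cdom c) \<subseteq> ?S \<union> {y \<in> cimg c. \<not> nonsing c y \<alpha>}"
    by (auto simp: cinv_cmap[OF c])
  ultimately show "negligible (cmap c ` ({x. step \<alpha> x \<in> N} \<inter> cdom c))" by (rule negligible_subset)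
qed

end

section \<open>Regularity of almost every step size\<close>

lemma fast_interpolation_mono:
  assumes "fast_interpolation C \<phi>" "C \<le> C'"
  shows "fast_interpolation C' \<phi>"
proof -
  have "C * (1/72) ^ (2 * N) \<le> C' * (1/72) ^ (2 * N)" for N :: nat
    using assms(2) by (intro mult_right_mono) auto
  then show ?thesis using assms(1) unfolding fast_interpolation_def by (blast intro: order_trans)
qed

text \<open>The base component is approached inside \<open>K\<close>, while the fibre component is
  hit exactly because the second factor is a full ball.\<close>

lemma approachable_Times_ball:
  fixes x :: "'a::euclidean_space" and p :: "'b::euclidean_space"
  assumes "approachable K x" "\<sigma> > 0"
  shows "approachable (K \<times> ball p \<sigma>) (x, p)"
proof -
  obtain h0 where h0: "h0 > 0" "\<And>h u. 0 < h \<Longrightarrow> h < h0 \<Longrightarrow> norm u \<le> 1 \<Longrightarrow> \<exists>y\<in>K. dist y (x + h *\<^sub>R u) \<le> h / 2"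
    using assms(1) unfolding approachable_def by blast
  show ?thesis unfolding approachable_def
  proof (intro exI[of _ "min h0 \<sigma>"] conjI allI impI)
    show "min h0 \<sigma> > 0" using h0 assms by simp
    fix h and u :: "'a \<times> 'b" assume h: "0 < h \<and> h < min h0 \<sigma>" and u: "norm u \<le> 1"
    have u12: "norm (fst u) \<le> 1" "norm (snd u) \<le> 1" using norm_fst_le_norm[of u] norm_snd_le_norm[of u] u by linarith+
    obtain y where y: "y \<in> K" "dist y (x + h *\<^sub>R fst u) \<le> h / 2" using h0(2)[of h "fst u"] h u12 by auto
    have "h * norm (snd u) \<le> h * 1" using h u12 by (intro mult_left_mono) auto
    moreover have "norm (h *\<^sub>R snd u) = h * norm (snd u)" using h by simp
    ultimately have "norm (h *\<^sub>R snd u) < \<sigma>" using h by linarith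
    then have "(y, p + h *\<^sub>R snd u) \<in> K \<times> ball p \<sigma>" using y h by (simp add: dist_norm)
    moreover have "dist (y, p + h *\<^sub>R snd u) ((x, p) + h *\<^sub>R u) \<le> h / 2"
      using y by (cases u) (simp add: dist_Pair_Pair)
    ultimately show "\<exists>z\<in>K \<times> ball p \<sigma>. dist z ((x, p) + h *\<^sub>R u) \<le> h / 2" by blast
  qed
qed

context riemannian_retraction
begin

text \<open>The points over which the fibres of the retraction are analytic around \<open>v0\<close> with a uniform bound,
  expressed without derivatives so that no further regularity in \<open>y\<close> is involved.\<close>

definition Kset :: "('m, 'a) chart \<Rightarrow> ('m, 'a) chart \<Rightarrow> 'a \<Rightarrow> nat \<Rightarrow> 'a set" where
  "Kset c d v0 m = {y \<in> cimg c. (\<forall>v\<in>ball v0 (1 / Suc m). (y, v) \<in> W c d) \<and>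
     (\<forall>b\<in>Basis. \<forall>p w. (\<forall>s. \<bar>s\<bar> \<le> 1 \<longrightarrow> p + s *\<^sub>R w \<in> ball v0 (1 / Suc m)) \<longrightarrow>
        fast_interpolation (real m) (\<lambda>s. inner (Phi c d (y, p + s *\<^sub>R w)) b))}"

text \<open>Centre \<open>v0\<close>, chart, radius and bound come from countable sets, so countably
  many \<open>Kset\<close>s exhaust all pairs (base point, fibre vector). Raising \<open>m\<close>
  shrinks the ball and weakens the bound together.\<close>

lemma Kset_cover:
  assumes c: "c \<in> A" "y \<in> cimg c" and A': "A' \<subseteq> A" "(\<Union>c\<in>A'. cdom c) = UNIV"
    and D: "\<And>X. open X \<Longrightarrow> X \<noteq> {} \<Longrightarrow> \<exists>v\<in>D. v \<in> X"
  obtains d v0 m where "d \<in> A'" "v0 \<in> D" "v \<in> ball v0 (1 / Suc m)" "y \<in> Kset c d v0 m"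
proof -
  let ?x = "cinv c y"
  define F where "F a = Rh c (y, a)" for a
  have x: "?x \<in> cdom c" by (rule cinv_dom[OF c])
  have "map_into real_analytic_on A UNIV (\<lambda>a. R ?x (coord_vec A c ?x a))"
    using fiber c x unfolding fiberwise_real_analytic_def charts_at_def by blast
  then have F: "map_into real_analytic_on A UNIV F" by (simp add: F_def[abs_def] Rh_def)
  obtain d where d: "d \<in> A'" "F v \<in> cdom d" using A'(2) by blast
  have dA: "d \<in> A" using d A' by blast
  have an: "real_analytic_on (UNIV \<inter> F -` cdom d) (cmap d \<circ> F)" using F dA by (simp add: map_into_def)
  have opn: "open (UNIV \<inter> F -` cdom d)"
    using F open_dom[OF dA] unfolding map_into_def by (intro continuous_open_preimage) auto
  have vin: "v \<in> UNIV \<inter> F -` cdom d" using d by simp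
  obtain \<eta> C where \<eta>: "\<eta> > 0" "C \<ge> 0"
    "\<And>p w b. b \<in> Basis \<Longrightarrow> (\<And>s. \<bar>s\<bar> \<le> 1 \<Longrightarrow> p + s *\<^sub>R w \<in> ball v \<eta>) \<Longrightarrow> fast_interpolation C (\<lambda>s. inner ((cmap d \<circ> F) (p + s *\<^sub>R w)) b)"
    by (rule real_analytic_on_fast_interpolation[OF an vin]) blast
  obtain \<eta>' where \<eta>': "\<eta>' > 0" "ball v \<eta>' \<subseteq> UNIV \<inter> F -` cdom d" using openE[OF opn vin] by blast
  obtain n :: nat where n: "C < real n" using reals_Archimedean2 by blast
  \<comment> \<open>Half of the radius, because the ball is recentred at a point \<open>v0\<close>
    up to \<open>1 / Suc m\<close> away from \<open>v\<close>.\<close>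
  obtain k :: nat where k: "1 / Suc k < min \<eta> \<eta>' / 2" using nat_approx_posE[of "min \<eta> \<eta>' / 2"] \<eta>(1) \<eta>'(1) by auto
  define m where "m = max n k"
  have "1 / real (Suc m) \<le> 1 / real (Suc k)" by (simp add: m_def frac_le)
  then have m1: "1 / Suc m < min \<eta> \<eta>' / 2" using k by linarith
  have m2: "C \<le> real m" using n by (simp add: m_def)
  have "ball v (1 / Suc m) \<noteq> {}" by simp
  then obtain v0 where v0: "v0 \<in> D" "v0 \<in> ball v (1 / Suc m)" using D[of "ball v (1 / Suc m)"] by auto
  have sub: "z \<in> ball v (min \<eta> \<eta>')" if "z \<in> ball v0 (1 / Suc m)" for z
    using dist_triangle[of v z v0] v0(2) m1 that by simp
  have Win: "(y, z) \<in> W c d" if "z \<in> ball v0 (1 / Suc m)" for z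
    using sub[OF that] \<eta>'(2) c by (auto simp: W_def F_def subset_iff)
  have "fast_interpolation (real m) (\<lambda>s. inner (Phi c d (y, p + s *\<^sub>R w)) b)"
    if "b \<in> Basis" "\<And>s. \<bar>s\<bar> \<le> 1 \<Longrightarrow> p + s *\<^sub>R w \<in> ball v0 (1 / Suc m)" for b p w
  proof -
    have "fast_interpolation C (\<lambda>s. inner ((cmap d \<circ> F) (p + s *\<^sub>R w)) b)"
      using sub that by (intro \<eta>(3)) auto
    from fast_interpolation_mono[OF this m2] show ?thesis by (simp add: Phi_def F_def)
  qed
  then have "y \<in> Kset c d v0 m" using Win c(2) unfolding Kset_def by blast
  then show thesis using that[OF d(1) v0(1)] v0(2) by (simp add: dist_commute)
qed

text \<open>As the step size runs through \<alpha> + r s, the fibre vector runs along a segment on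
  which the derivative of the retraction extends holomorphically in \<open>s\<close>. The derivative
  of the step is built from it with factors affine in \<open>s\<close>, so its determinant extends
  as well.\<close>

lemma local_germ:
  assumes c: "c \<in> A" and d: "d \<in> A" and y: "y \<in> Kset c d v0 m" and app: "approachable (Kset c d v0 m) y"
    and p0: "(- \<alpha>) *\<^sub>R gradc c y \<in> ball v0 (1 / Suc m)"
  shows "\<exists>r>0. \<exists>\<psi>. \<psi> holomorphic_on ball 0 1 \<and>
    (\<forall>s. \<bar>s\<bar> < 1 \<longrightarrow> (\<psi> (complex_of_real s) = 0 \<longleftrightarrow> \<alpha> + r * s \<in> {\<beta>. \<not> nonsing c y \<beta>}))"
proof -
  define G where "G = gradc c y"
  define p where "p = (- \<alpha>) *\<^sub>R G"
  have yc: "y \<in> cimg c" using y by (simp add: Kset_def)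
  have pin: "p \<in> ball v0 (1 / Suc m)" using p0 by (simp add: p_def G_def)
  then obtain \<rho> where \<rho>: "\<rho> > 0" "ball p \<rho> \<subseteq> ball v0 (1 / Suc m)" using openE[OF open_ball] by blast
  have zW: "(y, p) \<in> W c d" using y pin by (simp add: Kset_def)
  have C2: "Ck_on 2 (W c d) (Phi c d)" using Phi_smooth[OF c d] unfolding smooth_on_def by blast
  obtain d1 M where d1: "d1 > 0" "M > 0" "ball (y, p) d1 \<subseteq> W c d"
    "\<And>z z'. z \<in> ball (y, p) d1 \<Longrightarrow> z' \<in> ball (y, p) d1 \<Longrightarrow>
       norm (Phi c d z' - Phi c d z - frechet_derivative (Phi c d) (at z) (z' - z)) \<le> M * (norm (z' - z))\<^sup>2"
    by (rule Ck_on_2_quadratic_remainder[OF C2 W_open[OF c d] zW]) blast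
  define \<sigma> where "\<sigma> = min \<rho> d1 / 2"
  have \<sigma>: "\<sigma> > 0" "2 * \<sigma> \<le> \<rho>" "2 * \<sigma> \<le> d1" using \<rho>(1) d1(1) by (auto simp: \<sigma>_def)
  \<comment> \<open>Makes the displacement \<open>s *\<^sub>R w\<close> shorter than \<sigma> for
    |s| \<le> 1; the summand 1 covers a vanishing gradient.\<close>
  define r where "r = \<sigma> / (2 * (norm G + 1))"
  have G1: "norm G + 1 > 0" by (simp add: add_nonneg_pos)
  have r: "r > 0" using \<sigma> G1 by (simp add: r_def)
  have "r * norm G \<le> r * (norm G + 1)" using r by (intro mult_left_mono) auto
  also have "\<dots> = \<sigma> / 2" using G1 unfolding r_def by (simp only: times_divide_eq_left) (simp add: divide_simps)
  finally have rG: "r * norm G < \<sigma>" using \<sigma> by simp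
  define w where "w = r *\<^sub>R (- G)"
  have wn: "norm (s *\<^sub>R w) < \<sigma>" if "\<bar>s\<bar> \<le> 1" for s
  proof -
    have "\<bar>s\<bar> * (r * norm G) \<le> 1 * (r * norm G)" using that r by (intro mult_right_mono) auto
    moreover have "norm (s *\<^sub>R w) = \<bar>s\<bar> * (r * norm G)" using r by (simp add: w_def abs_mult)
    ultimately show ?thesis using rG by linarith
  qed
  define z0 where "z0 = (y, p)"
  define \<zeta> where "\<zeta> s = (y, p + s *\<^sub>R w)" for s
  have \<zeta>b: "\<zeta> s \<in> ball (y, p) d1" if "\<bar>s\<bar> \<le> 1" for s
    using wn[OF that] \<sigma> by (simp add: \<zeta>_def dist_Pair_Pair dist_norm)
  have \<zeta>W: "\<zeta> s \<in> W c d" if "\<bar>s\<bar> \<le> 1" for s using \<zeta>b[OF that] d1(3) by blast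
  \<comment> \<open>The parameter \<open>s\<close> translates the fibre component, while
    \<open>z\<close> varies over base and fibre. So \<open>F'\<close> is the full derivative of
    \<open>Phi\<close> at the moving point \<open>\<zeta> s\<close>.\<close>
  define F where "F b z s = inner (Phi c d (fst z, snd z + s *\<^sub>R w)) b" for b z s
  define F' where "F' b s h = inner (DPhi c d (\<zeta> s) h) b" for b s h
  let ?K = "Kset c d v0 m \<times> ball p \<sigma>"
  have ext: "\<exists>\<Psi>. \<Psi> holomorphic_on ball 0 1 \<and> (\<forall>s. \<bar>s\<bar> < 1 \<longrightarrow> \<Psi> (complex_of_real s) = of_real (F' b s h))"
    if b: "b \<in> Basis" for b h
  proof -
    have linF: "linear (F' b s)" if "\<bar>s\<bar> \<le> 1" for s
      unfolding F'_def[abs_def]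
      using linear_compose[OF DPhi_linear[OF c d \<zeta>W[OF that]] bounded_linear.linear[OF bounded_linear_inner_left[of b]]] by (simp add: o_def)
    have rem: "\<bar>F b z s - F b z0 s - F' b s (z - z0)\<bar> \<le> M * (norm (z - z0))\<^sup>2" if s: "\<bar>s\<bar> \<le> 1" and z: "z \<in> ball z0 \<sigma>" for s z
    proof -
      let ?z' = "(fst z, snd z + s *\<^sub>R w)"
      have diff: "?z' - \<zeta> s = z - z0" by (simp add: \<zeta>_def z0_def prod_eq_iff)
      have e: "?z' - (y, p) = (z - z0) + (0, s *\<^sub>R w)" by (simp add: z0_def prod_eq_iff)
      have "norm (?z' - (y, p)) \<le> norm (z - z0) + norm (0::'a, s *\<^sub>R w)" unfolding e by (rule norm_triangle_ineq)
      also have "\<dots> < \<sigma> + \<sigma>" using z wn[OF s] by (intro add_strict_mono) (auto simp: dist_norm norm_minus_commute norm_Pair)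
      finally have "norm (?z' - (y, p)) < d1" using \<sigma> by linarith
      then have "?z' \<in> ball (y, p) d1" by (metis dist_commute dist_norm mem_ball)
      from d1(4)[OF \<zeta>b[OF s] this]
      have n: "norm (Phi c d ?z' - Phi c d (\<zeta> s) - DPhi c d (\<zeta> s) (z - z0)) \<le> M * (norm (z - z0))\<^sup>2"
        by (simp only: diff DPhi_def)
      have "F b z s - F b z0 s - F' b s (z - z0) = inner (Phi c d ?z' - Phi c d (\<zeta> s) - DPhi c d (\<zeta> s) (z - z0)) b"
        by (simp add: F_def F'_def z0_def \<zeta>_def inner_diff_left)
      also have "\<bar>\<dots>\<bar> \<le> norm (Phi c d ?z' - Phi c d (\<zeta> s) - DPhi c d (\<zeta> s) (z - z0))" using b by (rule Basis_le_norm)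
      finally show ?thesis using n by linarith
    qed
    have appK: "approachable ?K z0" unfolding z0_def by (rule approachable_Times_ball[OF app \<sigma>(1)])
    have memK: "z0 \<in> ?K" using y \<sigma> by (simp add: z0_def)
    have fast: "fast_interpolation (real m) (F b z)" if "z \<in> ?K" for z
    proof -
      have zz: "fst z \<in> Kset c d v0 m" "snd z \<in> ball p \<sigma>" using that by auto
      have "snd z + s *\<^sub>R w \<in> ball v0 (1 / Suc m)" if "\<bar>s\<bar> \<le> 1" for s
      proof -
        have "dist p (snd z + s *\<^sub>R w) \<le> dist p (snd z) + norm (s *\<^sub>R w)"
          using dist_triangle[of p "snd z + s *\<^sub>R w" "snd z"] by (simp add: dist_norm)
        also have "\<dots> < \<rho>" using zz(2) wn[OF that] \<sigma> by simp
        finally show ?thesis using \<rho>(2) by auto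
      qed
      then show ?thesis using zz(1) b unfolding Kset_def F_def[abs_def] by blast
    qed
    have "M \<ge> 0" using d1(2) by simp
    show ?thesis
      by (rule derivative_holomorphic_extension[where u = h, OF linF rem \<sigma>(1) \<open>M \<ge> 0\<close> of_nat_0_le_iff memK appK fast],
          assumption+, rule exI, rule conjI, assumption, simp)
  qed
  have \<zeta>eq: "\<zeta> s = (y, (- (\<alpha> + r * s)) *\<^sub>R gradc c y)" for s
    by (simp add: \<zeta>_def p_def w_def G_def scaleR_left_distrib scaleR_left_diff_distrib mult.commute)
  \<comment> \<open>The step size enters twice, through the point \<open>\<zeta> s\<close> and
    through the coefficient of \<open>dG c y u\<close>; by linearity the coefficient is pulled out
    as a factor affine in \<open>s\<close>.\<close>
  have dTe: "inner (dT c d (\<alpha> + r * s) y u) b = F' b s (u, 0) + (- (\<alpha> + r * s)) * F' b s (0, dG c y u)" if "\<bar>s\<bar> < 1" for s u b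
  proof -
    have "\<bar>s\<bar> \<le> 1" using that by simp
    note lin = DPhi_linear[OF c d \<zeta>W[OF this]]
    have "(u, (- (\<alpha> + r * s)) *\<^sub>R dG c y u) = (u, 0) + (- (\<alpha> + r * s)) *\<^sub>R (0, dG c y u)" by simp
    then have "dT c d (\<alpha> + r * s) y u = DPhi c d (\<zeta> s) (u, 0) + (- (\<alpha> + r * s)) *\<^sub>R DPhi c d (\<zeta> s) (0, dG c y u)"
      unfolding dT_def \<zeta>eq[symmetric] by (simp only: linear_add[OF lin] linear_cmul[OF lin])
    then show ?thesis by (simp only: F'_def inner_add_left inner_scaleR_left)
  qed
  have dom: "dom_step c d (\<alpha> + r * s) y" if "\<bar>s\<bar> < 1" for s
    using \<zeta>W[of s] that by (simp add: dom_step_def \<zeta>eq)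
  obtain \<psi> where \<psi>: "\<psi> holomorphic_on ball 0 1" "\<And>s. \<bar>s\<bar> < 1 \<Longrightarrow> \<psi> (complex_of_real s) = 0 \<longleftrightarrow> \<not> inj (dT c d (\<alpha> + r * s) y)"
  proof (rule singular_holomorphic_condition[of "\<lambda>s. dT c d (\<alpha> + r * s) y"])
    fix s :: real assume "\<bar>s\<bar> < 1"
    then show "linear (dT c d (\<alpha> + r * s) y)"
      using has_strict_derivative_bounded_linear[OF step_strict[OF c yc d dom]] bounded_linear.linear by blast
  next
    fix u b :: 'a assume b: "b \<in> Basis"
    obtain \<Psi>1 where 1: "\<Psi>1 holomorphic_on ball 0 1" "\<And>s. \<bar>s\<bar> < 1 \<Longrightarrow> \<Psi>1 (complex_of_real s) = of_real (F' b s (u, 0))"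
      using ext[OF b] by blast
    obtain \<Psi>2 where 2: "\<Psi>2 holomorphic_on ball 0 1" "\<And>s. \<bar>s\<bar> < 1 \<Longrightarrow> \<Psi>2 (complex_of_real s) = of_real (F' b s (0, dG c y u))"
      using ext[OF b] by blast
    show "\<exists>\<Psi>. \<Psi> holomorphic_on ball 0 1 \<and> (\<forall>s. \<bar>s\<bar> < 1 \<longrightarrow> \<Psi> (complex_of_real s) = of_real (inner (dT c d (\<alpha> + r * s) y u) b))"
    proof (intro exI[of _ "\<lambda>z. \<Psi>1 z + (- (of_real \<alpha> + of_real r * z)) * \<Psi>2 z"] conjI allI impI)
      show "(\<lambda>z. \<Psi>1 z + (- (of_real \<alpha> + of_real r * z)) * \<Psi>2 z) holomorphic_on ball 0 1"
        by (intro holomorphic_intros 1 2)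
      fix s :: real assume s: "\<bar>s\<bar> < 1"
      show "\<Psi>1 (complex_of_real s) + (- (of_real \<alpha> + of_real r * complex_of_real s)) * \<Psi>2 (complex_of_real s) = of_real (inner (dT c d (\<alpha> + r * s) y u) b)"
        unfolding 1(2)[OF s] 2(2)[OF s] dTe[OF s] by simp
    qed
  qed blast
  show ?thesis
    by (intro exI[of _ r] conjI r exI[of _ \<psi>] \<psi>(1) allI impI) (use \<psi>(2) nonsing_iff[OF c d dom] in simp)
qed

text \<open>The exceptional points are those not approachable from one of the countably many
  \<open>Kset\<close>s containing them. At any other point every step size has an analytic germ, and
  step size 0 is nonsingular, so the singular step sizes are countable.\<close>

lemma negligible_uncountably_singular:
  assumes c: "c \<in> A"
  shows "negligible {y \<in> cimg c. \<not> countable {\<alpha>. \<not> nonsing c y \<alpha>}}"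
proof -
  obtain A' where A': "A' \<subseteq> A" "countable A'" "(\<Union>c\<in>A'. cdom c) = UNIV" by (rule countable_subatlas)
  obtain D :: "'a set" where D: "countable D" "\<And>X. open X \<Longrightarrow> X \<noteq> {} \<Longrightarrow> \<exists>v\<in>D. v \<in> X"
    using countable_dense_exists by metis
  define N where "N = (\<Union>i\<in>A' \<times> D \<times> UNIV. {y \<in> Kset c (fst i) (fst (snd i)) (snd (snd i)). \<not> approachable (Kset c (fst i) (fst (snd i)) (snd (snd i))) y})"
  have "negligible N" unfolding N_def
    by (intro negligible_countable_Union) (use A' D in \<open>auto intro!: negligible_not_approachable\<close>)
  moreover have "{y \<in> cimg c. \<not> countable {\<alpha>. \<not> nonsing c y \<alpha>}} \<subseteq> N"
  proof (rule subsetI, rule ccontr)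
    fix y assume y: "y \<in> {y \<in> cimg c. \<not> countable {\<alpha>. \<not> nonsing c y \<alpha>}}" and yN: "y \<notin> N"
    have yc: "y \<in> cimg c" using y by simp
    have "countable {\<alpha>. \<not> nonsing c y \<alpha>}"
    proof (rule countable_zero_set_of_analytic_germs[where \<beta> = 0])
      show "0 \<notin> {\<alpha>. \<not> nonsing c y \<alpha>}" using nonsing_zero[OF c yc] by simp
      fix \<alpha>
      obtain d v0 m where K: "d \<in> A'" "v0 \<in> D" "(- \<alpha>) *\<^sub>R gradc c y \<in> ball v0 (1 / Suc m)" "y \<in> Kset c d v0 m"
        by (rule Kset_cover[OF c yc A'(1,3) D(2), of "(- \<alpha>) *\<^sub>R gradc c y"])
      have "approachable (Kset c d v0 m) y"
      proof (rule ccontr)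
        assume "\<not> approachable (Kset c d v0 m) y"
        then have "y \<in> N" unfolding N_def using K by (intro UN_I[of "(d, v0, m)"]) auto
        then show False using yN by simp
      qed
      moreover have "d \<in> A" using K A' by blast
      ultimately show "\<exists>r>0. \<exists>\<psi>. \<psi> holomorphic_on ball 0 1 \<and>
        (\<forall>s. \<bar>s\<bar> < 1 \<longrightarrow> (\<psi> (complex_of_real s) = 0 \<longleftrightarrow> \<alpha> + r * s \<in> {\<alpha>. \<not> nonsing c y \<alpha>}))"
        using local_germ[OF c _ K(4) _ K(3)] by blast
    qed
    then show False using y by simp
  qed
  ultimately show ?thesis by (rule negligible_subset)
qed

text \<open>Fubini exchanges "for almost every point, almost every step size" with the reverse
  order.\<close>

lemma AE_negligible_singular:
  assumes c: "c \<in> A"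
  shows "AE \<alpha> in lborel. negligible {y \<in> cimg c. \<not> nonsing c y \<alpha>}"
proof -
  let ?P = "\<lambda>y \<alpha>. y \<in> cimg c \<longrightarrow> nonsing c y \<alpha>"
  have "open {z. fst z \<in> cimg c \<and> nonsing c (fst z) (snd z)}" by (rule nonsing_open[OF c])
  moreover have "open (cimg c \<times> (UNIV :: real set))" by (intro open_Times open_img c open_UNIV)
  ultimately have "- (cimg c \<times> UNIV) \<union> {z. fst z \<in> cimg c \<and> nonsing c (fst z) (snd z)} \<in> sets borel"
    by (intro sets.Un borel_comp borel_open)
  moreover have "- (cimg c \<times> UNIV) \<union> {z. fst z \<in> cimg c \<and> nonsing c (fst z) (snd z)} = {z. ?P (fst z) (snd z)}" by auto
  ultimately have B: "{z. ?P (fst z) (snd z)} \<in> sets borel" by simp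
  have sets_eq: "sets (lborel \<Otimes>\<^sub>M lborel :: ('a \<times> real) measure) = sets borel" by (simp only: lborel_prod sets_lborel)
  have space_eq: "space (lborel \<Otimes>\<^sub>M lborel :: ('a \<times> real) measure) = UNIV" by (simp add: space_pair_measure)
  have meas: "{z \<in> space (lborel \<Otimes>\<^sub>M lborel). ?P (fst z) (snd z)} \<in> sets (lborel \<Otimes>\<^sub>M lborel)"
    unfolding space_eq sets_eq using B by simp
  have "AE y in lborel. AE \<alpha> in lborel. ?P y \<alpha>"
  proof -
    have "negligible {y \<in> cimg c. \<not> countable {\<alpha>. \<not> nonsing c y \<alpha>}}" by (rule negligible_uncountably_singular[OF c])
    then have "AE y in lebesgue. y \<notin> {y \<in> cimg c. \<not> countable {\<alpha>. \<not> nonsing c y \<alpha>}}"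
      by (intro AE_not_in) (simp add: negligible_iff_null_sets)
    then have E: "AE y in lborel. y \<notin> {y \<in> cimg c. \<not> countable {\<alpha>. \<not> nonsing c y \<alpha>}}" by (simp add: AE_completion_iff)
    show ?thesis
    proof (rule AE_mp[OF E], rule AE_I2, rule impI)
      fix y assume y: "y \<notin> {y \<in> cimg c. \<not> countable {\<alpha>. \<not> nonsing c y \<alpha>}}"
      show "AE \<alpha> in lborel. ?P y \<alpha>"
      proof (cases "y \<in> cimg c")
        case True
        then have "countable {\<alpha>. \<not> nonsing c y \<alpha>}" using y by simp
        then have "{\<alpha>. \<not> nonsing c y \<alpha>} \<in> null_sets lborel" by (rule countable_imp_null_set_lborel)
        then have "AE \<alpha> in lborel. \<alpha> \<notin> {\<alpha>. \<not> nonsing c y \<alpha>}" by (rule AE_not_in)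
        then show ?thesis by (rule AE_mp) (auto intro!: AE_I2)
      qed simp
    qed
  qed
  then have E: "AE \<alpha> in lborel. AE y in lborel. ?P y \<alpha>"
    using lborel_pair.AE_commute[OF meas] by simp
  show ?thesis
  proof (rule AE_mp[OF E], rule AE_I2, rule impI)
    fix \<alpha> assume "AE y in lborel. ?P y \<alpha>"
    then obtain N where N: "{y \<in> space lborel. \<not> ?P y \<alpha>} \<subseteq> N" "N \<in> null_sets lborel"
      by (auto simp: eventually_ae_filter)
    have "negligible N" using N(2) by (simp add: negligible_iff_null_sets null_sets_completionI)
    moreover have "{y \<in> cimg c. \<not> nonsing c y \<alpha>} \<subseteq> N" using N(1) by auto
    ultimately show "negligible {y \<in> cimg c. \<not> nonsing c y \<alpha>}" by (rule negligible_subset)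
  qed
qed

end

section \<open>The step near a strict saddle\<close>

lemma while_scale_eq:
  fixes \<tau> \<alpha> :: real
  assumes "\<not> b (\<tau> ^ j * \<alpha>)" "\<And>i. i < j \<Longrightarrow> b (\<tau> ^ i * \<alpha>)"
  shows "while b (\<lambda>\<alpha>. \<tau> * \<alpha>) \<alpha> = \<tau> ^ j * \<alpha>"
  using assms
proof (induction j arbitrary: \<alpha>)
  case 0
  then show ?case by (subst while_unfold) simp
next
  case (Suc j)
  have "b \<alpha>" using Suc.prems(2)[of 0] by simp
  then have "while b (\<lambda>\<alpha>. \<tau> * \<alpha>) \<alpha> = while b (\<lambda>\<alpha>. \<tau> * \<alpha>) (\<tau> * \<alpha>)" by (subst while_unfold) simp
  also have "\<dots> = \<tau> ^ j * (\<tau> * \<alpha>)"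
  proof (rule Suc.IH)
    show "\<not> b (\<tau> ^ j * (\<tau> * \<alpha>))" using Suc.prems(1) by (simp add: mult_ac)
    show "b (\<tau> ^ i * (\<tau> * \<alpha>))" if "i < j" for i using Suc.prems(2)[of "Suc i"] that by (simp add: mult_ac)
  qed
  finally show ?case by (simp add: mult_ac)
qed

lemma negligible_scale_preimage:
  fixes N :: "real set"
  assumes "negligible N" "c \<noteq> 0"
  shows "negligible {x. c * x \<in> N}"
proof -
  have "negligible ((\<lambda>x. x / c) ` N)"
    by (rule negligible_differentiable_image_negligible[OF order_refl assms(1)])
       (intro bounded_linear_imp_differentiable_on bounded_linear_divide)
  moreover have "{x. c * x \<in> N} = (\<lambda>x. x / c) ` N" using assms(2) by (auto simp: image_iff field_simps intro!: bexI)
  ultimately show ?thesis by simp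
qed

context riemannian_retraction
begin

text \<open>The saddle is fixed by the step, so one chart serves as source and target. There the
  derivative is I - \<alpha> dG, self-adjoint for the metric at the saddle, and a negative
  eigenvalue \<mu> of dG gives the eigenvalue 1 - \<alpha> \<mu> > 1.\<close>

lemma saddle_stable_neighbourhood:
  assumes sad: "strict_saddle A g f x" and \<alpha>: "\<alpha> > 0"
  shows "\<exists>U. open U \<and> x \<in> U \<and> null_in {z. \<forall>n. (step \<alpha> ^^ n) z \<in> U}"
proof -
  obtain c where c: "c \<in> A" "x \<in> cdom c" using cover by blast
  define y where "y = cmap c x"
  have y: "y \<in> cimg c" using c by (simp add: y_def)
  have crit: "gradc c y = 0" and "\<exists>\<mu> e. \<mu> < 0 \<and> e \<noteq> 0 \<and> dG c y e = \<mu> *\<^sub>R e"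
    using saddle_eigenvector[OF sad c] by (auto simp: y_def)
  then obtain \<mu> e where e: "\<mu> < 0" "e \<noteq> 0" "dG c y e = \<mu> *\<^sub>R e" by blast
  have dom: "dom_step c c \<alpha> y" using zero_in_W[OF c(1) y] by (simp add: dom_step_def crit)
  have dTu: "dT c c \<alpha> y u = u - \<alpha> *\<^sub>R dG c y u" for u
    by (simp add: dT_def crit DPhi_zero[OF c(1) y])
  interpret B: inner_form "mc c y" by (rule inner_form_mc[OF c(1) y])
  have self: "mc c y (dT c c \<alpha> y u) v = mc c y u (dT c c \<alpha> y v)" for u v
    using dG_self_adjoint[OF c(1) y crit, of u v] by (simp add: dTu B.diff_left B.diff_right B.scale_left B.scale_right)
  have eig: "dT c c \<alpha> y e = (1 - \<alpha> * \<mu>) *\<^sub>R e" by (simp add: dTu e(3) scaleR_left_diff_distrib)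
  have big: "1 - \<alpha> * \<mu> > 1" using \<alpha> e(1) by (simp add: mult_pos_neg)
  obtain d where d: "d > 0" "negligible {p. \<forall>n. (Tm c c \<alpha> ^^ n) p \<in> ball y d}"
    by (rule B.negligible_local_stable_set[OF step_strict[OF c(1) y c(1) dom] self eig e(2) big]) blast
  obtain r where r: "r > 0" "\<And>z. z \<in> ball (y, \<alpha>) r \<Longrightarrow> fst z \<in> cimg c \<and> dom_step c c (snd z) (fst z)"
    using dom_step_open[OF c(1) y c(1) dom] by metis
  let ?B = "ball y (min d r)"
  have Bsub: "?B \<subseteq> cimg c"
  proof
    fix p assume "p \<in> ?B"
    then show "p \<in> cimg c" using r(2)[of "(p, \<alpha>)"] by (simp add: dist_Pair_Pair)
  qed
  define U where "U = cinv c ` ?B"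
  have U: "open U" unfolding U_def by (rule is_chart_open_cinv_image[OF chart[OF c(1)] open_ball Bsub])
  have "y \<in> ?B" using d r by simp
  then have xU: "x \<in> U" unfolding U_def using cinv_cmap[OF c] by (auto simp: y_def image_iff intro!: bexI[of _ "cmap c x"])
  let ?S = "{z. \<forall>n. (step \<alpha> ^^ n) z \<in> U}"
  have inU: "cmap c z \<in> ?B \<and> z = cinv c (cmap c z)" if "z \<in> U" for z
    using that Bsub by (auto simp: U_def cmap_cinv[OF c(1)] subset_iff)
  have "null_in ?S"
  proof (rule null_in_chart[OF c(1)])
    have "z \<in> cdom c" if "z \<in> U" for z using that Bsub unfolding U_def by (auto intro: cinv_dom[OF c(1)])
    moreover have "?S \<subseteq> U" by (auto dest: spec[of _ 0])
    ultimately show "?S \<subseteq> cdom c" by blast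
    show "negligible (cmap c ` ?S)"
    proof (rule negligible_subset[OF d(2)], rule image_subsetI)
      fix z assume z: "z \<in> ?S"
      have "(Tm c c \<alpha> ^^ n) (cmap c z) = cmap c ((step \<alpha> ^^ n) z)" for n
      proof (induction n)
        case (Suc n)
        have zn: "(step \<alpha> ^^ n) z \<in> U" using z by blast
        have "cmap c ((step \<alpha> ^^ n) z) \<in> cimg c" using inU[OF zn] Bsub by blast
        then have "Tm c c \<alpha> (cmap c ((step \<alpha> ^^ n) z)) = cmap c (step \<alpha> ((step \<alpha> ^^ n) z))"
          using Tm_eq[OF c(1)] inU[OF zn] by metis
        then show ?case by (simp add: Suc.IH)
      qed simp
      moreover have "cmap c ((step \<alpha> ^^ n) z) \<in> ball y d" for n
      proof -
        have "(step \<alpha> ^^ n) z \<in> U" using z by blast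
        then show ?thesis using inU by force
      qed
      ultimately show "cmap c z \<in> {p. \<forall>n. (Tm c c \<alpha> ^^ n) p \<in> ball y d}" by simp
    qed
  qed
  then show ?thesis using U xU by blast
qed

text \<open>There may be uncountably many saddles; Lindelof selects countably many of their
  neighbourhoods, and the tail of a convergent orbit stays in one of them.\<close>

lemma saddle_stable_null:
  assumes \<alpha>: "\<alpha> > 0"
  shows "\<exists>S. null_in S \<and> (\<forall>X x. strict_saddle A g f x \<and> (\<forall>n. X (Suc n) = step \<alpha> (X n)) \<and> X \<longlonglongrightarrow> x \<longrightarrow> (\<exists>n. X n \<in> S))"
proof -
  have "\<forall>x. \<exists>U. strict_saddle A g f x \<longrightarrow> open U \<and> x \<in> U \<and> null_in {z. \<forall>n. (step \<alpha> ^^ n) z \<in> U}"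
    using saddle_stable_neighbourhood[OF _ \<alpha>] by blast
  then obtain U where U: "\<And>x. strict_saddle A g f x \<Longrightarrow> open (U x) \<and> x \<in> U x \<and> null_in {z. \<forall>n. (step \<alpha> ^^ n) z \<in> U x}"
    by metis
  let ?F = "U ` {x. strict_saddle A g f x}"
  obtain F where F: "F \<subseteq> ?F" "countable F" "\<Union>F = \<Union>?F" using Lindelof[of ?F] U by blast
  define S where "S = (\<Union>V\<in>F. {z. \<forall>n. (step \<alpha> ^^ n) z \<in> V})"
  have "null_in S" unfolding S_def using F U by (intro null_in_UN) auto
  moreover have "\<exists>n. X n \<in> S" if sad: "strict_saddle A g f x" and X: "\<And>n. X (Suc n) = step \<alpha> (X n)" "X \<longlonglongrightarrow> x" for X x
  proof -
    have "x \<in> \<Union>F" using U[OF sad] sad F(3) by blast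
    then obtain V where V: "V \<in> F" "x \<in> V" by blast
    have "open V" using V(1) F(1) U by blast
    from topological_tendstoD[OF X(2) this V(2)] have "eventually (\<lambda>n. X n \<in> V) sequentially" .
    then obtain N where N: "\<And>n. n \<ge> N \<Longrightarrow> X n \<in> V" by (auto simp: eventually_sequentially)
    have "(step \<alpha> ^^ n) (X N) = X (N + n)" for n by (induction n) (auto simp: X(1))
    then have "X N \<in> S" unfolding S_def by (intro UN_I[OF V(1)]) (simp add: N)
    then show ?thesis by blast
  qed
  ultimately show ?thesis by blast
qed

section \<open>The Armijo condition for small steps\<close>

definition armijo :: "real \<Rightarrow> 'm \<Rightarrow> real \<Rightarrow> bool" where
  "armijo r x \<alpha> \<longleftrightarrow> f x - f (step \<alpha> x) \<ge> r * \<alpha> * (tnorm g x (gr x))\<^sup>2"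

text \<open>The linear model decreases by \<alpha> |grad|^2, and the condition asks for the fraction
  \<open>r\<close> of it. The remaining fraction 1 - r pays for two errors, half each: the quadratic
  remainder of \<open>f\<close> and the deviation of the retraction from translation. It holds
  around every point, so it also yields termination of the backtracking loop.\<close>

lemma armijo_uniform:
  assumes r: "r < 1"
  shows "\<exists>\<delta>>0. \<exists>U. open U \<and> x \<in> U \<and> (\<forall>z\<in>U. \<forall>\<alpha>. 0 < \<alpha> \<and> \<alpha> \<le> \<delta> \<longrightarrow> armijo r z \<alpha>)"
proof -
  obtain c where c: "c \<in> A" "x \<in> cdom c" using cover by blast
  define y where "y = cmap c x"
  have y: "y \<in> cimg c" using c by (simp add: y_def)
  obtain d1 M where d1: "d1 > 0" "M > 0" "ball y d1 \<subseteq> cimg c"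
    "\<And>p q. p \<in> ball y d1 \<Longrightarrow> q \<in> ball y d1 \<Longrightarrow> norm (fh c q - fh c p - frechet_derivative (fh c) (at p) (q - p)) \<le> M * (norm (q - p))\<^sup>2"
    by (rule Ck_on_2_quadratic_remainder[OF fh_C2[OF c(1)] open_img[OF c(1)] y]) blast
  obtain k K d2 where d2: "k > 0" "K > 0" "d2 > 0" "ball y d2 \<subseteq> cimg c"
    "\<And>p u. p \<in> ball y d2 \<Longrightarrow> mc c p u u \<ge> k * (norm u)\<^sup>2"
    "\<And>p u v. p \<in> ball y d2 \<Longrightarrow> \<bar>mc c p u v\<bar> \<le> K * norm u * norm v"
    by (rule inner_form_field_bounds[OF open_img[OF c(1)] y inner_form_mc[OF c(1)] mc_strict[OF c(1) y]]) blast+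
  \<comment> \<open>Tolerance for the retraction: tested against the gradient, the error is at most
    \<open>K * e * \<alpha> * (norm G)\<^sup>2\<close>, half the budget.\<close>
  define e where "e = min 1 ((1 - r) * k / (2 * K))"
  have e: "e > 0" "e \<le> 1" "K * e \<le> (1 - r) * k / 2"
  proof -
    show "e > 0" "e \<le> 1" using r d2 by (auto simp: e_def)
    have "K * e \<le> K * ((1 - r) * k / (2 * K))" using d2 by (intro mult_left_mono) (auto simp: e_def)
    then show "K * e \<le> (1 - r) * k / 2" using d2(2) by simp
  qed
  obtain d3 where d3: "d3 > 0" "\<And>z z'. z \<in> ball (y, 0) d3 \<Longrightarrow> z' \<in> ball (y, 0) d3 \<Longrightarrow> norm (Phi c c z - Phi c c z' - DPhi c c (y, 0) (z - z')) \<le> e * norm (z - z')"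
    using has_strict_derivativeD[OF Phi_strict[OF c(1) c(1) zero_in_W[OF c(1) y]] e(1)] by metis
  obtain d4 where d4: "d4 > 0" "ball (y, 0) d4 \<subseteq> W c c" using openE[OF W_open[OF c(1) c(1)] zero_in_W[OF c(1) y]] by blast
  define g0 where "g0 = norm (gradc c y) + 1"
  have g0: "g0 > 0" by (simp add: g0_def add_nonneg_pos)
  have cont: "isCont (gradc c) y" by (rule has_strict_derivative_isCont[OF gradc_strict[OF c(1) y]])
  obtain d5 where d5: "d5 > 0" "\<And>p. dist p y < d5 \<Longrightarrow> dist (gradc c p) (gradc c y) < 1"
    using cont[unfolded continuous_at_eps_delta, THEN spec, THEN mp, of 1] by auto
  define D where "D = Min {d1, d2, d3, d4, d5}"
  have D: "D > 0" "D \<le> d1" "D \<le> d2" "D \<le> d3" "D \<le> d4" "D \<le> d5" using d1 d2 d3 d4 d5 by (auto simp: D_def)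
  \<comment> \<open>The first bound keeps the quadratic remainder, at most
    \<open>4 * M * \<alpha>\<^sup>2 * (norm G)\<^sup>2\<close>, within half the budget. The second
    keeps the step below \<open>D / 4\<close>, so that the new point, at most twice as far from
    \<open>p\<close>, stays in the ball.\<close>
  define \<delta> where "\<delta> = min ((1 - r) * k / (8 * M)) (D / (4 * g0))"
  have \<delta>: "\<delta> > 0" "\<delta> \<le> (1 - r) * k / (8 * M)" "\<delta> \<le> D / (4 * g0)" using r d2 d1 D g0 by (auto simp: \<delta>_def)
  let ?B = "ball y (D / 2)"
  have Bsub: "?B \<subseteq> cimg c" using d1(3) D by (auto simp: subset_iff)
  define U where "U = cinv c ` ?B"
  have U: "open U" unfolding U_def by (rule is_chart_open_cinv_image[OF chart[OF c(1)] open_ball Bsub])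
  have xU: "x \<in> U" unfolding U_def using cinv_cmap[OF c] D(1) by (auto simp: y_def image_iff intro!: bexI[of _ "cmap c x"])
  have "armijo r z \<alpha>" if z: "z \<in> U" and \<alpha>: "0 < \<alpha>" "\<alpha> \<le> \<delta>" for z \<alpha>
  proof -
    obtain p where p: "p \<in> ?B" "z = cinv c p" using z by (auto simp: U_def)
    have pc: "p \<in> cimg c" using p Bsub by blast
    define G where "G = gradc c p"
    define v where "v = (- \<alpha>) *\<^sub>R G"
    have "dist G (gradc c y) < 1" unfolding G_def using p(1) D by (intro d5(2)) (simp add: dist_commute)
    then have Gn: "norm G \<le> g0" using norm_triangle_ineq2[of G "gradc c y"] by (simp add: g0_def dist_norm)
    have vn: "norm v = \<alpha> * norm G" using \<alpha> by (simp add: v_def)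
    have "\<alpha> * norm G \<le> (D / (4 * g0)) * g0" using \<alpha> \<delta>(3) Gn g0 D(1) by (intro mult_mono) auto
    then have vD: "norm v \<le> D / 4" using g0 by (simp add: vn)
    have pD: "norm (y - p) < D / 2" using p(1) by (simp add: dist_norm)
    have "norm ((p, v) - (y, 0)) \<le> norm (p - y) + norm v" using norm_Pair_le[of "p - y" v] by simp
    also have "\<dots> < D" using pD vD D(1) by (simp add: norm_minus_commute)
    finally have pvD: "dist (y, 0) (p, v) < D" by (metis dist_commute dist_norm)
    have p0D: "dist (y, 0) (p, 0::'a) < D" using pD D(1) by (simp add: dist_Pair_Pair dist_norm)
    have pvW: "(p, v) \<in> W c c" using pvD D d4 by auto
    define q where "q = Phi c c (p, v)"
    have "norm (Phi c c (p, v) - Phi c c (p, 0) - DPhi c c (y, 0) ((p, v) - (p, 0))) \<le> e * norm ((p, v) - (p, 0))"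
      using pvD p0D D by (intro d3(2)) auto
    then have qv: "norm (q - p - v) \<le> e * norm v"
      by (simp add: q_def Phi_zero[OF c(1) pc] DPhi_zero[OF c(1) y] norm_Pair)
    have "norm (q - p) \<le> norm (q - p - v) + norm v" using norm_triangle_ineq[of "q - p - v" v] by simp
    also have "\<dots> \<le> 1 * norm v + norm v" using qv mult_right_mono[OF e(2), of "norm v"] by simp
    finally have qp: "norm (q - p) \<le> 2 * norm v" by simp
    have "dist y q \<le> norm (y - p) + norm (q - p)" using dist_triangle[of y q p] by (simp add: dist_norm norm_minus_commute)
    then have qD: "q \<in> ball y d1" using qp vD pD D by simp
    have pb: "p \<in> ball y d1" "p \<in> ball y d2" using p(1) D by auto
    have st: "step \<alpha> z = Rh c (p, v)" using step_coord[OF c(1) pc] by (simp add: p(2) v_def G_def)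
    have fq: "f (step \<alpha> z) = fh c q"
    proof -
      have "Rh c (p, v) \<in> cdom c" using pvW by (simp add: W_def)
      then show ?thesis by (simp add: st fh_def q_def Phi_def cinv_cmap[OF c(1)])
    qed
    have fp: "f z = fh c p" by (simp add: p(2) fh_def)
    have lin: "linear (df c p)" by (rule df_linear[OF c(1) pc])
    have riesz: "df c p u = mc c p G u" for u using gradc_riesz[OF c(1) pc] by (simp add: G_def)
    have t1: "fh c q - fh c p - df c p (q - p) \<le> M * (norm (q - p))\<^sup>2"
      using d1(4)[OF pb(1) qD] by (simp add: df_def)
    have "(norm (q - p))\<^sup>2 \<le> (2 * norm v)\<^sup>2" using qp by (intro power_mono) auto
    then have "M * (norm (q - p))\<^sup>2 \<le> M * (2 * norm v)\<^sup>2" using d1(2) by (intro mult_left_mono) auto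
    also have "\<dots> = (4 * M * \<alpha>) * (\<alpha> * (norm G)\<^sup>2)" by (simp add: vn power2_eq_square)
    also have "\<dots> \<le> ((1 - r) * k / 2) * (\<alpha> * (norm G)\<^sup>2)"
    proof (intro mult_right_mono)
      have "4 * M * \<alpha> \<le> 4 * M * ((1 - r) * k / (8 * M))" using \<alpha> \<delta>(2) d1(2) by (intro mult_left_mono) auto
      also have "\<dots> = (1 - r) * k / 2" using d1(2) by simp
      finally show "4 * M * \<alpha> \<le> (1 - r) * k / 2" .
    qed (use \<alpha> in auto)
    finally have t2: "M * (norm (q - p))\<^sup>2 \<le> ((1 - r) * k / 2) * (\<alpha> * (norm G)\<^sup>2)" .
    have "df c p (q - p - v) \<le> K * norm G * norm (q - p - v)" unfolding riesz using d2(6)[OF pb(2), of G "q - p - v"] by linarith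
    also have "\<dots> \<le> K * norm G * (e * norm v)" using qv d2(2) by (intro mult_left_mono) auto
    also have "\<dots> = (K * e) * (\<alpha> * (norm G)\<^sup>2)" by (simp add: vn power2_eq_square)
    also have "\<dots> \<le> ((1 - r) * k / 2) * (\<alpha> * (norm G)\<^sup>2)" using e(3) \<alpha> by (intro mult_right_mono) auto
    finally have t3: "df c p (q - p - v) \<le> ((1 - r) * k / 2) * (\<alpha> * (norm G)\<^sup>2)" .
    have t4: "df c p (q - p) = df c p (q - p - v) + df c p v" using linear_add[OF lin, of "q - p - v" v] by simp
    have t5: "df c p v = - \<alpha> * mc c p G G" unfolding v_def using linear_cmul[OF lin, of "- \<alpha>" G] riesz[of G] by simp
    have "(1 - r) * \<alpha> * (k * (norm G)\<^sup>2) \<le> (1 - r) * \<alpha> * mc c p G G"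
      using d2(5)[OF pb(2), of G] r \<alpha> by (intro mult_left_mono) auto
    moreover have "((1 - r) * k / 2) * (\<alpha> * (norm G)\<^sup>2) + ((1 - r) * k / 2) * (\<alpha> * (norm G)\<^sup>2) = (1 - r) * \<alpha> * (k * (norm G)\<^sup>2)"
      by (simp add: field_simps)
    ultimately have "fh c q - fh c p \<le> - \<alpha> * mc c p G G + (1 - r) * \<alpha> * mc c p G G"
      using t1 t2 t3 t4 t5 by linarith
    also have "\<dots> = - (r * \<alpha> * mc c p G G)" by (simp add: algebra_simps)
    finally have "r * \<alpha> * mc c p G G \<le> f z - f (step \<alpha> z)" by (simp add: fp fq)
    then show ?thesis using tnorm_grad[OF c(1) pc] by (simp add: armijo_def p(2) G_def)
  qed
  then show ?thesis using \<delta>(1) U xU by blast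
qed

lemma small_gradient_neighbourhood:
  assumes crit: "strict_saddle A g f x" and \<epsilon>: "\<epsilon> > 0"
  shows "\<exists>U. open U \<and> x \<in> U \<and> (\<forall>z\<in>U. tnorm g z (gr z) < \<epsilon>)"
proof -
  obtain c where c: "c \<in> A" "x \<in> cdom c" using cover by blast
  define y where "y = cmap c x"
  have y: "y \<in> cimg c" using c by (simp add: y_def)
  have G0: "gradc c y = 0" using saddle_eigenvector(1)[OF crit c] by (simp add: y_def)
  obtain k K d2 where d2: "k > 0" "K > 0" "d2 > 0" "ball y d2 \<subseteq> cimg c"
    "\<And>p u. p \<in> ball y d2 \<Longrightarrow> mc c p u u \<ge> k * (norm u)\<^sup>2"
    "\<And>p u v. p \<in> ball y d2 \<Longrightarrow> \<bar>mc c p u v\<bar> \<le> K * norm u * norm v"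
    by (rule inner_form_field_bounds[OF open_img[OF c(1)] y inner_form_mc[OF c(1)] mc_strict[OF c(1) y]]) blast+
  have cont: "isCont (gradc c) y" by (rule has_strict_derivative_isCont[OF gradc_strict[OF c(1) y]])
  \<comment> \<open>Since \<open>K \<le> (K + 1)\<^sup>2\<close>, dividing by \<open>K + 1\<close>
    is enough to bound the Riemannian norm.\<close>
  have pos: "\<epsilon> / (K + 1) > 0" using \<epsilon> d2 by simp
  obtain d5 where d5: "d5 > 0" "\<And>p. dist p y < d5 \<Longrightarrow> dist (gradc c p) (gradc c y) < \<epsilon> / (K + 1)"
    using cont[unfolded continuous_at_eps_delta, THEN spec, THEN mp, OF pos] by blast
  let ?B = "ball y (min d2 d5)"
  have Bsub: "?B \<subseteq> cimg c" using d2(4) by (auto simp: subset_iff)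
  define U where "U = cinv c ` ?B"
  have U: "open U" unfolding U_def by (rule is_chart_open_cinv_image[OF chart[OF c(1)] open_ball Bsub])
  have xU: "x \<in> U" unfolding U_def using cinv_cmap[OF c] d2(3) d5(1) by (auto simp: y_def image_iff intro!: bexI[of _ "cmap c x"])
  have "tnorm g z (gr z) < \<epsilon>" if z: "z \<in> U" for z
  proof -
    obtain p where p: "p \<in> ?B" "z = cinv c p" using z by (auto simp: U_def)
    have pc: "p \<in> cimg c" using p Bsub by blast
    have Gn: "norm (gradc c p) < \<epsilon> / (K + 1)" using d5(2)[of p] p(1) G0 by (simp add: dist_commute)
    have "(tnorm g z (gr z))\<^sup>2 \<le> K * (norm (gradc c p))\<^sup>2"
      using tnorm_grad[OF c(1) pc] d2(6)[of p "gradc c p" "gradc c p"] p by (simp add: power2_eq_square mult.assoc)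
    also have "\<dots> \<le> (K + 1)\<^sup>2 * (norm (gradc c p))\<^sup>2"
      using d2(2) by (intro mult_right_mono) (auto simp: power2_eq_square algebra_simps)
    also have "\<dots> = ((K + 1) * norm (gradc c p))\<^sup>2" by (simp add: power_mult_distrib)
    also have "\<dots> < \<epsilon>\<^sup>2"
      using Gn d2(2) by (intro power_strict_mono) (auto simp: pos_less_divide_eq mult.commute)
    finally show ?thesis using \<epsilon> by (rule power_less_imp_less_base[OF _ less_imp_le])
  qed
  then show ?thesis using U xU by blast
qed

end

section \<open>The algorithm\<close>

lemma eventually_constant_nat:
  fixes \<kappa> :: "nat \<Rightarrow> nat"
  assumes mono: "\<And>t. t \<ge> t0 \<Longrightarrow> \<kappa> t \<le> \<kappa> (Suc t)" and bound: "\<And>t. t \<ge> t0 \<Longrightarrow> \<kappa> t \<le> K"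
  shows "\<exists>t1\<ge>t0. \<forall>t\<ge>t1. \<kappa> t = \<kappa> t1"
proof -
  have fin: "finite (\<kappa> ` {t0..})" by (rule finite_subset[of _ "{..K}"]) (use bound in auto)
  then have "Max (\<kappa> ` {t0..}) \<in> \<kappa> ` {t0..}" by (rule Max_in) auto
  then obtain t1 where t1: "t1 \<ge> t0" "\<kappa> t1 = Max (\<kappa> ` {t0..})" by auto
  have "\<kappa> t = \<kappa> t1" if "t \<ge> t1" for t
  proof (rule antisym)
    show "\<kappa> t \<le> \<kappa> t1" unfolding t1(2) using fin that t1(1) by (intro Max_ge) auto
    show "\<kappa> t1 \<le> \<kappa> t" using that
    proof (induction t rule: dec_induct)
      case (step n)
      then show ?case using mono[of n] t1(1) by simp
    qed simp
  qed
  then show ?thesis using t1(1) by blast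
qed

context riemannian_retraction
begin

text \<open>Armijo holds for all small step sizes, so a least successful exponent exists and is
  where the loop stops. The second part says that an acceptable step size is left unchanged.\<close>

lemma backtrack_spec:
  assumes \<tau>: "0 < \<tau>" "\<tau> < 1" and r: "r < 1" and \<alpha>: "\<alpha> > 0"
  shows "\<exists>j. backtrack A g R f \<tau> r x \<alpha> = \<tau> ^ j * \<alpha> \<and> (armijo r x \<alpha> \<longrightarrow> j = 0)"
proof -
  obtain \<delta> U where \<delta>: "\<delta> > 0" "x \<in> U" "\<And>z \<alpha>. z \<in> U \<Longrightarrow> 0 < \<alpha> \<Longrightarrow> \<alpha> \<le> \<delta> \<Longrightarrow> armijo r z \<alpha>"
    using armijo_uniform[OF r, of x] by blast
  obtain n where n: "\<tau> ^ n < \<delta> / \<alpha>" using real_arch_pow_inv[of "\<delta> / \<alpha>" \<tau>] \<delta>(1) \<alpha> \<tau>(2) by auto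
  then have "\<tau> ^ n * \<alpha> \<le> \<delta>" using \<alpha> by (simp add: pos_less_divide_eq)
  then have ex: "armijo r x (\<tau> ^ n * \<alpha>)" using \<delta>(2) \<tau>(1) \<alpha> by (intro \<delta>(3)) auto
  define j where "j = (LEAST j. armijo r x (\<tau> ^ j * \<alpha>))"
  have j: "armijo r x (\<tau> ^ j * \<alpha>)" unfolding j_def by (rule LeastI[where P = "\<lambda>j. armijo r x (\<tau> ^ j * \<alpha>)", OF ex])
  have least: "\<not> armijo r x (\<tau> ^ i * \<alpha>)" if "i < j" for i using not_less_Least[of i "\<lambda>j. armijo r x (\<tau> ^ j * \<alpha>)"] that by (simp add: j_def)
  have "backtrack A g R f \<tau> r x \<alpha> = \<tau> ^ j * \<alpha>"
    unfolding backtrack_def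
    by (rule while_scale_eq) (use j least in \<open>auto simp: armijo_def not_le\<close>)
  moreover have "armijo r x \<alpha> \<longrightarrow> j = 0" using least[of 0] by auto
  ultimately show ?thesis by blast
qed

context
  fixes \<tau> r \<epsilon> abar :: real and x0 :: 'm
  assumes \<tau>: "0 < \<tau>" "\<tau> < 1" and r: "r < 1" and \<epsilon>: "\<epsilon> > 0" and abar: "abar > 0"
begin

abbreviation "iter \<equiv> sbgd A g R f \<tau> r \<epsilon> abar x0"
definition "trial t = snd (sbgd_state A g R f \<tau> r \<epsilon> abar x0 t)"
definition "accepted t = backtrack A g R f \<tau> r (iter t) (trial t)"

lemma iter_0: "iter 0 = x0" and trial_0: "trial 0 = abar"
  by (simp_all add: sbgd_def trial_def)

lemma iter_Suc: "iter (Suc t) = step (accepted t) (iter t)"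
  and trial_Suc: "trial (Suc t) = (if tnorm g (iter (Suc t)) (gr (iter (Suc t))) \<ge> \<epsilon> then abar else accepted t)"
  by (simp_all add: sbgd_def trial_def accepted_def Let_def case_prod_beta)

lemma trial_power: "\<exists>k. trial t = \<tau> ^ k * abar"
proof (induction t)
  case 0
  show ?case by (rule exI[of _ 0]) (simp add: trial_0)
next
  case (Suc t)
  then obtain k where k: "trial t = \<tau> ^ k * abar" by blast
  then have "trial t > 0" using \<tau> abar by simp
  then obtain j where "accepted t = \<tau> ^ j * trial t" using backtrack_spec[OF \<tau> r] unfolding accepted_def by blast
  then have acc: "accepted t = \<tau> ^ (j + k) * abar" by (simp add: k power_add)
  show ?case
  proof (cases "tnorm g (iter (Suc t)) (gr (iter (Suc t))) \<ge> \<epsilon>")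
    case True
    then show ?thesis by (intro exI[of _ 0]) (simp add: trial_Suc)
  next
    case False
    then show ?thesis by (intro exI[of _ "j + k"]) (simp add: trial_Suc acc)
  qed
qed

lemma trial_pos: "trial t > 0"
  using trial_power[of t] \<tau> abar by auto

lemma accepted_spec: "\<exists>j. accepted t = \<tau> ^ j * trial t \<and> (armijo r (iter t) (trial t) \<longrightarrow> j = 0)"
  unfolding accepted_def by (rule backtrack_spec[OF \<tau> r trial_pos])

text \<open>Resets return to \<open>abar\<close> and backtracking multiplies by \<tau>, so only
  countably many step sizes can occur for a given \<open>abar\<close>, whatever the initial
  point.\<close>

lemma accepted_power: "\<exists>k. accepted t = \<tau> ^ k * abar"
proof -
  obtain k where k: "trial t = \<tau> ^ k * abar" using trial_power by blast
  obtain j where "accepted t = \<tau> ^ j * trial t" using accepted_spec by blast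
  then have "accepted t = \<tau> ^ (j + k) * abar" by (simp add: k power_add)
  then show ?thesis by blast
qed

text \<open>Near the saddle the gradient stays below \<epsilon>, so the step size is never reset and
  can only decrease, by powers of \<tau>. It does so only finitely often.\<close>

lemma step_size_eventually_constant:
  assumes sad: "strict_saddle A g f x" and lim: "iter \<longlonglongrightarrow> x"
  shows "\<exists>k t1. \<forall>t\<ge>t1. iter (Suc t) = step (\<tau> ^ k * abar) (iter t)"
proof -
  obtain \<delta> U where \<delta>: "\<delta> > 0" "open U" "x \<in> U" "\<And>z \<alpha>. z \<in> U \<Longrightarrow> 0 < \<alpha> \<Longrightarrow> \<alpha> \<le> \<delta> \<Longrightarrow> armijo r z \<alpha>"
    using armijo_uniform[OF r, of x] by blast
  obtain V where V: "open V" "x \<in> V" "\<And>z. z \<in> V \<Longrightarrow> tnorm g z (gr z) < \<epsilon>"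
    using small_gradient_neighbourhood[OF sad \<epsilon>] by blast
  have "eventually (\<lambda>t. iter t \<in> U \<and> iter t \<in> V) sequentially"
    using topological_tendstoD[OF lim \<delta>(2,3)] topological_tendstoD[OF lim V(1,2)] by (rule eventually_conj)
  then obtain t0 where t0: "\<And>t. t \<ge> t0 \<Longrightarrow> iter t \<in> U" "\<And>t. t \<ge> t0 \<Longrightarrow> iter t \<in> V"
    unfolding eventually_sequentially by blast
  obtain \<kappa> where \<kappa>: "\<And>t. accepted t = \<tau> ^ \<kappa> t * abar" using accepted_power by metis
  have next_trial: "trial (Suc t) = accepted t" if "t \<ge> t0" for t
    using V(3)[OF t0(2), of "Suc t"] that by (simp add: trial_Suc)
  have next_acc: "accepted (Suc t) \<le> accepted t" "accepted t \<le> \<delta> \<Longrightarrow> accepted (Suc t) = accepted t" if t: "t \<ge> t0" for t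
  proof -
    obtain j where j: "accepted (Suc t) = \<tau> ^ j * accepted t" "armijo r (iter (Suc t)) (accepted t) \<longrightarrow> j = 0"
      using accepted_spec[of "Suc t"] next_trial[OF t] by auto
    have pos: "accepted t > 0" using \<kappa>[of t] \<tau> abar by simp
    show "accepted (Suc t) \<le> accepted t" using j(1) pos \<tau> by (simp add: mult_left_le_one_le power_le_one)
    show "accepted (Suc t) = accepted t" if "accepted t \<le> \<delta>"
      using j \<delta>(4)[OF t0(1)[of "Suc t"] pos that] t by simp
  qed
  have "\<exists>s\<ge>t0. \<forall>t\<ge>s. accepted t = accepted s"
  \<comment> \<open>Once at most \<delta>, the step size is always accepted and stays fixed. If it
    never gets there, its exponent is bounded, and a bounded monotone sequence of naturals
    stabilises.\<close>
  proof (cases "\<exists>s\<ge>t0. accepted s \<le> \<delta>")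
    case True
    then obtain s where s: "s \<ge> t0" "accepted s \<le> \<delta>" by blast
    have "accepted t = accepted s" if "t \<ge> s" for t
      using that
    proof (induction t rule: dec_induct)
      case (step n)
      then show ?case using next_acc(2)[of n] s by simp
    qed simp
    then show ?thesis using s(1) by blast
  next
    case False
    have mono: "\<kappa> t \<le> \<kappa> (Suc t)" if t: "t \<ge> t0" for t
    proof (rule ccontr)
      assume "\<not> \<kappa> t \<le> \<kappa> (Suc t)"
      then have "\<tau> ^ \<kappa> t < \<tau> ^ \<kappa> (Suc t)" using \<tau> by (intro power_strict_decreasing) auto
      then have "accepted t < accepted (Suc t)" using abar by (simp add: \<kappa>)
      then show False using next_acc(1)[OF t] by simp
    qed
    obtain K where K: "\<tau> ^ K < \<delta> / abar" using real_arch_pow_inv[of "\<delta> / abar" \<tau>] \<delta>(1) abar \<tau>(2) by auto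
    have bound: "\<kappa> t \<le> K" if t: "t \<ge> t0" for t
    proof (rule ccontr)
      assume "\<not> \<kappa> t \<le> K"
      then have "\<tau> ^ \<kappa> t \<le> \<tau> ^ K" using \<tau> by (intro power_decreasing) auto
      then have "\<tau> ^ \<kappa> t * abar < \<delta>" using K abar by (simp add: pos_less_divide_eq) (meson less_le_trans mult_right_mono not_le less_imp_le order.strict_trans1)
      then show False using False t by (auto simp: \<kappa>)
    qed
    obtain t1 where t1: "t1 \<ge> t0" "\<And>t. t \<ge> t1 \<Longrightarrow> \<kappa> t = \<kappa> t1"
      using eventually_constant_nat[of t0 \<kappa>, OF mono bound] by blast
    have "accepted t = accepted t1" if "t \<ge> t1" for t
      unfolding \<kappa> by (subst t1(2)[OF that]) (rule refl)
    then show ?thesis using t1(1) by blast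
  qed
  then obtain s where s: "\<And>t. t \<ge> s \<Longrightarrow> accepted t = accepted s" by blast
  have "iter (Suc t) = step (\<tau> ^ \<kappa> s * abar) (iter t)" if "t \<ge> s" for t
    by (simp only: iter_Suc s[OF that] \<kappa>[of s])
  then show ?thesis by blast
qed

end

text \<open>An orbit converging to a saddle enters the null set of one constant step size after
  finitely many steps, each taken with a step size \<open>\<tau> ^ k * abar\<close>. Hence its
  initial point lies in a countable union of iterated preimages of null sets.\<close>

lemma sbgd_avoids:
  assumes \<tau>: "0 < \<tau>" "\<tau> < 1" and r: "r < 1" and \<epsilon>: "\<epsilon> > 0"
  shows "AE abar in lebesgue. abar > 0 \<longrightarrow> sbgd_avoids_strict_saddles A g R f \<tau> r \<epsilon> abar"
proof -
  obtain A' where A': "A' \<subseteq> A" "countable A'" "(\<Union>c\<in>A'. cdom c) = UNIV" by (rule countable_subatlas)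
  define good where "good \<alpha> \<longleftrightarrow> (\<forall>c\<in>A'. negligible {y \<in> cimg c. \<not> nonsing c y \<alpha>})" for \<alpha>
  have "AE \<alpha> in lborel. good \<alpha>"
    unfolding good_def AE_ball_countable[OF A'(2)] using AE_negligible_singular A'(1) by blast
  then obtain N where N: "{\<alpha> \<in> space lborel. \<not> good \<alpha>} \<subseteq> N" "N \<in> null_sets lborel"
    by (auto simp: eventually_ae_filter)
  have Nn: "negligible N" using N(2) by (simp add: negligible_iff_null_sets null_sets_completionI)
  \<comment> \<open>Values of \<open>abar\<close> for which some \<open>\<tau> ^ k * abar\<close> is
    bad: a countable union of rescaled null sets.\<close>
  define N' where "N' = (\<Union>k::nat. {a. \<tau> ^ k * a \<in> N})"
  have "negligible N'" unfolding N'_def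
    using \<tau> Nn by (intro negligible_countable_Union) (auto intro!: negligible_scale_preimage)
  then have E: "AE abar in lebesgue. abar \<notin> N'" by (intro AE_not_in) (simp add: negligible_iff_null_sets)
  show ?thesis
  proof (rule AE_mp[OF E], rule AE_I2, intro impI)
    fix abar :: real assume aN: "abar \<notin> N'" and a: "abar > 0"
    have good: "negligible {y \<in> cimg c. \<not> nonsing c y (\<tau> ^ k * abar)}" if "c \<in> A'" for c and k :: nat
    proof -
      have "\<tau> ^ k * abar \<notin> N" using aN by (auto simp: N'_def)
      then show ?thesis using N(1) that by (auto simp: good_def)
    qed
    have "\<tau> ^ k * abar > 0" for k using \<tau> a by simp
    from saddle_stable_null[OF this]
    obtain S where S: "\<And>k. null_in (S k)"
      "\<And>k X x. strict_saddle A g f x \<Longrightarrow> (\<And>n. X (Suc n) = step (\<tau> ^ k * abar) (X n)) \<Longrightarrow> X \<longlonglongrightarrow> x \<Longrightarrow> \<exists>n. X n \<in> S k"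
      by metis
    \<comment> \<open>The exponents used before stabilisation depend on the initial point, so the
      preimages under all possible step sizes are united.\<close>
    define pre where "pre M = (\<Union>k::nat. {x. step (\<tau> ^ k * abar) x \<in> M})" for M
    define P where "P n = (pre ^^ n) (\<Union>k. S k)" for n
    have Pnull: "null_in (P n)" for n
    proof (induction n)
      case 0
      show ?case unfolding P_def by (simp, intro null_in_UN) (auto intro: S(1))
    next
      case (Suc n)
      then have "null_in (pre (P n))" unfolding pre_def
        by (intro null_in_UN null_in_step_preimage[OF A' good]) auto
      then show ?case by (simp add: P_def)
    qed
    have "{x0. \<exists>x. strict_saddle A g f x \<and> sbgd A g R f \<tau> r \<epsilon> abar x0 \<longlonglongrightarrow> x} \<subseteq> (\<Union>n. P n)"
    proof clarify
      fix x0 x assume sad: "strict_saddle A g f x" and lim: "sbgd A g R f \<tau> r \<epsilon> abar x0 \<longlonglongrightarrow> x"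
      let ?X = "sbgd A g R f \<tau> r \<epsilon> abar x0"
      obtain k t1 where k: "\<And>t. t \<ge> t1 \<Longrightarrow> ?X (Suc t) = step (\<tau> ^ k * abar) (?X t)"
        using step_size_eventually_constant[OF \<tau> r \<epsilon> a sad lim] by blast
      have "(\<lambda>n. ?X (n + t1)) \<longlonglongrightarrow> x" using lim by (rule LIMSEQ_ignore_initial_segment)
      then obtain n where n: "?X (n + t1) \<in> S k" using S(2)[OF sad, of "\<lambda>n. ?X (n + t1)" k] k by auto
      \<comment> \<open>Each step back adds one application of \<open>pre\<close>, with the exponent
        actually used at that iteration.\<close>
      have backward: "?X t \<in> P n \<Longrightarrow> ?X 0 \<in> P (n + t)" for t n
      proof (induction t arbitrary: n)
        case (Suc t)
        obtain j where "accepted \<tau> r \<epsilon> abar x0 t = \<tau> ^ j * abar" using accepted_power[OF \<tau> r \<epsilon> a] by blast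
        then have "step (\<tau> ^ j * abar) (?X t) \<in> P n" using Suc.prems iter_Suc[OF \<tau> r \<epsilon> a] by simp
        then have "?X t \<in> P (Suc n)" by (auto simp: P_def pre_def)
        from Suc.IH[OF this] show ?case by simp
      qed simp
      have "?X (n + t1) \<in> P 0" using n by (auto simp: P_def)
      from backward[OF this] have "?X 0 \<in> P (0 + (n + t1))" .
      then show "x0 \<in> (\<Union>n. P n)" using iter_0[OF \<tau> r \<epsilon> a, of x0] by auto
    qed
    moreover have "null_in (\<Union>n. P n)" by (intro null_in_UN Pnull) auto
    ultimately have "null_in {x0. \<exists>x. strict_saddle A g f x \<and> sbgd A g R f \<tau> r \<epsilon> abar x0 \<longlonglongrightarrow> x}"
      using null_in_subset by blast
    then show "sbgd_avoids_strict_saddles A g R f \<tau> r \<epsilon> abar"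
      unfolding sbgd_avoids_strict_saddles_def by (rule null_in_imp_measure_zero)
  qed
qed

end

section \<open>Euclidean space\<close>

lemma Ck_on_const: "Ck_on k S (\<lambda>x. c)"
  by (induction k arbitrary: c) (auto simp: frechet_derivative_const)

lemma smooth_on_bounded_linear:
  assumes "bounded_linear h"
  shows "smooth_on S h"
  unfolding smooth_on_def
proof
  have "frechet_derivative h (at x) = h" for x
    using bounded_linear_imp_has_derivative[OF assms] frechet_derivative_at by metis
  moreover have "h differentiable at x" for x using bounded_linear_imp_differentiable[OF assms] .
  ultimately show "Ck_on k S h" for k
    using linear_continuous_on[OF assms] by (cases k) (auto simp: Ck_on_const)
qed

text \<open>The expansion is finite, with a constant term and the linear terms. The work lies in
  naming the multi-indices as extensional functions on \<open>Basis\<close>.\<close>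

lemma real_analytic_on_translation:
  "real_analytic_on S (\<lambda>x::'e::euclidean_space. v + x)"
  unfolding real_analytic_on_def
proof
  fix a :: 'e
  define z where "z = (\<lambda>b\<in>Basis::'e set. 0::nat)"
  define e where "e b = (\<lambda>b'\<in>Basis::'e set. if b' = b then 1 else 0::nat)" for b
  \<comment> \<open>At the unit index \<open>e b\<close> the sum over the basis collapses to the
    vector \<open>b\<close>; this form avoids inverting \<open>e\<close>.\<close>
  define coef where "coef \<kappa> = (if \<kappa> = z then v + a else if \<kappa> \<in> e ` Basis then (\<Sum>b\<in>Basis. real (\<kappa> b) *\<^sub>R b) else 0)" for \<kappa>
  let ?T = "insert z (e ` Basis)"
  have eb: "e b b = 1" if "b \<in> Basis" for b using that by (simp add: e_def)
  have inj: "inj_on e Basis"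
  proof (rule inj_onI)
    fix b b' assume b: "b \<in> Basis" "b' \<in> Basis" "e b = e b'"
    then have "e b' b = 1" using eb by metis
    then show "b = b'" using b by (auto simp: e_def split: if_splits)
  qed
  have zne: "z \<notin> e ` Basis"
  proof
    assume "z \<in> e ` Basis"
    then obtain b where b: "b \<in> Basis" "z = e b" by blast
    then have "z b = 1" using eb by simp
    then show False using b(1) by (simp add: z_def)
  qed
  have ce: "coef (e b) = b" if b: "b \<in> Basis" for b
  proof -
    have "coef (e b) = (\<Sum>b'\<in>Basis. real (e b b') *\<^sub>R b')" using zne b by (auto simp: coef_def)
    also have "\<dots> = (\<Sum>b'\<in>Basis. if b' = b then b' else 0)" by (intro sum.cong) (auto simp: e_def)
    finally show ?thesis using b by simp
  qed
  have me: "(\<Prod>b'\<in>Basis. (u \<bullet> b') ^ e b b') = u \<bullet> b" if b: "b \<in> Basis" for b u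
  proof -
    have "(\<Prod>b'\<in>Basis. (u \<bullet> b') ^ e b b') = (\<Prod>b'\<in>Basis. if b' = b then u \<bullet> b' else 1)" by (intro prod.cong) (auto simp: e_def)
    then show ?thesis using b by simp
  qed
  have mz: "(\<Prod>b'\<in>Basis. (u \<bullet> b') ^ z b') = 1" for u by (intro prod.neutral) (simp add: z_def)
  have "((\<lambda>\<kappa>. (\<Prod>b\<in>Basis. ((x - a) \<bullet> b) ^ \<kappa> b) *\<^sub>R coef \<kappa>) has_sum (v + x)) (Basis \<rightarrow>\<^sub>E UNIV)" for x
  proof -
    let ?t = "\<lambda>\<kappa>. (\<Prod>b\<in>Basis. ((x - a) \<bullet> b) ^ \<kappa> b) *\<^sub>R coef \<kappa>"
    have "(?t has_sum (sum ?t ?T)) ?T" by (rule has_sum_finite) auto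
    also have "sum ?t ?T = (v + a) + (\<Sum>b\<in>Basis. ?t (e b))"
      using zne inj by (subst sum.insert) (auto simp: sum.reindex mz coef_def)
    also have "(\<Sum>b\<in>Basis. ?t (e b)) = (\<Sum>b\<in>Basis. ((x - a) \<bullet> b) *\<^sub>R b)" by (intro sum.cong refl) (simp add: me ce)
    also have "(v + a) + \<dots> = v + x" by (simp add: euclidean_representation)
    also have "(?t has_sum (v + x)) ?T \<longleftrightarrow> (?t has_sum (v + x)) (Basis \<rightarrow>\<^sub>E UNIV)"
    proof (rule has_sum_cong_neutral)
      have "?T \<subseteq> Basis \<rightarrow>\<^sub>E UNIV" by (auto simp: z_def e_def)
      then show "?t \<kappa> = 0" if "\<kappa> \<in> ?T - (Basis \<rightarrow>\<^sub>E UNIV)" for \<kappa> using that by blast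
      show "?t \<kappa> = 0" if "\<kappa> \<in> (Basis \<rightarrow>\<^sub>E UNIV) - ?T" for \<kappa> using that by (simp add: coef_def)
    qed simp
    finally show ?thesis .
  qed
  then show "\<exists>\<rho>>0. \<exists>coef. \<forall>x\<in>ball a \<rho>. ((\<lambda>\<kappa>. (\<Prod>b\<in>Basis. ((x - a) \<bullet> b) ^ \<kappa> b) *\<^sub>R coef \<kappa>) has_sum (v + x)) (Basis \<rightarrow>\<^sub>E UNIV)"
    by (intro exI[of _ 1] conjI exI[of _ coef]) auto
qed

lemma euclidean_chart_simps:
  "cdom euclidean_chart = UNIV" "cmap euclidean_chart = (\<lambda>x. x)" "cimg euclidean_chart = UNIV" "cinv euclidean_chart = (\<lambda>x. x)"
  by (simp_all add: euclidean_chart_def fun_eq_iff inv_into_f_eq)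

lemma charts_at_euclidean: "charts_at euclidean_atlas x = {euclidean_chart}"
  by (auto simp: charts_at_def euclidean_atlas_def euclidean_chart_simps)

lemma transition_euclidean: "transition_deriv euclidean_chart euclidean_chart x = (\<lambda>u. u)"
proof -
  have "((\<lambda>y::'a. y) has_derivative (\<lambda>u. u)) (at x)" by (rule has_derivative_ident)
  from frechet_derivative_at[OF this] show ?thesis by (simp add: transition_deriv_def euclidean_chart_simps o_def)
qed

lemma coord_vec_euclidean: "coord_vec euclidean_atlas euclidean_chart x a euclidean_chart = a"
  by (simp add: coord_vec_def charts_at_euclidean transition_euclidean)

lemma tangent_space_euclidean: "tangent_space euclidean_atlas x = {v. \<forall>c. c \<noteq> euclidean_chart \<longrightarrow> v c = 0}"
  by (auto simp only: tangent_space_def charts_at_euclidean transition_euclidean singleton_iff)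

lemma analytic_manifold_euclidean: "analytic_manifold (euclidean_atlas :: ('e::euclidean_space, 'e) chart set)"
proof
  have ra: "real_analytic_on S (\<lambda>x::'e. x)" for S using real_analytic_on_translation[of S 0] by simp
  have "is_chart (euclidean_chart :: ('e, 'e) chart)"
    unfolding is_chart_def euclidean_chart_simps by (simp add: homeomorphism_ident)
  then show "real_analytic_atlas (euclidean_atlas :: ('e, 'e) chart set)"
    unfolding is_atlas_def euclidean_atlas_def compatible_def
    by (simp add: euclidean_chart_simps o_def ra)
qed

lemma riemannian_metric_flat: "riemannian_metric euclidean_atlas (flat_metric :: ('e::euclidean_space, 'e) metric)"
proof -
  have pos: "flat_metric x u u > 0" if "u \<in> tangent_space euclidean_atlas x" "u \<noteq> tzero" for x :: 'e and u
  proof -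
    have "u euclidean_chart \<noteq> 0"
    proof
      assume "u euclidean_chart = 0"
      then have "u c = 0" for c using that(1) by (cases "c = euclidean_chart") (auto simp only: tangent_space_euclidean mem_Collect_eq)
      then show False using that(2) by (simp add: tzero_def fun_eq_iff)
    qed
    then show ?thesis by (simp add: flat_metric_def)
  qed
  have "smooth_on S (\<lambda>y::'e. metric_coeff euclidean_atlas flat_metric euclidean_chart y a b)" for S a b
    by (simp add: metric_coeff_def flat_metric_def coord_vec_euclidean euclidean_chart_simps smooth_on_def Ck_on_const)
  then show ?thesis using pos unfolding riemannian_metric_def
    by (simp add: euclidean_atlas_def flat_metric_def tadd_def tscale_def inner_commute inner_add_left inner_add_right)
qed

lemma is_retraction_translation: "is_retraction euclidean_atlas (translation_retraction :: 'e::euclidean_space \<Rightarrow> _)"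
  unfolding is_retraction_def
proof (intro conjI ballI allI)
  have F: "(\<lambda>(y::'e, a). translation_retraction (cinv euclidean_chart y) (coord_vec euclidean_atlas euclidean_chart (cinv euclidean_chart y) a)) = (\<lambda>z. fst z + snd z)"
    by (simp add: fun_eq_iff translation_retraction_def coord_vec_euclidean euclidean_chart_simps)
  have bl: "bounded_linear (\<lambda>z::'e \<times> 'e. fst z + snd z)" by (intro bounded_linear_add bounded_linear_fst bounded_linear_snd)
  fix c :: "('e, 'e) chart" assume c: "c \<in> euclidean_atlas"
  show "map_into smooth_on euclidean_atlas (cimg c \<times> UNIV) (\<lambda>(y, a). translation_retraction (cinv c y) (coord_vec euclidean_atlas c (cinv c y) a))"
    using c unfolding euclidean_atlas_def singleton_iff
    by (simp only: F[unfolded euclidean_atlas_def]) (simp add: map_into_def euclidean_chart_simps o_def smooth_on_bounded_linear[OF bl] linear_continuous_on[OF bl])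
next
  fix x :: 'e and v assume v: "v \<in> tangent_space euclidean_atlas x"
  have \<gamma>: "(\<lambda>t. translation_retraction x (tscale t v)) = (\<lambda>t. x + t *\<^sub>R v euclidean_chart)"
    by (simp add: translation_retraction_def tscale_def)
  show "translation_retraction x (tscale 0 v) = x" by (simp add: translation_retraction_def tscale_def)
  have "((\<lambda>t. x + t *\<^sub>R v euclidean_chart) has_vector_derivative v euclidean_chart) (at 0)"
    by (auto intro!: derivative_eq_intros)
  then show "has_velocity euclidean_atlas (\<lambda>t. translation_retraction x (tscale t v)) v 0"
    unfolding has_velocity_def \<gamma> using v
    by (simp add: charts_at_euclidean euclidean_chart_simps o_def)
qed

lemma fiberwise_real_analytic_translation: "fiberwise_real_analytic euclidean_atlas (translation_retraction :: 'e::euclidean_space \<Rightarrow> _)"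
proof -
  have F: "(\<lambda>a. translation_retraction x (coord_vec euclidean_atlas euclidean_chart x a)) = (\<lambda>a. x + a)" for x :: 'e
    by (simp add: fun_eq_iff translation_retraction_def coord_vec_euclidean)
  have "map_into real_analytic_on euclidean_atlas UNIV (\<lambda>a. x + a)" for x :: 'e
    unfolding map_into_def euclidean_atlas_def
    by (auto simp: euclidean_chart_simps o_def real_analytic_on_translation intro!: continuous_intros)
  then show ?thesis unfolding fiberwise_real_analytic_def charts_at_euclidean by (simp add: F)
qed

theorem theorem4p1:
  fixes h :: "'e::euclidean_space \<Rightarrow> real"
    and A :: "('m::{t2_space, second_countable_topology}, 'a::euclidean_space) chart set"
    and g :: "('m, 'a) metric"
    and R :: "'m \<Rightarrow> ('m, 'a) tvec \<Rightarrow> 'm"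
    and f :: "'m \<Rightarrow> real"
    and \<tau> r \<epsilon> :: real
  assumes "0 < \<tau>" "\<tau> < 1" "0 < r" "r < 1" "0 < \<epsilon>"
  shows
    "(Ck_fun 2 euclidean_atlas h \<longrightarrow>
        (AE \<alpha>bar in lebesgue. \<alpha>bar > 0 \<longrightarrow>
           sbgd_avoids_strict_saddles euclidean_atlas flat_metric translation_retraction
             h \<tau> r \<epsilon> \<alpha>bar))
     \<and>
     (real_analytic_atlas A \<and> riemannian_metric A g \<and> is_retraction A R \<and>
      fiberwise_real_analytic A R \<and> Ck_fun 2 A f \<longrightarrow>
        (AE \<alpha>bar in lebesgue. \<alpha>bar > 0 \<longrightarrow>
           sbgd_avoids_strict_saddles A g R f \<tau> r \<epsilon> \<alpha>bar))"
proof (intro conjI impI)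
  assume "Ck_fun 2 euclidean_atlas h"
  \<comment> \<open>Euclidean space with translations is an instance of the manifold
    setting.\<close>
  then have "riemannian_retraction euclidean_atlas flat_metric translation_retraction h"
    by (intro riemannian_retraction.intro riemannian_retraction_axioms.intro analytic_manifold_euclidean
        riemannian_metric_flat is_retraction_translation fiberwise_real_analytic_translation)
  from riemannian_retraction.sbgd_avoids[OF this assms(1,2,4,5)]
  show "AE \<alpha>bar in lebesgue. \<alpha>bar > 0 \<longrightarrow>
           sbgd_avoids_strict_saddles euclidean_atlas flat_metric translation_retraction h \<tau> r \<epsilon> \<alpha>bar" .
next
  assume "real_analytic_atlas A \<and> riemannian_metric A g \<and> is_retraction A R \<and>
      fiberwise_real_analytic A R \<and> Ck_fun 2 A f"
  then have "riemannian_retraction A g R f"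
    by (intro riemannian_retraction.intro riemannian_retraction_axioms.intro analytic_manifold.intro) auto
  from riemannian_retraction.sbgd_avoids[OF this assms(1,2,4,5)]
  show "AE \<alpha>bar in lebesgue. \<alpha>bar > 0 \<longrightarrow> sbgd_avoids_strict_saddles A g R f \<tau> r \<epsilon> \<alpha>bar" .
qed

end
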